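(* Let $E$ be a directed graph (with at least one vertex) and $K$ a (nonzero, unital) von Neumann regular commutative ring. The following are equivalent: (1) the Leavitt path algebra $L_K(E)$ is von Neumann regular; (2) $E$ is acyclic; (3) the boundary path groupoid $\mathscr G_E$ is principal; (4) $\mathscr G_E$ is an approximately quasi-compact groupoid.
   Context: A ring $A$ (not necessarily unital) is von Neumann regular if for every $a\in A$ there is $b\in A$ with $aba=a$. A directed graph $E=(E^0,E^1,r,s)$ has arbitrary sets of vertices $E^0$ and edges $E^1$ and maps $r,s\colon E^1\to E^0$. A path is a sequence of edges $e_1e_2\cdots$ with $r(e_i)=s(e_{i+1})$; $E^*$ is the set of finite paths (with a path of length $0$ at each vertex), $E^\infty$ the set of infinite paths, $|\mu|$ denotes length, and $r,s$ extend to paths. $E$ is acyclic if there is no finite path $\mu$ of positive length with $s(\mu)=r(\mu)$. A vertex $v$ is regular if $0<|s^{-1}(v)|<\infty$, otherwise singular; $E_{\mathrm{sing}}$ is the set of singular vertices. $L_K(E)$ is the $K$-algebra generated by $\{v\mid v\in E^0\}\cup\{e,e^*\mid e\in E^1\}$ subject to: $vw=\delta_{v,w}v$; $s(e)e=e=er(e)$ and $r(e)e^*=e^*=e^*s(e)$; $e^*f=\delta_{e,f}r(e)$; and $v=\sum_{s(e)=v}ee^*$ for every regular vertex $v$. The boundary path space is $\partial E=E^\infty\cup\{\mu\in E^*\mid r(\mu)\in E_{\mathrm{sing}}\}$. For $\mu\in E^*$ and finite $F\subseteq s^{-1}(r(\mu))$ put $Z(\mu)=\{\mu x\in\partial E\mid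 x\in\partial E,\ s(x)=r(\mu)\}$ and $Z(\mu\setminus F)=Z(\mu)\setminus\bigcup_{e\in F}Z(\mu e)$; these latter sets form a basis of compact open sets of a locally compact Hausdorff topology on $\partial E$. Let $\partial E^{\ge n}$ be the set of elements of length at least $n$ and $\sigma^n\colon\partial E^{\geq n}\to\partial E$ the map deleting the first $n$ edges. Then $\mathscr G_E=\{(x,m-n,y)\in\partial E\times\mathbb Z\times\partial E\mid x\in\partial E^{\ge m},\ y\in\partial E^{\ge n},\ \sigma^m(x)=\sigma^n(y)\}$ with product $(x,m,y)(y,n,z)=(x,m+n,z)$ and inverse $(x,m,y)^{-1}=(y,-m,x)$; its topology has as basis the sets $Z(\mu,F,\nu)=\{(x,|\mu|-|\nu|,y)\in\mathscr G_E\mid x\in Z(\mu\setminus F),\ y\in Z(\nu\setminus F),\ \sigma^{|\mu|}(x)=\sigma^{|\nu|}(y)\}$ for $\mu,\nu\in E^*$ with $r(\mu)=r(\nu)$ and $F\subseteq s^{-1}(r(\mu))$ finite. It is a Hausdorff ample groupoid. A groupoid is principal if all its isotropy groups (groups of arrows with source and range equal to a given unit) are trivial. An ample groupoid is approximately quasi-compact if it is a directed union (under inclusion) of quasi-compact open subgroupoids, where quasi-compact means every open cover has a finite subcover. *)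

theory Defs
  imports
    "HOL-Algebra.QuotRing"
    "HOL-Library.Poly_Mapping"
    "HOL-Library.Stream"
    "HOL-Library.Extended_Nat"
    "HOL-Analysis.Abstract_Topology"
    "Graph_Theory.Arc_Walk"
begin

section \<open>Von Neumann regularity\<close>

text \<open>
  No unit is involved, so the notion is stated for a set with a multiplication; it is used both for
  the coefficient ring (a type of class \<^class>\<open>comm_ring_1\<close>) and for the carrier of a ring record.
\<close>

definition von_neumann_regular :: "'a set \<Rightarrow> ('a \<Rightarrow> 'a \<Rightarrow> 'a) \<Rightarrow> bool" where
  "von_neumann_regular A mul \<longleftrightarrow> (\<forall>a\<in>A. \<exists>b\<in>A. mul (mul a b) a = a)"

section \<open>Directed graphs\<close>

text \<open>
  A directed graph is a \<^const>\<open>wf_digraph\<close>, with \<^const>\<open>tail\<close> in the role of $s$ and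
  \<^const>\<open>head\<close> in the role of $r$; vertex and edge sets are arbitrary.  A finite path is a pair
  \<open>(u, p)\<close> of its source and its list of edges with \<^term>\<open>pre_digraph.awalk E u p v\<close>, where \<open>v\<close> is
  its range; the path of length \<open>0\<close> at \<open>v\<close> is \<open>(v, [])\<close>.
\<close>

definition acyclic_digraph :: "('v, 'e) pre_digraph \<Rightarrow> bool" where
  "acyclic_digraph E \<longleftrightarrow> \<not> (\<exists>u p. p \<noteq> [] \<and> pre_digraph.awalk E u p u)"

definition regular_vertex :: "('v, 'e) pre_digraph \<Rightarrow> 'v \<Rightarrow> bool" where
  "regular_vertex E v \<longleftrightarrow> v \<in> verts E \<and> out_arcs E v \<noteq> {} \<and> finite (out_arcs E v)"

definition singular_verts :: "('v, 'e) pre_digraph \<Rightarrow> 'v set" where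
  "singular_verts E = {v \<in> verts E. \<not> regular_vertex E v}"

section \<open>Free algebras\<close>

text \<open>
  The free monoid, written additively because the multiplication on \<^typ>\<open>'m \<Rightarrow>\<^sub>0 'k\<close> is convolution
  over a \<^class>\<open>monoid_add\<close>.
\<close>

datatype 'x free_monoid = Word (letters: "'x list")

instantiation free_monoid :: (type) monoid_add
begin

definition zero_free_monoid where
  "0 = Word []"

definition plus_free_monoid where
  "v + w = Word (letters v @ letters w)"

instance
  by standard (auto simp: zero_free_monoid_def plus_free_monoid_def)

end

lemma letters_zero [simp]: "letters 0 = []"
  by (simp add: zero_free_monoid_def)

lemma letters_plus [simp]: "letters (v + w) = letters v @ letters w"
  by (simp add: plus_free_monoid_def)

text \<open>The free unital associative algebra on \<open>X\<close> over the commutative ring \<^typ>\<open>'k\<close>.\<close>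

definition free_algebra :: "'x set \<Rightarrow> ('x free_monoid \<Rightarrow>\<^sub>0 'k::comm_ring_1) ring" where
  "free_algebra X = \<lparr>carrier = {p. \<forall>w\<in>Poly_Mapping.keys p. set (letters w) \<subseteq> X},
     mult = (*), one = 1, zero = 0, add = (+)\<rparr>"

lemma ring_free_algebra: "ring (free_algebra X :: ('x free_monoid \<Rightarrow>\<^sub>0 'k::comm_ring_1) ring)"
proof (rule ringI)
  let ?F = "free_algebra X :: ('x free_monoid \<Rightarrow>\<^sub>0 'k) ring"
  show "abelian_group ?F"
  proof (rule abelian_groupI)
    fix p assume p: "p \<in> carrier ?F"
    show "\<exists>q\<in>carrier ?F. q \<oplus>\<^bsub>?F\<^esub> p = \<zero>\<^bsub>?F\<^esub>"
      by (rule bexI[of _ "- p"]) (use p in \<open>auto simp: free_algebra_def\<close>)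
  qed (auto simp: free_algebra_def add_ac dest: set_mp[OF Poly_Mapping.keys_add])
  show "monoid ?F"
    by (unfold_locales;
        auto simp: free_algebra_def mult.assoc dest!: set_mp[OF Poly_Mapping.keys_mult]; blast)
qed (auto simp: free_algebra_def algebra_simps)

section \<open>Leavitt path algebras\<close>

datatype ('v, 'e) lpa_gen = Vertex 'v | Edge 'e | Ghost 'e

definition lpa_gens :: "('v, 'e) pre_digraph \<Rightarrow> ('v, 'e) lpa_gen set" where
  "lpa_gens E = Vertex ` verts E \<union> Edge ` arcs E \<union> Ghost ` arcs E"

definition gen :: "'x \<Rightarrow> ('x free_monoid \<Rightarrow>\<^sub>0 'k::comm_ring_1)" where
  "gen x = Poly_Mapping.single (Word [x]) 1"

text \<open>A relation $l = r$ is represented by the element $l - r$ of the free algebra.\<close>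

definition lpa_relations ::
    "('v, 'e) pre_digraph \<Rightarrow> (('v, 'e) lpa_gen free_monoid \<Rightarrow>\<^sub>0 'k::comm_ring_1) set" where
  "lpa_relations E =
     {gen (Vertex v) * gen (Vertex w) - (if v = w then gen (Vertex v) else 0) | v w.
        v \<in> verts E \<and> w \<in> verts E} \<union>
     {gen (Vertex (tail E e)) * gen (Edge e) - gen (Edge e) | e. e \<in> arcs E} \<union>
     {gen (Edge e) * gen (Vertex (head E e)) - gen (Edge e) | e. e \<in> arcs E} \<union>
     {gen (Vertex (head E e)) * gen (Ghost e) - gen (Ghost e) | e. e \<in> arcs E} \<union>
     {gen (Ghost e) * gen (Vertex (tail E e)) - gen (Ghost e) | e. e \<in> arcs E} \<union>
     {gen (Ghost e) * gen (Edge f) - (if e = f then gen (Vertex (head E e)) else 0) | e f.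
        e \<in> arcs E \<and> f \<in> arcs E} \<union>
     {gen (Vertex v) - (\<Sum>e\<in>out_arcs E v. gen (Edge e) * gen (Ghost e)) | v.
        regular_vertex E v}"

text \<open>
  $L_K(E)$ is not unital in general.  The free non-unital algebra on the generators consists of the
  elements of the free unital algebra without constant term.  All relations lie in it, and its
  algebra ideal generated by them is the two-sided ideal they generate in the free unital algebra,
  so $L_K(E)$ is the image of the free non-unital algebra in the quotient of the unital one.  The
  record inherits a \<^const>\<open>one\<close> field from that quotient, which is meaningful only if it lies in the
  carrier.  The first argument only fixes the type of coefficients.
\<close>

definition leavitt_path_algebra ::
    "'k::comm_ring_1 itself \<Rightarrow> ('v, 'e) pre_digraph \<Rightarrow>
     (('v, 'e) lpa_gen free_monoid \<Rightarrow>\<^sub>0 'k) set ring" where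
  "leavitt_path_algebra _ E =
     (let F = free_algebra (lpa_gens E); I = genideal F (lpa_relations E)
      in (F Quot I)\<lparr>carrier := {I +>\<^bsub>F\<^esub> p | p. p \<in> carrier F \<and> Poly_Mapping.lookup p 0 = 0}\<rparr>)"

section \<open>Topological groupoids\<close>

text \<open>
  A groupoid is given by its arrows; its units are the arrows \<open>u\<close> with \<open>gsource u = u\<close>.  The product
  of \<open>g\<close> and \<open>h\<close> is meaningful when \<open>gsource g = grange h\<close>.
\<close>

record 'a top_groupoid =
  garrows :: "'a set"
  gsource :: "'a \<Rightarrow> 'a"
  grange :: "'a \<Rightarrow> 'a"
  gmult :: "'a \<Rightarrow> 'a \<Rightarrow> 'a"
  ginverse :: "'a \<Rightarrow> 'a"
  gtopology :: "'a topology"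

definition gunits :: "('a, 'z) top_groupoid_scheme \<Rightarrow> 'a set" where
  "gunits G = {u \<in> garrows G. gsource G u = u}"

definition isotropy :: "('a, 'z) top_groupoid_scheme \<Rightarrow> 'a \<Rightarrow> 'a set" where
  "isotropy G u = {g \<in> garrows G. gsource G g = u \<and> grange G g = u}"

definition principal_groupoid :: "('a, 'z) top_groupoid_scheme \<Rightarrow> bool" where
  "principal_groupoid G \<longleftrightarrow> (\<forall>u\<in>gunits G. isotropy G u = {u})"

definition subgroupoid :: "'a set \<Rightarrow> ('a, 'z) top_groupoid_scheme \<Rightarrow> bool" where
  "subgroupoid H G \<longleftrightarrow> H \<subseteq> garrows G \<and>
     (\<forall>g\<in>H. ginverse G g \<in> H) \<and>
     (\<forall>g\<in>H. \<forall>h\<in>H. gsource G g = grange G h \<longrightarrow> gmult G g h \<in> H)"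

definition approximately_quasi_compact :: "('a, 'z) top_groupoid_scheme \<Rightarrow> bool" where
  "approximately_quasi_compact G \<longleftrightarrow>
     (\<exists>\<H>. (\<forall>H\<in>\<H>. subgroupoid H G \<and> openin (gtopology G) H \<and> compactin (gtopology G) H) \<and>
          \<H> \<noteq> {} \<and> (\<forall>A\<in>\<H>. \<forall>B\<in>\<H>. \<exists>C\<in>\<H>. A \<subseteq> C \<and> B \<subseteq> C) \<and>
          \<Union>\<H> = garrows G)"

section \<open>Boundary paths\<close>

type_synonym ('v, 'e) finite_path = "'v \<times> 'e list"

definition finite_paths :: "('v, 'e) pre_digraph \<Rightarrow> ('v, 'e) finite_path set" where
  "finite_paths E = {(u, p). \<exists>v. pre_digraph.awalk E u p v}"

definition path_range :: "('v, 'e) pre_digraph \<Rightarrow> ('v, 'e) finite_path \<Rightarrow> 'v" where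
  "path_range E \<mu> = pre_digraph.awlast E (fst \<mu>) (snd \<mu>)"

definition path_length :: "('v, 'e) finite_path \<Rightarrow> nat" where
  "path_length \<mu> = length (snd \<mu>)"

definition infinite_paths :: "('v, 'e) pre_digraph \<Rightarrow> 'e stream set" where
  "infinite_paths E = {\<xi>. \<forall>i. \<xi> !! i \<in> arcs E \<and> head E (\<xi> !! i) = tail E (\<xi> !! Suc i)}"

datatype ('v, 'e) gpath = FinPath "('v, 'e) finite_path" | InfPath "'e stream"

definition boundary_paths :: "('v, 'e) pre_digraph \<Rightarrow> ('v, 'e) gpath set" where
  "boundary_paths E =
     InfPath ` infinite_paths E \<union> FinPath ` {\<mu> \<in> finite_paths E. path_range E \<mu> \<in> singular_verts E}"

fun gpath_source :: "('v, 'e) pre_digraph \<Rightarrow> ('v, 'e) gpath \<Rightarrow> 'v" where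
  "gpath_source E (FinPath \<mu>) = fst \<mu>"
| "gpath_source E (InfPath \<xi>) = tail E (shd \<xi>)"

fun gpath_length :: "('v, 'e) gpath \<Rightarrow> enat" where
  "gpath_length (FinPath \<mu>) = enat (path_length \<mu>)"
| "gpath_length (InfPath \<xi>) = \<infinity>"

text \<open>The concatenation $\mu x$, used only when the range of $\mu$ is the source of $x$.\<close>

fun path_append :: "('v, 'e) finite_path \<Rightarrow> ('v, 'e) gpath \<Rightarrow> ('v, 'e) gpath" where
  "path_append \<mu> (FinPath \<nu>) = FinPath (fst \<mu>, snd \<mu> @ snd \<nu>)"
| "path_append \<mu> (InfPath \<xi>) = InfPath (snd \<mu> @- \<xi>)"

text \<open>
  The map $\sigma^n$, used only on paths of length at least $n$.  The source of the shifted finite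
  path is the range of the deleted initial segment.
\<close>

fun path_shift :: "('v, 'e) pre_digraph \<Rightarrow> nat \<Rightarrow> ('v, 'e) gpath \<Rightarrow> ('v, 'e) gpath" where
  "path_shift E n (FinPath \<mu>) = FinPath (path_range E (fst \<mu>, take n (snd \<mu>)), drop n (snd \<mu>))"
| "path_shift E n (InfPath \<xi>) = InfPath (sdrop n \<xi>)"

definition cylinder ::
    "('v, 'e) pre_digraph \<Rightarrow> ('v, 'e) finite_path \<Rightarrow> ('v, 'e) gpath set" where
  "cylinder E \<mu> = {path_append \<mu> x | x. x \<in> boundary_paths E \<and> gpath_source E x = path_range E \<mu>}"

definition cylinder_minus ::
    "('v, 'e) pre_digraph \<Rightarrow> ('v, 'e) finite_path \<Rightarrow> 'e set \<Rightarrow> ('v, 'e) gpath set" where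
  "cylinder_minus E \<mu> F = cylinder E \<mu> - (\<Union>e\<in>F. cylinder E (fst \<mu>, snd \<mu> @ [e]))"

section \<open>The boundary path groupoid\<close>

type_synonym ('v, 'e) bpg_arrow = "('v, 'e) gpath \<times> int \<times> ('v, 'e) gpath"

definition bpg_arrows :: "('v, 'e) pre_digraph \<Rightarrow> ('v, 'e) bpg_arrow set" where
  "bpg_arrows E = {(x, int m - int n, y) | x m n y.
     x \<in> boundary_paths E \<and> y \<in> boundary_paths E \<and>
     enat m \<le> gpath_length x \<and> enat n \<le> gpath_length y \<and>
     path_shift E m x = path_shift E n y}"

definition bpg_basic_set ::
    "('v, 'e) pre_digraph \<Rightarrow> ('v, 'e) finite_path \<Rightarrow> 'e set \<Rightarrow> ('v, 'e) finite_path \<Rightarrow>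
     ('v, 'e) bpg_arrow set" where
  "bpg_basic_set E \<mu> F \<nu> = {(x, int (path_length \<mu>) - int (path_length \<nu>), y) | x y.
     (x, int (path_length \<mu>) - int (path_length \<nu>), y) \<in> bpg_arrows E \<and>
     x \<in> cylinder_minus E \<mu> F \<and> y \<in> cylinder_minus E \<nu> F \<and>
     path_shift E (path_length \<mu>) x = path_shift E (path_length \<nu>) y}"

text \<open>
  The sets \<^const>\<open>bpg_basic_set\<close> form a basis, so the topology they generate consists of
  their unions.
\<close>

definition bpg_topology :: "('v, 'e) pre_digraph \<Rightarrow> ('v, 'e) bpg_arrow topology" where
  "bpg_topology E = topology_generated_by {bpg_basic_set E \<mu> F \<nu> | \<mu> F \<nu>.
     \<mu> \<in> finite_paths E \<and> \<nu> \<in> finite_paths E \<and> path_range E \<mu> = path_range E \<nu> \<and>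
     finite F \<and> F \<subseteq> out_arcs E (path_range E \<mu>)}"

definition boundary_path_groupoid ::
    "('v, 'e) pre_digraph \<Rightarrow> ('v, 'e) bpg_arrow top_groupoid" where
  "boundary_path_groupoid E = \<lparr>
     garrows = bpg_arrows E,
     gsource = (\<lambda>(x, k, y). (y, 0, y)),
     grange = (\<lambda>(x, k, y). (x, 0, x)),
     gmult = (\<lambda>(x, k, y) (y', l, z). (x, k + l, z)),
     ginverse = (\<lambda>(x, k, y). (y, - k, x)),
     gtopology = bpg_topology E\<rparr>"

end

theory Submission
  imports Defs "HOL-Library.Function_Algebras"
begin

text \<open>
  For a finite subgraph with edge set $F$ of an acyclic graph, put $q_x = x - \sum ee^*$, the sum over
  the $e \in F$ with source $x$.  The elements $\mu q_x \nu^*$, with $\mu, \nu$ paths of the subgraph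
  ending in $x$, are matrix units, and their span contains the vertices and edges of the subgraph.
  Hence every element of $L_K(E)$ is the image of a matrix over $K$, which is regular because $K$ is.
  Conversely, if $c$ is a cycle at $v$, then $L_K(E)$ acts on the functions on infinite paths times
  $\mathbb{Z}$, the second coordinate recording the degree.  A quasi-inverse of $v - c$ would yield a
  finitely supported $g$ on $\mathbb{Z}$ with $g(n) - g(n - |c|) = \delta_{n,0}$ at the multiples of $|c|$.

  On the groupoid side, the arrows that exchange the maximal initial segments lying in a finite
  subgraph form a compact open subgroupoid when the graph is acyclic.  A cycle $c$, on the other hand,
  gives the isotropy element $(c^\infty, |c|, c^\infty)$, whose powers cannot lie in a compact set since
  the degree is locally constant.
\<close>

section \<open>Matrices over a regular commutative ring\<close>

text \<open>Some q_x may vanish in L_K(E), so the span is merely an image of a matrix ring; this is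
  enough, because a quasi-inverse of a matrix maps to a quasi-inverse of its image. The subtraction
  in q_x provides orthogonality: without it the product of \<nu>* and \<alpha> would survive
  whenever one path extends the other.

  In the converse the degree coordinate does the work: on functions of infinite paths alone, c fixes
  the indicator of c^\<infinity>, so v - c kills it and nothing follows. With degrees, c acts there
  as a translation, while every element of the algebra changes degrees by a bounded amount.

  On the groupoid side the condition behind q_x reappears as "the tail does not begin with an edge
  of F". It makes the factorisation of a boundary path unique, which is what lets the chosen arrows
  compose; acyclicity makes such a factorisation exist.\<close>

definition mmul :: "'i set \<Rightarrow> ('i \<Rightarrow> 'i \<Rightarrow> 'k::comm_ring_1) \<Rightarrow> ('i \<Rightarrow> 'i \<Rightarrow> 'k) \<Rightarrow> 'i \<Rightarrow> 'i \<Rightarrow> 'k" where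
  "mmul S a b i j = (\<Sum>k\<in>S. a i k * b k j)"

lemma mmul_assoc: "mmul S (mmul S a b) c = mmul S a (mmul S b c)"
proof (intro ext)
  fix i j
  have "mmul S (mmul S a b) c i j = (\<Sum>k\<in>S. \<Sum>l\<in>S. a i l * b l k * c k j)"
    by (simp add: mmul_def sum_distrib_right)
  also have "\<dots> = (\<Sum>l\<in>S. \<Sum>k\<in>S. a i l * b l k * c k j)"
    by (rule sum.swap)
  also have "\<dots> = mmul S a (mmul S b c) i j"
    by (simp add: mmul_def sum_distrib_left mult.assoc)
  finally show "mmul S (mmul S a b) c i j = mmul S a (mmul S b c) i j" .
qed

lemma mmul_add_left: "mmul S (a + b) c = mmul S a c + mmul S b c"
  by (intro ext) (simp add: mmul_def algebra_simps sum.distrib)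

lemma mmul_add_right: "mmul S a (b + c) = mmul S a b + mmul S a c"
  by (intro ext) (simp add: mmul_def algebra_simps sum.distrib)

lemma mmul_diff_left: "mmul S (a - b) c = mmul S a c - mmul S b c"
  by (intro ext) (simp add: mmul_def algebra_simps sum_subtractf)

lemma mmul_diff_right: "mmul S a (b - c) = mmul S a b - mmul S a c"
  by (intro ext) (simp add: mmul_def algebra_simps sum_subtractf)

lemmas mmul_simps = mmul_assoc mmul_add_left mmul_add_right mmul_diff_left mmul_diff_right

definition mreg :: "'i set \<Rightarrow> ('i \<Rightarrow> 'i \<Rightarrow> 'k::comm_ring_1) \<Rightarrow> bool" where
  "mreg S a \<longleftrightarrow> (\<exists>x. mmul S (mmul S a x) a = a)"

text \<open>McCoy's lemma, which allows the rows of a matrix to be treated one at a time.\<close>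

lemma mreg_if_mreg_defect:
  assumes "mreg S (a - mmul S (mmul S a x) a)"
  shows "mreg S a"
proof -
  let ?d = "a - mmul S (mmul S a x) a"
  obtain y where y: "mmul S (mmul S ?d y) ?d = ?d"
    using assms by (auto simp: mreg_def)
  \<comment> \<open>Since d = a(1 - xa) = (1 - ax)a, the product d y d equals a(1 - xa)y(1 - ax)a.
    The quasi-inverse of \<open>a\<close> is therefore x + (1 - xa)y(1 - ax), multiplied out so that
    no identity matrix has to be mentioned.\<close>
  let ?x = "x + y - mmul S x (mmul S a y) - mmul S y (mmul S a x)
    + mmul S x (mmul S a (mmul S y (mmul S a x)))"
  have "mmul S (mmul S a ?x) a = mmul S (mmul S a x) a + mmul S (mmul S ?d y) ?d"
    by (simp add: mmul_simps algebra_simps)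
  also have "\<dots> = a"
    unfolding y by simp
  finally show ?thesis
    unfolding mreg_def by blast
qed

text \<open>Let c consist of the rows of \<open>a\<close> in \<open>R2\<close>, with c x c = c. If
  x' keeps only the columns of x indexed by \<open>R2\<close>, then x' a = x c, so on the rows in
  \<open>R2\<close> the defect a - a x' a agrees with c - c x c = 0. The defect thus lives on the
  rows in \<open>R1\<close> and on columns already occupied by \<open>a\<close>, and McCoy's lemma
  applies.\<close>

lemma mreg_row_split:
  fixes a :: "'i \<Rightarrow> 'i \<Rightarrow> 'k::comm_ring_1"
  assumes "finite S" and "\<And>i j. i \<notin> R1 \<union> R2 \<Longrightarrow> a i j = 0" and "R1 \<inter> R2 = {}" "R1 \<union> R2 \<subseteq> S"
    and "mreg S (\<lambda>i j. if i \<in> R2 then a i j else 0)"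
    and R1: "\<And>b :: 'i \<Rightarrow> 'i \<Rightarrow> 'k. (\<And>i j. b i j \<noteq> 0 \<Longrightarrow> i \<in> R1 \<and> (\<exists>i. a i j \<noteq> 0)) \<Longrightarrow> mreg S b"
  shows "mreg S a"
proof -
  define c where "c = (\<lambda>i j. if i \<in> R2 then a i j else 0)"
  obtain x where x: "mmul S (mmul S c x) c = c"
    using assms(5) by (auto simp: mreg_def c_def)
  define x' where "x' = (\<lambda>i j. if j \<in> R2 then x i j else 0)"
  have x'a: "mmul S x' a = mmul S x c"
    by (intro ext) (auto simp: mmul_def x'_def c_def intro!: sum.cong)
  let ?d = "a - mmul S (mmul S a x') a"
  have d: "?d = a - mmul S a (mmul S x c)"
    by (simp add: mmul_assoc x'a)
  have cx: "mmul S a (mmul S x c) i j = mmul S c (mmul S x c) i j" if "i \<in> R2" for i j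
    using that by (simp add: mmul_def c_def)
  have "?d i j = 0" if "i \<notin> R1" for i j
  proof (cases "i \<in> R2")
    case True
    then have "a i j = mmul S c (mmul S x c) i j"
      using x by (simp add: mmul_assoc c_def)
    with cx[OF True] show ?thesis
      by (simp add: d)
  next
    case False
    then have "a i k = 0" for k
      using that assms(2) by auto
    then show ?thesis
      by (simp add: mmul_def)
  qed
  moreover have "?d i j = 0" if "\<And>i. a i j = 0" for i j
    using that by (simp add: mmul_def)
  ultimately have "mreg S ?d"
    by (intro R1) metis
  then show ?thesis
    by (rule mreg_if_mreg_defect)
qed

lemma mreg_transposeI:
  fixes a :: "'i \<Rightarrow> 'i \<Rightarrow> 'k::comm_ring_1"
  assumes "mreg S a"
  shows "mreg S (\<lambda>i j. a j i)"
proof -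
  obtain x where x: "mmul S (mmul S a x) a = a"
    using assms by (auto simp: mreg_def)
  have "mmul S (mmul S (\<lambda>i j. a j i) (\<lambda>i j. x j i)) (\<lambda>i j. a j i) i j
    = mmul S a (mmul S x a) j i" for i j
    by (simp add: mmul_def mult_ac sum_distrib_left)
  then have "mmul S (mmul S (\<lambda>i j. a j i) (\<lambda>i j. x j i)) (\<lambda>i j. a j i) = (\<lambda>i j. a j i)"
    using x by (simp add: mmul_assoc fun_eq_iff)
  then show ?thesis
    unfolding mreg_def by (rule exI[of _ "\<lambda>i j. x j i"])
qed

text \<open>Induction on the size of the supporting rectangle: rows are peeled off one at a time, a
  single row is transposed and peeled along its entries, and a 1 x 1 support is regularity of K
  itself. Only the support shrinks; the index set \<open>S\<close> stays fixed, so all products are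
  taken in the same matrix ring.\<close>

lemma mreg_supported:
  fixes a :: "'i \<Rightarrow> 'i \<Rightarrow> 'k::comm_ring_1"
  assumes K: "von_neumann_regular (UNIV :: 'k set) (*)"
    and S: "finite S" "R \<subseteq> S" "C \<subseteq> S"
    and a: "\<And>i j. a i j \<noteq> 0 \<Longrightarrow> i \<in> R \<and> j \<in> C"
  shows "mreg S a"
  using S(2,3) a
proof (induction "card R + card C" arbitrary: R C a rule: less_induct)
  case less
  have fin: "finite R" "finite C"
    using less.prems S(1) by (auto intro: finite_subset)
  show ?case
  proof (cases "card R \<le> 1 \<and> card C \<le> 1")
    case True
    show ?thesis
    proof (cases "R = {} \<or> C = {}")
      case True
      then have "a = (\<lambda>i j. 0)"
        using less.prems(3) by (intro ext) blast
      then show ?thesis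
        by (simp add: mreg_def mmul_def fun_eq_iff)
    next
      case False
      with True fin have "card R = 1" "card C = 1"
        by (auto simp: le_Suc_eq)
      then obtain r c where rc: "R = {r}" "C = {c}"
        by (auto simp: card_1_singleton_iff)
      obtain k where k: "a r c * k * a r c = a r c"
        using K by (auto simp: von_neumann_regular_def)
      have a0: "a i j = 0" if "i \<noteq> r \<or> j \<noteq> c" for i j
        using less.prems(3)[of i j] that rc by auto
      have "mmul S a (mmul S (\<lambda>i j. if i = c \<and> j = r then k else 0) a) i j = a i j" for i j
      proof -
        have "mmul S (\<lambda>i j. if i = c \<and> j = r then k else 0) a l j = (if l = c then k * a r j else 0)" for l
          using less.prems(1) S(1) rc by (simp add: mmul_def if_distrib[of "\<lambda>x. x * _"] cong: if_cong)
        then have "mmul S a (mmul S (\<lambda>i j. if i = c \<and> j = r then k else 0) a) i j = a i c * (k * a r j)"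
          using less.prems(2) S(1) rc by (simp add: mmul_def if_distrib[of "\<lambda>x. _ * x"] cong: if_cong)
        also have "\<dots> = a i j"
          using k a0[of i j] a0[of i c] a0[of r j] by (cases "i = r"; cases "j = c") (auto simp: mult.assoc)
        finally show ?thesis .
      qed
      then show ?thesis
        unfolding mreg_def mmul_assoc by blast
    qed
  next
    case False
    \<comment> \<open>Stated for any rectangle of the same total size, so that it serves both
      \<open>a\<close> and its transpose, whose support has \<open>R\<close> and \<open>C\<close>
      exchanged.\<close>
    have rows: "mreg S b" if "R' \<subseteq> S" "C' \<subseteq> S" "card R' + card C' = card R + card C" "card R' > 1"
      and b: "\<And>i j. b i j \<noteq> 0 \<Longrightarrow> i \<in> R' \<and> j \<in> C'" for R' C' and b :: "'i \<Rightarrow> 'i \<Rightarrow> 'k"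
    proof -
      obtain r where r: "r \<in> R'"
        using \<open>card R' > 1\<close> by fastforce
      have finR: "finite R'"
        using that(1) S(1) by (rule finite_subset)
      have card: "card (R' - {r}) + card C' < card R + card C" "card {r} + card C' < card R + card C"
        using that(3,4) r finR by auto
      show ?thesis
      proof (rule mreg_row_split[OF S(1), of "{r}" "R' - {r}"])
        show "mreg S (\<lambda>i j. if i \<in> R' - {r} then b i j else 0)"
          by (rule less.hyps[OF card(1)]) (use b that in \<open>auto split: if_splits\<close>)
        show "mreg S b'" if "\<And>i j. b' i j \<noteq> 0 \<Longrightarrow> i \<in> {r} \<and> (\<exists>i. b i j \<noteq> 0)" for b' :: "'i \<Rightarrow> 'i \<Rightarrow> 'k"
          by (rule less.hyps[OF card(2)]) (use that b r \<open>R' \<subseteq> S\<close> \<open>C' \<subseteq> S\<close> in blast)+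
      qed (use b r \<open>R' \<subseteq> S\<close> in auto)
    qed
    show ?thesis
    proof (cases "card R > 1")
      case True
      then show ?thesis
        by (intro rows[of R C]) (use less.prems in auto)
    next
      case False
      with \<open>\<not> (card R \<le> 1 \<and> card C \<le> 1)\<close> have "mreg S (\<lambda>i j. a j i)"
        by (intro rows[of C R]) (use less.prems in auto)
      then show ?thesis
        by (rule mreg_transposeI[of S "\<lambda>i j. a j i"])
    qed
  qed
qed

section \<open>Congruences and Cohn families\<close>

text \<open>Plays the role of the quotient ring: calculations use representatives in a type-class
  ring rather than cosets in a ring record.\<close>

locale ring_congruence =
  fixes cong :: "'a::ring_1 \<Rightarrow> 'a \<Rightarrow> bool" (infix "\<approx>" 50)
  assumes cong_refl [simp, intro]: "a \<approx> a"
    and cong_sym: "a \<approx> b \<Longrightarrow> b \<approx> a"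
    and cong_trans [trans]: "a \<approx> b \<Longrightarrow> b \<approx> c \<Longrightarrow> a \<approx> c"
    and cong_add: "a \<approx> b \<Longrightarrow> c \<approx> d \<Longrightarrow> a + c \<approx> b + d"
    and cong_mult: "a \<approx> b \<Longrightarrow> c \<approx> d \<Longrightarrow> a * c \<approx> b * d"
begin

lemma cong_diff: "a \<approx> b \<Longrightarrow> c \<approx> d \<Longrightarrow> a - c \<approx> b - d"
  using cong_add[of a b "- 1 * c" "- 1 * d"] cong_mult[of "- 1" "- 1" c d] by simp

lemma cong_sum: "(\<And>i. i \<in> A \<Longrightarrow> f i \<approx> g i) \<Longrightarrow> sum f A \<approx> sum g A"
  by (induction A rule: infinite_finite_induct) (auto intro: cong_add)

lemma cong_mult_left: "a \<approx> b \<Longrightarrow> c * a \<approx> c * b"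
  by (rule cong_mult) auto

lemma cong_mult_right: "a \<approx> b \<Longrightarrow> a * c \<approx> b * c"
  by (rule cong_mult) auto

end

section \<open>Paths inside a finite subgraph of an acyclic graph\<close>

lemma (in wf_digraph) acyclic_awalk_distinct:
  assumes "acyclic_digraph G" and "awalk u p v"
  shows "distinct p"
proof (rule ccontr)
  assume "\<not> distinct p"
  then obtain xs ys zs e where "p = xs @ [e] @ ys @ [e] @ zs"
    using not_distinct_decomp by blast
  with assms(2) have "awalk (tail G e) (e # ys) (tail G e)"
    by (auto simp: awalk_Cons_iff)
  with assms(1) show False
    unfolding acyclic_digraph_def by blast
qed

definition paths_within :: "('v, 'e) pre_digraph \<Rightarrow> 'e set \<Rightarrow> 'v \<Rightarrow> 'e list set" where
  "paths_within E F u = {p. set p \<subseteq> F \<and> (\<exists>v. pre_digraph.awalk E u p v)}"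

lemma (in wf_digraph) finite_paths_within:
  assumes "acyclic_digraph G" "finite F"
  shows "finite (paths_within G F u)"
  by (rule finite_subset[OF _ finite_subset_distinct[OF assms(2)]])
    (auto simp: paths_within_def dest: acyclic_awalk_distinct[OF assms(1)])

lemma (in wf_digraph) paths_within_unfold:
  assumes "u \<in> verts G" "F \<subseteq> arcs G"
  shows "paths_within G F u = insert [] (\<Union>e\<in>F \<inter> out_arcs G u. (#) e ` paths_within G F (head G e))"
proof (rule Set.set_eqI)
  fix p
  show "p \<in> paths_within G F u \<longleftrightarrow> p \<in> insert [] (\<Union>e\<in>F \<inter> out_arcs G u. (#) e ` paths_within G F (head G e))"
    using assms by (cases p) (auto simp: paths_within_def awalk_simps image_iff)
qed

text \<open>The index set of the matrix units. Every vertex carries an empty path, so the sources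
  must be confined to a set \<open>V\<close> for this to be finite.\<close>

definition paths_from :: "('v, 'e) pre_digraph \<Rightarrow> 'v set \<Rightarrow> 'e set \<Rightarrow> ('v \<times> 'e list) set" where
  "paths_from E V F = Sigma V (paths_within E F)"

lemma (in wf_digraph) paths_fromD:
  "\<mu> \<in> paths_from G V F \<Longrightarrow> awalk (fst \<mu>) (snd \<mu>) (path_range G \<mu>) \<and> set (snd \<mu>) \<subseteq> F \<and> fst \<mu> \<in> V"
  by (auto simp: paths_from_def paths_within_def path_range_def)

lemma (in wf_digraph) finite_paths_from:
  assumes "acyclic_digraph G" "finite V" "finite F"
  shows "finite (paths_from G V F)"
  unfolding paths_from_def using assms by (intro finite_SigmaI finite_paths_within)

text \<open>These are the relations of the Cohn path algebra, up to a congruence and with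
  \<open>sc\<close> embedding the scalars centrally. They give orthogonality of the matrix units
  whether or not some of these are congruent to 0.\<close>

locale cohn_family = wf_digraph E + ring_congruence cong
  for E :: "('v, 'e) pre_digraph" and cong :: "'a::ring_1 \<Rightarrow> 'a \<Rightarrow> bool" (infix "\<approx>" 50) +
  fixes vx :: "'v \<Rightarrow> 'a" and ed gh :: "'e \<Rightarrow> 'a" and sc :: "'k::comm_ring_1 \<Rightarrow> 'a"
  assumes vx_vx: "v \<in> verts E \<Longrightarrow> w \<in> verts E \<Longrightarrow> vx v * vx w \<approx> (if v = w then vx v else 0)"
    and tail_ed: "e \<in> arcs E \<Longrightarrow> vx (tail E e) * ed e \<approx> ed e"
    and ed_head: "e \<in> arcs E \<Longrightarrow> ed e * vx (head E e) \<approx> ed e"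
    and head_gh: "e \<in> arcs E \<Longrightarrow> vx (head E e) * gh e \<approx> gh e"
    and gh_tail: "e \<in> arcs E \<Longrightarrow> gh e * vx (tail E e) \<approx> gh e"
    and gh_ed: "e \<in> arcs E \<Longrightarrow> f \<in> arcs E \<Longrightarrow> gh e * ed f \<approx> (if e = f then vx (head E e) else 0)"
    and sc_add: "sc (k + l) = sc k + sc l"
    and sc_mult: "sc (k * l) = sc k * sc l"
    and sc_one: "sc 1 = 1"
    and sc_comm: "sc k * a = a * sc k"
begin

lemma sc_zero [simp]: "sc 0 = 0"
  using sc_add[of 0 0] by simp

lemma sc_sum: "sc (sum f A) = (\<Sum>i\<in>A. sc (f i))"
  by (induction A rule: infinite_finite_induct) (auto simp: sc_add)

lemma vx_ed: "x \<in> verts E \<Longrightarrow> e \<in> arcs E \<Longrightarrow> vx x * ed e \<approx> (if tail E e = x then ed e else 0)"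
proof -
  assume xe: "x \<in> verts E" "e \<in> arcs E"
  have "vx x * ed e \<approx> vx x * (vx (tail E e) * ed e)"
    by (intro cong_mult_left cong_sym[OF tail_ed] xe)
  also have "\<dots> = (vx x * vx (tail E e)) * ed e"
    by (simp add: mult.assoc)
  also have "\<dots> \<approx> (if x = tail E e then vx x else 0) * ed e"
    by (intro cong_mult_right vx_vx) (use xe in auto)
  also have "\<dots> \<approx> (if tail E e = x then ed e else 0)"
    using xe tail_ed by auto
  finally show ?thesis .
qed

lemma gh_vx: "x \<in> verts E \<Longrightarrow> e \<in> arcs E \<Longrightarrow> gh e * vx x \<approx> (if tail E e = x then gh e else 0)"
proof -
  assume xe: "x \<in> verts E" "e \<in> arcs E"
  have "gh e * vx x \<approx> (gh e * vx (tail E e)) * vx x"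
    by (intro cong_mult_right cong_sym[OF gh_tail] xe)
  also have "\<dots> = gh e * (vx (tail E e) * vx x)"
    by (simp add: mult.assoc)
  also have "\<dots> \<approx> gh e * (if tail E e = x then vx (tail E e) else 0)"
    by (intro cong_mult_left vx_vx) (use xe in auto)
  also have "\<dots> \<approx> (if tail E e = x then gh e else 0)"
    using xe gh_tail by auto
  finally show ?thesis .
qed

text \<open>The element q_x. Intuitively it projects onto the paths at x that do not continue along
  an edge of \<open>F\<close>.\<close>

definition gap :: "'e set \<Rightarrow> 'v \<Rightarrow> 'a" where
  "gap F x = vx x - (\<Sum>e\<in>F \<inter> out_arcs E x. ed e * gh e)"

context
  fixes F assumes F: "finite F" "F \<subseteq> arcs E"
begin

text \<open>By \<open>gh_ed\<close> only the summand e = f can survive in the sum; it cancels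
  against x f if f starts at x, and otherwise both terms are 0.\<close>

lemma gap_ed:
  assumes "x \<in> verts E" "f \<in> F"
  shows "gap F x * ed f \<approx> 0"
proof -
  have f: "f \<in> arcs E"
    using assms F by auto
  have "gap F x * ed f = vx x * ed f - (\<Sum>e\<in>F \<inter> out_arcs E x. ed e * (gh e * ed f))"
    by (simp add: gap_def left_diff_distrib sum_distrib_right mult.assoc)
  also have "\<dots> \<approx> (if tail E f = x then ed f else 0)
      - (\<Sum>e\<in>F \<inter> out_arcs E x. ed e * (if e = f then vx (head E e) else 0))"
    by (intro cong_diff vx_ed cong_sum cong_mult_left gh_ed) (use assms f F in auto)
  also have "(\<Sum>e\<in>F \<inter> out_arcs E x. ed e * (if e = f then vx (head E e) else 0))
      = (if tail E f = x then ed f * vx (head E f) else 0)"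
    using assms f F by (simp add: if_distrib[of "\<lambda>z. _ * z"] cong: if_cong)
  also have "(if tail E f = x then ed f else 0) - \<dots> \<approx> (if tail E f = x then ed f else 0)
      - (if tail E f = x then ed f else 0)"
    by (intro cong_diff) (use f ed_head in auto)
  finally show ?thesis by simp
qed

lemma gh_gap:
  assumes "x \<in> verts E" "f \<in> F"
  shows "gh f * gap F x \<approx> 0"
proof -
  have f: "f \<in> arcs E"
    using assms F by auto
  have "gh f * gap F x = gh f * vx x - (\<Sum>e\<in>F \<inter> out_arcs E x. (gh f * ed e) * gh e)"
    by (simp add: gap_def right_diff_distrib sum_distrib_left mult.assoc)
  also have "\<dots> \<approx> (if tail E f = x then gh f else 0)
      - (\<Sum>e\<in>F \<inter> out_arcs E x. (if f = e then vx (head E f) else 0) * gh e)"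
    by (intro cong_diff gh_vx cong_sum cong_mult_right gh_ed) (use assms f F in auto)
  also have "(\<Sum>e\<in>F \<inter> out_arcs E x. (if f = e then vx (head E f) else 0) * gh e)
      = (if tail E f = x then vx (head E f) * gh f else 0)"
    using assms f F by (simp add: if_distrib[of "\<lambda>z. z * _"] cong: if_cong)
  also have "(if tail E f = x then gh f else 0) - \<dots> \<approx> (if tail E f = x then gh f else 0)
      - (if tail E f = x then gh f else 0)"
    by (intro cong_diff) (use f head_gh in auto)
  finally show ?thesis by simp
qed

lemma gap_vx:
  assumes "x \<in> verts E" "y \<in> verts E"
  shows "gap F x * vx y \<approx> (if x = y then gap F x else 0)"
proof -
  have "gap F x * vx y = vx x * vx y - (\<Sum>e\<in>F \<inter> out_arcs E x. ed e * (gh e * vx y))"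
    by (simp add: gap_def left_diff_distrib sum_distrib_right mult.assoc)
  also have "\<dots> \<approx> (if x = y then vx x else 0)
      - (\<Sum>e\<in>F \<inter> out_arcs E x. ed e * (if tail E e = y then gh e else 0))"
    by (intro cong_diff vx_vx cong_sum cong_mult_left gh_vx) (use assms F in auto)
  also have "\<dots> = (if x = y then gap F x else 0)"
    by (auto simp: gap_def intro!: sum.cong sum.neutral)
  finally show ?thesis .
qed

lemma gap_gap:
  assumes "x \<in> verts E" "y \<in> verts E"
  shows "gap F x * gap F y \<approx> (if x = y then gap F x else 0)"
proof -
  have "gap F x * gap F y = gap F x * vx y - (\<Sum>e\<in>F \<inter> out_arcs E y. gap F x * ed e * gh e)"
    unfolding gap_def[of F y] by (simp add: right_diff_distrib sum_distrib_left mult.assoc)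
  also have "\<dots> \<approx> (if x = y then gap F x else 0) - (\<Sum>e\<in>F \<inter> out_arcs E y. 0 * gh e)"
    by (intro cong_diff gap_vx cong_sum cong_mult_right gap_ed) (use assms F in auto)
  finally show ?thesis by simp
qed

end

text \<open>The empty product is the unit of the ambient ring, not a vertex, so an edge list does
  not remember its base point. In \<open>munit\<close> the adjacent \<open>gap\<close> supplies the
  missing vertex.\<close>

definition pe :: "'e list \<Rightarrow> 'a" where
  "pe p = prod_list (map ed p)"

definition pg :: "'e list \<Rightarrow> 'a" where
  "pg p = prod_list (map gh (rev p))"

lemma pe_simps [simp]: "pe [] = 1" "pe (e # p) = ed e * pe p"
  by (simp_all add: pe_def)

lemma pg_simps [simp]: "pg [] = 1" "pg (e # p) = pg p * gh e"
  by (simp_all add: pg_def)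

context
  fixes F assumes F: "finite F" "F \<subseteq> arcs E"
begin

lemma vx_gap:
  assumes "x \<in> verts E"
  shows "vx x * gap F x \<approx> gap F x"
proof -
  have "vx x * gap F x = vx x * vx x - (\<Sum>e\<in>F \<inter> out_arcs E x. (vx x * ed e) * gh e)"
    by (simp add: gap_def right_diff_distrib sum_distrib_left mult.assoc)
  also have "\<dots> \<approx> (if x = x then vx x else 0)
      - (\<Sum>e\<in>F \<inter> out_arcs E x. (if tail E e = x then ed e else 0) * gh e)"
    by (intro cong_diff vx_vx cong_sum cong_mult_right vx_ed) (use assms F in auto)
  also have "\<dots> = gap F x"
    by (auto simp: gap_def intro!: sum.cong sum.neutral)
  finally show ?thesis .
qed

lemma vx_pe_gap:
  assumes "awalk u p x"
  shows "vx u * (pe p * gap F x) \<approx> pe p * gap F x"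
proof (cases p)
  case Nil
  then show ?thesis
    using assms vx_gap by (auto simp: awalk_simps)
next
  case (Cons e q)
  with assms have "u = tail E e" "e \<in> arcs E"
    by (auto simp: awalk_simps)
  then show ?thesis
    using cong_mult_right[OF tail_ed[of e], of "pe q * gap F x"] Cons by (simp add: mult.assoc)
qed

text \<open>Common initial edges cancel by e* e = r(e), and two different edges give 0. If one list
  runs out first, the remaining edge of the other meets a gap and is killed by \<open>gap_ed\<close>
  or \<open>gh_gap\<close>. If both run out together, \<open>gap_gap\<close> decides whether the two
  vertices agree.\<close>

lemma gap_pg_pe_gap:
  assumes "awalk u p x" "awalk v r y" "set p \<subseteq> F" "set r \<subseteq> F"
  shows "gap F x * (pg p * (pe r * gap F y)) \<approx> (if u = v \<and> p = r then gap F x else 0)"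
  using assms
proof (induction p arbitrary: u v r)
  case Nil
  then have x: "x = u" "x \<in> verts E"
    by (auto simp: awalk_simps)
  show ?case
  proof (cases r)
    case Nil
    then show ?thesis
      using Nil.prems x gap_gap[OF F, of x y] by (auto simp: awalk_simps)
  next
    case (Cons f r')
    then have "gap F x * ed f * (pe r' * gap F y) \<approx> 0 * (pe r' * gap F y)"
      by (intro cong_mult_right gap_ed F x) (use Nil.prems in auto)
    then show ?thesis
      by (simp add: Cons mult.assoc)
  qed
next
  case (Cons e p)
  then have e: "e \<in> F" "e \<in> arcs E" "u = tail E e" "awalk (head E e) p x"
    using F by (auto simp: awalk_simps)
  show ?case
  proof (cases r)
    case Nil
    then have y: "y = v" "y \<in> verts E"
      using Cons.prems by (auto simp: awalk_simps)
    have "gap F x * pg p * (gh e * gap F y) \<approx> gap F x * pg p * 0"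
      by (intro cong_mult_left gh_gap F y e)
    then show ?thesis
      by (simp add: Nil mult.assoc)
  next
    case r: (Cons f r')
    then have f: "f \<in> F" "f \<in> arcs E" "v = tail E f" "awalk (head E f) r' y"
      using F Cons.prems by (auto simp: awalk_simps)
    have "gap F x * (pg (e # p) * (pe r * gap F y)) = gap F x * pg p * ((gh e * ed f) * (pe r' * gap F y))"
      by (simp add: r mult.assoc)
    also have "\<dots> \<approx> gap F x * pg p * ((if e = f then vx (head E e) else 0) * (pe r' * gap F y))"
      by (intro cong_mult_left cong_mult_right gh_ed e f)
    also have "\<dots> \<approx> (if e = f \<and> p = r' then gap F x else 0)"
    proof (cases "e = f")
      case True
      have "gap F x * pg p * (vx (head E e) * (pe r' * gap F y)) \<approx> gap F x * pg p * (pe r' * gap F y)"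
        by (intro cong_mult_left vx_pe_gap) (use f True in simp)
      also have "\<dots> = gap F x * (pg p * (pe r' * gap F y))"
        by (simp add: mult.assoc)
      also have "\<dots> \<approx> (if head E e = head E f \<and> p = r' then gap F x else 0)"
        by (rule Cons.IH[OF e(4) f(4)]) (use Cons.prems r in auto)
      finally show ?thesis
        using True by simp
    qed simp
    also have "(if e = f \<and> p = r' then gap F x else 0) = (if u = v \<and> e # p = r then gap F x else 0)"
      using e f r by auto
    finally show ?thesis .
  qed
qed

end

definition munit :: "'e set \<Rightarrow> 'v \<times> 'e list \<Rightarrow> 'v \<times> 'e list \<Rightarrow> 'a" where
  "munit F \<mu> \<nu> = pe (snd \<mu>) * gap F (path_range E \<mu>) * pg (snd \<nu>)"

lemma munit_mult:
  assumes F: "finite F" "F \<subseteq> arcs E"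
    and "\<mu> \<in> paths_from E V F" "\<nu> \<in> paths_from E V F" "\<alpha> \<in> paths_from E V F" "\<beta> \<in> paths_from E V F"
    and "path_range E \<mu> = path_range E \<nu>" "path_range E \<alpha> = path_range E \<beta>"
  shows "munit F \<mu> \<nu> * munit F \<alpha> \<beta> \<approx> (if \<nu> = \<alpha> then munit F \<mu> \<beta> else 0)"
proof -
  let ?x = "path_range E \<nu>" and ?y = "path_range E \<alpha>"
  have "munit F \<mu> \<nu> * munit F \<alpha> \<beta>
      = pe (snd \<mu>) * (gap F ?x * (pg (snd \<nu>) * (pe (snd \<alpha>) * gap F ?y)) * pg (snd \<beta>))"
    using assms by (simp add: munit_def mult.assoc)
  also have "\<dots> \<approx> pe (snd \<mu>) * ((if fst \<nu> = fst \<alpha> \<and> snd \<nu> = snd \<alpha> then gap F ?x else 0) * pg (snd \<beta>))"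
    by (intro cong_mult_left cong_mult_right gap_pg_pe_gap F)
      (use assms paths_fromD in blast)+
  also have "\<dots> = (if \<nu> = \<alpha> then munit F \<mu> \<beta> else 0)"
    using assms by (auto simp: munit_def mult.assoc prod_eq_iff)
  finally show ?thesis .
qed

text \<open>Write u = q_u + \<Sum> e r(e) e* and expand each r(e) recursively. Prefixing e embeds
  the paths at r(e) into those at u and misses the empty path; acyclicity makes both sets finite, so
  their cardinality is a measure for the recursion.\<close>

lemma vx_conv_munits:
  assumes F: "finite F" "F \<subseteq> arcs E" and ac: "acyclic_digraph E" and u: "u \<in> verts E"
  shows "vx u \<approx> (\<Sum>p\<in>paths_within E F u. munit F (u, p) (u, p))"
  using u
proof (induction "card (paths_within E F u)" arbitrary: u rule: less_induct)
  case less
  let ?A = "F \<inter> out_arcs E u" and ?P = "paths_within E F"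
  have IH: "vx (head E e) \<approx> (\<Sum>p\<in>?P (head E e). munit F (head E e, p) (head E e, p))" if "e \<in> ?A" for e
  proof (rule less.hyps)
    have "card (?P (head E e)) = card ((#) e ` ?P (head E e))"
      by (simp add: card_image)
    also have "\<dots> < card (?P u)"
      using paths_within_unfold[OF less.prems F(2)] that
      by (intro psubset_card_mono finite_paths_within ac F) blast
    finally show "card (?P (head E e)) < card (?P u)" .
  qed (use that in auto)
  have "vx u = gap F u + (\<Sum>e\<in>?A. ed e * gh e)"
    by (simp add: gap_def)
  also have "\<dots> \<approx> gap F u + (\<Sum>e\<in>?A. ed e * ((\<Sum>p\<in>?P (head E e). munit F (head E e, p) (head E e, p)) * gh e))"
  proof (intro cong_add cong_refl cong_sum cong_mult_left)
    fix e assume e: "e \<in> ?A"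
    then have "gh e \<approx> vx (head E e) * gh e"
      by (intro cong_sym[OF head_gh]) auto
    also have "\<dots> \<approx> (\<Sum>p\<in>?P (head E e). munit F (head E e, p) (head E e, p)) * gh e"
      by (intro cong_mult_right IH e)
    finally show "gh e \<approx> (\<Sum>p\<in>?P (head E e). munit F (head E e, p) (head E e, p)) * gh e" .
  qed
  also have "\<dots> = munit F (u, []) (u, []) + (\<Sum>e\<in>?A. \<Sum>p\<in>?P (head E e). munit F (u, e # p) (u, e # p))"
    by (auto simp: munit_def path_range_def sum_distrib_left sum_distrib_right mult.assoc intro!: sum.cong)
  also have "(\<Sum>e\<in>?A. \<Sum>p\<in>?P (head E e). munit F (u, e # p) (u, e # p))
    = (\<Sum>p\<in>(\<Union>e\<in>?A. (#) e ` ?P (head E e)). munit F (u, p) (u, p))"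
    by (subst sum.UNION_disjoint)
      (auto simp: F finite_paths_within[OF ac] sum.reindex)
  also have "munit F (u, []) (u, []) + \<dots> = (\<Sum>p\<in>?P u. munit F (u, p) (u, p))"
    unfolding paths_within_unfold[OF less.prems F(2)]
    by (subst sum.insert) (auto simp: F finite_paths_within[OF ac])
  finally show ?case .
qed

end

section \<open>Coefficient matrices and the elements they represent\<close>

context cohn_family
begin

text \<open>Matrix units exist only for pairs of paths with a common range, so the coefficient
  matrices are block diagonal, one block for each range vertex. Entries off the blocks must vanish,
  since there \<open>munit\<close> (which takes its gap from the first path only) does not multiply
  like a matrix unit.\<close>

definition block :: "'v set \<Rightarrow> 'e set \<Rightarrow> ('v \<times> 'e list \<Rightarrow> 'v \<times> 'e list \<Rightarrow> 'k) \<Rightarrow> bool" where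
  "block V F a \<longleftrightarrow> (\<forall>\<mu> \<nu>. a \<mu> \<nu> \<noteq> 0 \<longrightarrow>
     \<mu> \<in> paths_from E V F \<and> \<nu> \<in> paths_from E V F \<and> path_range E \<mu> = path_range E \<nu>)"

definition of_block :: "'v set \<Rightarrow> 'e set \<Rightarrow> ('v \<times> 'e list \<Rightarrow> 'v \<times> 'e list \<Rightarrow> 'k) \<Rightarrow> 'a" where
  "of_block V F a = (\<Sum>\<mu>\<in>paths_from E V F. \<Sum>\<nu>\<in>paths_from E V F. sc (a \<mu> \<nu>) * munit F \<mu> \<nu>)"

lemma block_mmul:
  assumes "block V F a" "block V F b"
  shows "block V F (mmul S a b)"
  unfolding block_def mmul_def
proof (intro allI impI)
  fix \<mu> \<nu>
  assume "(\<Sum>\<kappa>\<in>S. a \<mu> \<kappa> * b \<kappa> \<nu>) \<noteq> 0"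
  then obtain \<kappa> where "a \<mu> \<kappa> * b \<kappa> \<nu> \<noteq> 0"
    by (meson sum.neutral)
  then have "a \<mu> \<kappa> \<noteq> 0" "b \<kappa> \<nu> \<noteq> 0"
    by auto
  then show "\<mu> \<in> paths_from E V F \<and> \<nu> \<in> paths_from E V F \<and> path_range E \<mu> = path_range E \<nu>"
    using assms unfolding block_def by metis
qed

text \<open>The matrix-unit rule collapses the fourfold sum along the inner indices \<nu> =
  \<alpha>, leaving the matrix product. That rule asks for matching ranges, which hold for every
  pair of nonzero coefficients by the block condition.\<close>

lemma of_block_mult:
  assumes F: "finite F" "F \<subseteq> arcs E" and fin: "finite (paths_from E V F)"
    and ab: "block V F a" "block V F b"
  shows "of_block V F a * of_block V F b \<approx> of_block V F (mmul (paths_from E V F) a b)"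
proof -
  let ?S = "paths_from E V F"
  have summand: "(sc (a \<mu> \<nu>) * munit F \<mu> \<nu>) * (sc (b \<alpha> \<beta>) * munit F \<alpha> \<beta>)
      \<approx> (if \<nu> = \<alpha> then sc (a \<mu> \<nu> * b \<alpha> \<beta>) * munit F \<mu> \<beta> else 0)"
    if "\<mu> \<in> ?S" "\<nu> \<in> ?S" "\<alpha> \<in> ?S" "\<beta> \<in> ?S" for \<mu> \<nu> \<alpha> \<beta>
  proof (cases "a \<mu> \<nu> = 0 \<or> b \<alpha> \<beta> = 0")
    case False
    then have "path_range E \<mu> = path_range E \<nu>" "path_range E \<alpha> = path_range E \<beta>"
      using ab unfolding block_def by blast+
    note munit_mult[OF F that this]
    moreover have "(sc (a \<mu> \<nu>) * munit F \<mu> \<nu>) * (sc (b \<alpha> \<beta>) * munit F \<alpha> \<beta>)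
        = sc (a \<mu> \<nu> * b \<alpha> \<beta>) * (munit F \<mu> \<nu> * munit F \<alpha> \<beta>)"
      unfolding sc_mult mult.assoc
      by (simp only: sc_comm[of "b \<alpha> \<beta>"] mult.assoc)
    ultimately have "(sc (a \<mu> \<nu>) * munit F \<mu> \<nu>) * (sc (b \<alpha> \<beta>) * munit F \<alpha> \<beta>)
        \<approx> sc (a \<mu> \<nu> * b \<alpha> \<beta>) * (if \<nu> = \<alpha> then munit F \<mu> \<beta> else 0)"
      using cong_mult_left by metis
    then show ?thesis
      by (simp split: if_splits)
  qed auto
  have "of_block V F a * of_block V F b = (\<Sum>\<mu>\<in>?S. \<Sum>\<nu>\<in>?S. \<Sum>\<alpha>\<in>?S. \<Sum>\<beta>\<in>?S.
      (sc (a \<mu> \<nu>) * munit F \<mu> \<nu>) * (sc (b \<alpha> \<beta>) * munit F \<alpha> \<beta>))"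
    unfolding of_block_def sum_distrib_right unfolding sum_distrib_left ..
  also have "\<dots> \<approx> (\<Sum>\<mu>\<in>?S. \<Sum>\<nu>\<in>?S. \<Sum>\<alpha>\<in>?S. \<Sum>\<beta>\<in>?S.
      (if \<nu> = \<alpha> then sc (a \<mu> \<nu> * b \<alpha> \<beta>) * munit F \<mu> \<beta> else 0))"
    by (intro cong_sum summand)
  also have "\<dots> = (\<Sum>\<mu>\<in>?S. \<Sum>\<nu>\<in>?S. \<Sum>\<beta>\<in>?S. \<Sum>\<alpha>\<in>?S.
      (if \<nu> = \<alpha> then sc (a \<mu> \<nu> * b \<alpha> \<beta>) * munit F \<mu> \<beta> else 0))"
    by (intro sum.cong refl sum.swap)
  also have "\<dots> = (\<Sum>\<mu>\<in>?S. \<Sum>\<nu>\<in>?S. \<Sum>\<beta>\<in>?S. sc (a \<mu> \<nu> * b \<nu> \<beta>) * munit F \<mu> \<beta>)"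
    using fin by simp
  also have "\<dots> = (\<Sum>\<mu>\<in>?S. \<Sum>\<beta>\<in>?S. \<Sum>\<nu>\<in>?S. sc (a \<mu> \<nu> * b \<nu> \<beta>) * munit F \<mu> \<beta>)"
    by (intro sum.cong refl sum.swap)
  also have "\<dots> = of_block V F (mmul ?S a b)"
    by (simp add: of_block_def mmul_def sc_sum sum_distrib_right)
  finally show ?thesis .
qed

definition spanned :: "'v set \<Rightarrow> 'e set \<Rightarrow> 'a \<Rightarrow> bool" where
  "spanned V F x \<longleftrightarrow> (\<exists>a. block V F a \<and> x \<approx> of_block V F a)"

lemma spanned_cong: "spanned V F x \<Longrightarrow> y \<approx> x \<Longrightarrow> spanned V F y"
  unfolding spanned_def using cong_trans by blast

lemma spanned_zero: "spanned V F 0"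
  unfolding spanned_def by (intro exI[of _ "\<lambda>_ _. 0"]) (simp add: block_def of_block_def)

lemma spanned_add:
  assumes "spanned V F x" "spanned V F y"
  shows "spanned V F (x + y)"
proof -
  obtain a b where ab: "block V F a" "x \<approx> of_block V F a" "block V F b" "y \<approx> of_block V F b"
    using assms by (auto simp: spanned_def)
  have "of_block V F a + of_block V F b = of_block V F (\<lambda>\<mu> \<nu>. a \<mu> \<nu> + b \<mu> \<nu>)"
    by (simp add: of_block_def sc_add distrib_right sum.distrib)
  with ab have "x + y \<approx> of_block V F (\<lambda>\<mu> \<nu>. a \<mu> \<nu> + b \<mu> \<nu>)"
    using cong_add by metis
  moreover have "block V F (\<lambda>\<mu> \<nu>. a \<mu> \<nu> + b \<mu> \<nu>)"
    using ab unfolding block_def by (metis add_0)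
  ultimately show ?thesis
    unfolding spanned_def by blast
qed

lemma spanned_sum: "(\<And>i. i \<in> A \<Longrightarrow> spanned V F (f i)) \<Longrightarrow> spanned V F (sum f A)"
  by (induction A rule: infinite_finite_induct) (auto intro: spanned_zero spanned_add)

lemma spanned_scale:
  assumes "spanned V F x"
  shows "spanned V F (sc k * x)"
proof -
  obtain a where a: "block V F a" "x \<approx> of_block V F a"
    using assms by (auto simp: spanned_def)
  have "sc k * of_block V F a = of_block V F (\<lambda>\<mu> \<nu>. k * a \<mu> \<nu>)"
    by (simp add: of_block_def sc_mult sum_distrib_left mult.assoc)
  with a have "sc k * x \<approx> of_block V F (\<lambda>\<mu> \<nu>. k * a \<mu> \<nu>)"
    using cong_mult_left by metis
  moreover have "block V F (\<lambda>\<mu> \<nu>. k * a \<mu> \<nu>)"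
    using a(1) unfolding block_def by (metis mult_zero_right)
  ultimately show ?thesis
    unfolding spanned_def by blast
qed

lemma spanned_munit:
  assumes "finite (paths_from E V F)" "\<mu> \<in> paths_from E V F" "\<nu> \<in> paths_from E V F" "path_range E \<mu> = path_range E \<nu>"
  shows "spanned V F (munit F \<mu> \<nu>)"
proof -
  let ?a = "\<lambda>\<alpha> \<beta>. if \<alpha> = \<mu> \<and> \<beta> = \<nu> then 1 else 0"
  have "of_block V F ?a = (\<Sum>\<alpha>\<in>paths_from E V F. if \<alpha> = \<mu> then munit F \<mu> \<nu> else 0)"
    unfolding of_block_def
  proof (rule sum.cong[OF refl])
    fix \<alpha>
    have "(\<Sum>\<beta>\<in>paths_from E V F. sc (?a \<alpha> \<beta>) * munit F \<alpha> \<beta>)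
        = (\<Sum>\<beta>\<in>paths_from E V F. if \<beta> = \<nu> then (if \<alpha> = \<mu> then munit F \<mu> \<nu> else 0) else 0)"
      by (intro sum.cong) (auto simp: sc_one)
    then show "(\<Sum>\<beta>\<in>paths_from E V F. sc (?a \<alpha> \<beta>) * munit F \<alpha> \<beta>) = (if \<alpha> = \<mu> then munit F \<mu> \<nu> else 0)"
      using assms by simp
  qed
  also have "\<dots> = munit F \<mu> \<nu>"
    using assms by simp
  finally have "munit F \<mu> \<nu> \<approx> of_block V F ?a"
    by simp
  moreover have "block V F ?a"
    using assms by (auto simp: block_def)
  ultimately show ?thesis
    unfolding spanned_def by blast
qed

context
  fixes V F
  assumes F: "finite F" "F \<subseteq> arcs E" and V: "finite V" "V \<subseteq> verts E"
    and ac: "acyclic_digraph E"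
begin

lemma spanned_mult:
  assumes "spanned V F x" "spanned V F y"
  shows "spanned V F (x * y)"
proof -
  obtain a b where ab: "block V F a" "x \<approx> of_block V F a" "block V F b" "y \<approx> of_block V F b"
    using assms by (auto simp: spanned_def)
  then have "x * y \<approx> of_block V F a * of_block V F b"
    by (intro cong_mult)
  also have "\<dots> \<approx> of_block V F (mmul (paths_from E V F) a b)"
    by (rule of_block_mult[OF F finite_paths_from[OF ac V(1) F(1)] ab(1,3)])
  finally show ?thesis
    using block_mmul[OF ab(1,3)] unfolding spanned_def by blast
qed

lemma spanned_vx:
  assumes "v \<in> V"
  shows "spanned V F (vx v)"
proof (rule spanned_cong[OF _ vx_conv_munits[OF F ac]])
  show "spanned V F (\<Sum>p\<in>paths_within E F v. munit F (v, p) (v, p))"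
    by (intro spanned_sum spanned_munit finite_paths_from ac V F) (use assms in \<open>auto simp: paths_from_def\<close>)
qed (use assms V in auto)

lemma spanned_ed:
  assumes "e \<in> F" "tail E e \<in> V" "head E e \<in> V"
  shows "spanned V F (ed e)"
proof (rule spanned_cong)
  let ?P = "paths_within E F (head E e)"
  have e: "e \<in> arcs E"
    using assms F by auto
  have "ed e \<approx> ed e * vx (head E e)"
    by (rule cong_sym[OF ed_head[OF e]])
  also have "\<dots> \<approx> ed e * (\<Sum>p\<in>?P. munit F (head E e, p) (head E e, p))"
    by (intro cong_mult_left vx_conv_munits F ac) (use e in auto)
  also have "\<dots> = (\<Sum>p\<in>?P. munit F (tail E e, e # p) (head E e, p))"
    by (auto simp: munit_def path_range_def sum_distrib_left mult.assoc intro!: sum.cong)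
  finally show "ed e \<approx> (\<Sum>p\<in>?P. munit F (tail E e, e # p) (head E e, p))" .
  show "spanned V F (\<Sum>p\<in>?P. munit F (tail E e, e # p) (head E e, p))"
    by (intro spanned_sum spanned_munit finite_paths_from ac V F)
      (use assms e in \<open>auto simp: paths_from_def paths_within_def path_range_def awalk_simps\<close>)
qed

lemma spanned_gh:
  assumes "e \<in> F" "tail E e \<in> V" "head E e \<in> V"
  shows "spanned V F (gh e)"
proof (rule spanned_cong)
  let ?P = "paths_within E F (head E e)"
  have e: "e \<in> arcs E"
    using assms F by auto
  have "gh e \<approx> vx (head E e) * gh e"
    by (rule cong_sym[OF head_gh[OF e]])
  also have "\<dots> \<approx> (\<Sum>p\<in>?P. munit F (head E e, p) (head E e, p)) * gh e"
    by (intro cong_mult_right vx_conv_munits F ac) (use e in auto)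
  also have "\<dots> = (\<Sum>p\<in>?P. munit F (head E e, p) (tail E e, e # p))"
    by (auto simp: munit_def path_range_def sum_distrib_right mult.assoc intro!: sum.cong)
  finally show "gh e \<approx> (\<Sum>p\<in>?P. munit F (head E e, p) (tail E e, e # p))" .
  show "spanned V F (\<Sum>p\<in>?P. munit F (head E e, p) (tail E e, e # p))"
    by (intro spanned_sum spanned_munit finite_paths_from ac V F)
      (use assms e in \<open>auto simp: paths_from_def paths_within_def path_range_def awalk_simps\<close>)
qed

lemma regular_if_spanned:
  assumes K: "von_neumann_regular (UNIV :: 'k set) (*)" and "spanned V F x"
  shows "\<exists>y. x * y * x \<approx> x"
proof -
  let ?S = "paths_from E V F"
  obtain a where a: "block V F a" "x \<approx> of_block V F a"
    using assms(2) by (auto simp: spanned_def)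
  have "mreg ?S a"
    by (rule mreg_supported[OF K finite_paths_from[OF ac V(1) F(1)] subset_refl subset_refl])
      (use a(1) in \<open>auto simp: block_def\<close>)
  then obtain b where b: "mmul ?S (mmul ?S a b) a = a"
    by (auto simp: mreg_def)
  \<comment> \<open>A quasi-inverse of \<open>a\<close> need not be block diagonal. Dropping the
    entries of \<open>b\<close> off the blocks does not change a b a: between nonzero entries of
    \<open>a\<close> in a position (\<mu>, \<nu>) on a block, only entries of \<open>b\<close> on
    that same block occur, and off the blocks both a b' a and \<open>a\<close> vanish.\<close>
  define b' where "b' \<mu> \<nu> = (if \<mu> \<in> ?S \<and> \<nu> \<in> ?S \<and> path_range E \<mu> = path_range E \<nu> then b \<mu> \<nu> else 0)" for \<mu> \<nu>
  have b': "block V F b'"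
    by (auto simp: block_def b'_def split: if_splits)
  have a0: "a \<mu> \<nu> = 0" if "path_range E \<mu> \<noteq> path_range E \<nu>" for \<mu> \<nu>
    using a(1) that unfolding block_def by blast
  have "mmul ?S (mmul ?S a b') a \<mu> \<nu> = a \<mu> \<nu>" for \<mu> \<nu>
  proof (cases "path_range E \<mu> = path_range E \<nu>")
    case True
    have "mmul ?S (mmul ?S a b') a \<mu> \<nu> = mmul ?S (mmul ?S a b) a \<mu> \<nu>"
      unfolding mmul_def
    proof (intro sum.cong refl)
      fix \<kappa> assume \<kappa>: "\<kappa> \<in> ?S"
      show "(\<Sum>\<rho>\<in>?S. a \<mu> \<rho> * b' \<rho> \<kappa>) * a \<kappa> \<nu> = (\<Sum>\<rho>\<in>?S. a \<mu> \<rho> * b \<rho> \<kappa>) * a \<kappa> \<nu>"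
      proof (cases "path_range E \<kappa> = path_range E \<nu>")
        case rng: True
        have "(\<Sum>\<rho>\<in>?S. a \<mu> \<rho> * b' \<rho> \<kappa>) = (\<Sum>\<rho>\<in>?S. a \<mu> \<rho> * b \<rho> \<kappa>)"
          using \<kappa> rng True a0 by (intro sum.cong) (auto simp: b'_def)
        then show ?thesis
          by simp
      qed (simp add: a0)
    qed
    with b show ?thesis
      by simp
  next
    case False
    then show ?thesis
      using block_mmul[OF block_mmul[OF a(1) b'] a(1), of ?S ?S] a(1) unfolding block_def by metis
  qed
  then have "mmul ?S (mmul ?S a b') a = a"
    by blast
  note mult = of_block_mult[OF F finite_paths_from[OF ac V(1) F(1)]]
  have "x * of_block V F b' * x \<approx> of_block V F a * of_block V F b' * of_block V F a"
    by (intro cong_mult cong_refl a)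
  also have "\<dots> \<approx> of_block V F (mmul ?S a b') * of_block V F a"
    by (intro cong_mult_right mult a b')
  also have "\<dots> \<approx> of_block V F (mmul ?S (mmul ?S a b') a)"
    by (intro mult block_mmul a b')
  also have "\<dots> = of_block V F a"
    by (simp only: \<open>mmul ?S (mmul ?S a b') a = a\<close>)
  also have "\<dots> \<approx> x"
    by (rule cong_sym[OF a(2)])
  finally show ?thesis
    by blast
qed

end

end

section \<open>The congruence defining the Leavitt path algebra\<close>

lemma poly_mapping_additive_induct [case_names single add]:
  fixes p :: "'m \<Rightarrow>\<^sub>0 'k::comm_monoid_add"
  assumes single: "\<And>w k. P (Poly_Mapping.single w k)" and add: "\<And>p q. P p \<Longrightarrow> P q \<Longrightarrow> P (p + q)"
  shows "P p"
proof (induction p rule: update_induct)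
  case const
  show ?case
    using single[of undefined 0] by simp
next
  case (update f a b)
  have "Poly_Mapping.update a b f = f + Poly_Mapping.single a b"
    by (rule poly_mapping_eqI) (use update.hyps in \<open>auto simp: lookup_update lookup_add lookup_single in_keys_iff when_def\<close>)
  then show ?case
    using add[OF update.IH single] by simp
qed

text \<open>Sends every letter outside \<open>X\<close> to 0. As a word lies over \<open>X\<close>
  exactly when all its factors do, this is a ring retraction of the full free algebra onto the
  subalgebra on \<open>X\<close>. Membership in the carrier becomes the equation
  \<open>trunc X p = p\<close>, on which rewriting works.\<close>

definition trunc :: "'x set \<Rightarrow> ('x free_monoid \<Rightarrow>\<^sub>0 'k::comm_ring_1) \<Rightarrow> ('x free_monoid \<Rightarrow>\<^sub>0 'k)" where
  "trunc X p = Abs_poly_mapping (\<lambda>w. if set (letters w) \<subseteq> X then Poly_Mapping.lookup p w else 0)"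

lemma lookup_trunc:
  "Poly_Mapping.lookup (trunc X p) w = (if set (letters w) \<subseteq> X then Poly_Mapping.lookup p w else 0)"
proof -
  have "finite {w. (if set (letters w) \<subseteq> X then Poly_Mapping.lookup p w else 0) \<noteq> 0}"
    by (rule finite_subset[OF _ finite_lookup[of p]]) auto
  then show ?thesis
    by (simp add: trunc_def)
qed

lemma trunc_simps [simp]:
  "trunc X 0 = 0"
  "trunc X (p + q) = trunc X p + trunc X q"
  "trunc X (p - q) = trunc X p - trunc X q"
  "trunc X (- p) = - trunc X p"
  "trunc X (trunc X p) = trunc X p"
  by (rule poly_mapping_eqI; simp add: lookup_trunc lookup_add lookup_minus)+

lemma trunc_single:
  "trunc X (Poly_Mapping.single w k) = (if set (letters w) \<subseteq> X then Poly_Mapping.single w k else 0)"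
  by (rule poly_mapping_eqI) (auto simp: lookup_trunc lookup_single when_def)

lemma trunc_mult [simp]: "trunc X (p * q) = trunc X p * trunc X q"
proof (induction p rule: poly_mapping_additive_induct)
  case (single v k)
  show ?case
    by (induction q rule: poly_mapping_additive_induct)
      (auto simp: mult_single trunc_single distrib_left)
qed (simp add: distrib_right)

lemma trunc_sum [simp]: "trunc X (sum f A) = (\<Sum>a\<in>A. trunc X (f a))"
  by (induction A rule: infinite_finite_induct) simp_all

lemma trunc_gen [simp]: "trunc X (gen x) = (if x \<in> X then gen x else 0)"
  by (simp add: gen_def trunc_single)

lemma carrier_free_algebra: "p \<in> carrier (free_algebra X) \<longleftrightarrow> trunc X p = p"
  by (auto simp: free_algebra_def poly_mapping_eq_iff fun_eq_iff lookup_trunc in_keys_iff)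

lemma trunc_empty: "trunc {} p = Poly_Mapping.single 0 (Poly_Mapping.lookup p 0)"
  by (rule poly_mapping_eqI)
    (auto simp: lookup_trunc lookup_single when_def zero_free_monoid_def free_monoid.expand)

text \<open>The constant term is the truncation to the empty alphabet, hence multiplicative like
  every truncation.\<close>

lemma lookup_mult_zero:
  fixes p q :: "'x free_monoid \<Rightarrow>\<^sub>0 'k::comm_ring_1"
  shows "Poly_Mapping.lookup (p * q) 0 = Poly_Mapping.lookup p 0 * Poly_Mapping.lookup q 0"
proof -
  have "Poly_Mapping.single 0 (Poly_Mapping.lookup (p * q) 0)
      = (Poly_Mapping.single 0 (Poly_Mapping.lookup p 0 * Poly_Mapping.lookup q 0) :: 'x free_monoid \<Rightarrow>\<^sub>0 'k)"
    using trunc_mult[of "{}" p q] unfolding trunc_empty by (simp add: mult_single)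
  then show ?thesis
    by (simp add: inj_eq[OF inj_single])
qed

lemma single_zero_comm:
  fixes p :: "'x free_monoid \<Rightarrow>\<^sub>0 'k::comm_ring_1"
  shows "Poly_Mapping.single 0 k * p = p * Poly_Mapping.single 0 k"
  by (induction p rule: poly_mapping_additive_induct)
    (simp_all add: mult_single distrib_left distrib_right mult.commute)

lemma free_algebra_simps [simp]:
  "x \<otimes>\<^bsub>free_algebra X\<^esub> y = x * y" "x \<oplus>\<^bsub>free_algebra X\<^esub> y = x + y" "\<zero>\<^bsub>free_algebra X\<^esub> = 0"
  by (simp_all add: free_algebra_def)

lemma free_algebra_uminus:
  assumes "x \<in> carrier (free_algebra X)"
  shows "\<ominus>\<^bsub>free_algebra X\<^esub> x = - x"
proof -
  interpret ring "free_algebra X"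
    by (rule ring_free_algebra)
  show ?thesis
    using assms by (intro minus_equality) (auto simp: carrier_free_algebra)
qed

definition lpa_ideal :: "('v, 'e) pre_digraph \<Rightarrow> (('v, 'e) lpa_gen free_monoid \<Rightarrow>\<^sub>0 'k::comm_ring_1) set" where
  "lpa_ideal E = genideal (free_algebra (lpa_gens E)) (lpa_relations E)"

lemma lpa_gens_iff [simp]:
  "Vertex v \<in> lpa_gens E \<longleftrightarrow> v \<in> verts E"
  "Edge e \<in> lpa_gens E \<longleftrightarrow> e \<in> arcs E"
  "Ghost e \<in> lpa_gens E \<longleftrightarrow> e \<in> arcs E"
  by (auto simp: lpa_gens_def)

context wf_digraph
begin

lemma lpa_relations_carrier: "lpa_relations G \<subseteq> carrier (free_algebra (lpa_gens G))"
  by (auto simp: lpa_relations_def carrier_free_algebra regular_vertex_def split: if_splits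
      intro!: sum.cong)

lemma ideal_lpa: "ideal (lpa_ideal G) (free_algebra (lpa_gens G))"
  unfolding lpa_ideal_def by (rule ring.genideal_ideal[OF ring_free_algebra lpa_relations_carrier])

lemma lpa_relation: "r \<in> lpa_relations G \<Longrightarrow> r \<in> lpa_ideal G"
  unfolding lpa_ideal_def using ring.genideal_self[OF ring_free_algebra lpa_relations_carrier] by blast

lemma lpa_ideal_closed:
  fixes p q :: "('a, 'b) lpa_gen free_monoid \<Rightarrow>\<^sub>0 'k::comm_ring_1"
  shows lpa_ideal_zero: "(0 :: ('a, 'b) lpa_gen free_monoid \<Rightarrow>\<^sub>0 'k) \<in> lpa_ideal G"
    and lpa_ideal_add: "p \<in> lpa_ideal G \<Longrightarrow> q \<in> lpa_ideal G \<Longrightarrow> p + q \<in> lpa_ideal G"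
    and lpa_ideal_uminus: "p \<in> lpa_ideal G \<Longrightarrow> - p \<in> lpa_ideal G"
    and lpa_ideal_mult_left: "p \<in> lpa_ideal G \<Longrightarrow> trunc (lpa_gens G) q * p \<in> lpa_ideal G"
    and lpa_ideal_mult_right: "p \<in> lpa_ideal G \<Longrightarrow> p * trunc (lpa_gens G) q \<in> lpa_ideal G"
proof -
  interpret I: ideal "lpa_ideal G" "free_algebra (lpa_gens G) :: (('a, 'b) lpa_gen free_monoid \<Rightarrow>\<^sub>0 'k) ring"
    by (rule ideal_lpa)
  show "(0 :: ('a, 'b) lpa_gen free_monoid \<Rightarrow>\<^sub>0 'k) \<in> lpa_ideal G"
    using additive_subgroup.zero_closed[OF I.is_additive_subgroup] by simp
  show "p \<in> lpa_ideal G \<Longrightarrow> q \<in> lpa_ideal G \<Longrightarrow> p + q \<in> lpa_ideal G"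
    using additive_subgroup.a_closed[OF I.is_additive_subgroup, of p q] by simp
  show "p \<in> lpa_ideal G \<Longrightarrow> - p \<in> lpa_ideal G"
    using additive_subgroup.a_inv_closed[OF I.is_additive_subgroup, of p] I.a_subset
    by (auto simp: free_algebra_uminus)
  show "p \<in> lpa_ideal G \<Longrightarrow> trunc (lpa_gens G) q * p \<in> lpa_ideal G"
    using I.I_l_closed[of p "trunc (lpa_gens G) q"] by (simp add: carrier_free_algebra)
  show "p \<in> lpa_ideal G \<Longrightarrow> p * trunc (lpa_gens G) q \<in> lpa_ideal G"
    using I.I_r_closed[of p "trunc (lpa_gens G) q"] by (simp add: carrier_free_algebra)
qed

lemma von_neumann_regular_lpa_iff:
  "von_neumann_regular (carrier (leavitt_path_algebra TYPE('k::comm_ring_1) G))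
      (mult (leavitt_path_algebra TYPE('k) G))
    \<longleftrightarrow> (\<forall>p. trunc (lpa_gens G) p = p \<and> Poly_Mapping.lookup p 0 = 0 \<longrightarrow>
      (\<exists>q :: ('a, 'b) lpa_gen free_monoid \<Rightarrow>\<^sub>0 'k.
        trunc (lpa_gens G) q = q \<and> Poly_Mapping.lookup q 0 = 0 \<and> p * q * p - p \<in> lpa_ideal G))"
proof -
  let ?F = "free_algebra (lpa_gens G) :: (('a, 'b) lpa_gen free_monoid \<Rightarrow>\<^sub>0 'k) ring"
  let ?I = "lpa_ideal G :: (('a, 'b) lpa_gen free_monoid \<Rightarrow>\<^sub>0 'k) set"
  interpret I: ideal ?I ?F
    by (rule ideal_lpa)
  have car: "carrier (leavitt_path_algebra TYPE('k) G)
      = (\<lambda>p. ?I +>\<^bsub>?F\<^esub> p) ` {p. p \<in> carrier ?F \<and> Poly_Mapping.lookup p 0 = 0}"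
    by (auto simp: leavitt_path_algebra_def Let_def lpa_ideal_def)
  have mult: "mult (leavitt_path_algebra TYPE('k) G) (?I +>\<^bsub>?F\<^esub> p) (?I +>\<^bsub>?F\<^esub> q) = ?I +>\<^bsub>?F\<^esub> (p * q)"
    if "p \<in> carrier ?F" "q \<in> carrier ?F" for p q
    using I.rcoset_mult_add[OF that] by (simp add: leavitt_path_algebra_def Let_def lpa_ideal_def FactRing_def)
  have mult3: "mult (leavitt_path_algebra TYPE('k) G)
      (mult (leavitt_path_algebra TYPE('k) G) (?I +>\<^bsub>?F\<^esub> p) (?I +>\<^bsub>?F\<^esub> q)) (?I +>\<^bsub>?F\<^esub> p) = ?I +>\<^bsub>?F\<^esub> p
      \<longleftrightarrow> p * q * p - p \<in> ?I"
    if "p \<in> carrier ?F" "q \<in> carrier ?F" for p q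
  proof -
    have c: "p * q \<in> carrier ?F" "p * q * p \<in> carrier ?F"
      using that by (simp_all add: carrier_free_algebra)
    show ?thesis
      using I.quotient_eq_iff_same_a_r_cos[OF I.is_ideal c(2) that(1)] that c
      by (simp add: mult I.minus_eq free_algebra_uminus)
  qed
  let ?P = "{p. p \<in> carrier ?F \<and> Poly_Mapping.lookup p 0 = 0}"
  have "von_neumann_regular (carrier (leavitt_path_algebra TYPE('k) G)) (mult (leavitt_path_algebra TYPE('k) G))
      \<longleftrightarrow> (\<forall>p\<in>?P. \<exists>q\<in>?P. mult (leavitt_path_algebra TYPE('k) G)
          (mult (leavitt_path_algebra TYPE('k) G) (?I +>\<^bsub>?F\<^esub> p) (?I +>\<^bsub>?F\<^esub> q)) (?I +>\<^bsub>?F\<^esub> p)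
        = ?I +>\<^bsub>?F\<^esub> p)"
    unfolding von_neumann_regular_def car by (simp only: ball_simps bex_simps)
  also have "\<dots> \<longleftrightarrow> (\<forall>p\<in>?P. \<exists>q\<in>?P. p * q * p - p \<in> ?I)"
    by (intro ball_cong bex_cong refl mult3) auto
  finally show ?thesis
    unfolding carrier_free_algebra by blast
qed

text \<open>The ideal lives in the subalgebra on \<open>lpa_gens G\<close>, whereas a
  \<open>ring_congruence\<close> must relate all elements of the type. Composing with the retraction
  \<open>trunc\<close> extends coset equality to the whole type and leaves it unchanged on the
  carrier.\<close>

definition lpa_cong :: "(('a, 'b) lpa_gen free_monoid \<Rightarrow>\<^sub>0 'k::comm_ring_1) \<Rightarrow> _ \<Rightarrow> bool" where
  "lpa_cong p q \<longleftrightarrow> trunc (lpa_gens G) (p - q) \<in> lpa_ideal G"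

lemma lpa_congI: "p - q \<in> lpa_relations G \<Longrightarrow> lpa_cong p q"
  using lpa_relations_carrier lpa_relation unfolding lpa_cong_def
  by (metis carrier_free_algebra subsetD)

lemma ring_congruence_lpa:
  "ring_congruence (lpa_cong :: (('a, 'b) lpa_gen free_monoid \<Rightarrow>\<^sub>0 'k::comm_ring_1) \<Rightarrow> _)"
proof
  fix a b c d :: "('a, 'b) lpa_gen free_monoid \<Rightarrow>\<^sub>0 'k"
  let ?t = "trunc (lpa_gens G) :: (('a, 'b) lpa_gen free_monoid \<Rightarrow>\<^sub>0 'k) \<Rightarrow> _"
  show "lpa_cong a a"
    by (simp add: lpa_cong_def lpa_ideal_zero)
  show "lpa_cong b a" if "lpa_cong a b"
    using lpa_ideal_uminus[OF that[unfolded lpa_cong_def]] by (simp add: lpa_cong_def)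
  show "lpa_cong a c" if "lpa_cong a b" "lpa_cong b c"
    using lpa_ideal_add[OF that[unfolded lpa_cong_def]] by (simp add: lpa_cong_def)
  show "lpa_cong (a + c) (b + d)" if "lpa_cong a b" "lpa_cong c d"
    using lpa_ideal_add[OF that[unfolded lpa_cong_def]] by (simp add: lpa_cong_def algebra_simps)
  show "lpa_cong (a * c) (b * d)" if "lpa_cong a b" "lpa_cong c d"
  proof -
    have "?t (a - b) * ?t c + ?t b * ?t (c - d) \<in> lpa_ideal G"
      using that by (intro lpa_ideal_add lpa_ideal_mult_left lpa_ideal_mult_right) (simp_all add: lpa_cong_def)
    then show ?thesis
      by (simp add: lpa_cong_def algebra_simps)
  qed
qed

lemma cohn_family_lpa:
  "cohn_family G lpa_cong (\<lambda>v. gen (Vertex v)) (\<lambda>e. gen (Edge e)) (\<lambda>e. gen (Ghost e))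
    (Poly_Mapping.single 0 :: 'k::comm_ring_1 \<Rightarrow> _)"
proof -
  interpret ring_congruence "lpa_cong :: (('a, 'b) lpa_gen free_monoid \<Rightarrow>\<^sub>0 'k) \<Rightarrow> _"
    by (rule ring_congruence_lpa)
  show ?thesis
  proof
    fix e f assume ef: "e \<in> arcs G" "f \<in> arcs G"
    then have "gen (Ghost e) * gen (Edge f) - (if e = f then gen (Vertex (head G e)) else 0)
        \<in> (lpa_relations G :: (('a, 'b) lpa_gen free_monoid \<Rightarrow>\<^sub>0 'k) set)"
      unfolding lpa_relations_def by blast
    then show "lpa_cong (gen (Ghost e) * gen (Edge f) :: ('a, 'b) lpa_gen free_monoid \<Rightarrow>\<^sub>0 'k)
        (if e = f then gen (Vertex (head G e)) else 0)"
      by (rule lpa_congI)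
  next
    fix v w assume "v \<in> verts G" "w \<in> verts G"
    then have "gen (Vertex v) * gen (Vertex w) - (if v = w then gen (Vertex v) else 0)
        \<in> (lpa_relations G :: (('a, 'b) lpa_gen free_monoid \<Rightarrow>\<^sub>0 'k) set)"
      unfolding lpa_relations_def by blast
    then show "lpa_cong (gen (Vertex v) * gen (Vertex w) :: ('a, 'b) lpa_gen free_monoid \<Rightarrow>\<^sub>0 'k)
        (if v = w then gen (Vertex v) else 0)"
      by (rule lpa_congI)
  qed (rule lpa_congI; force simp: lpa_relations_def | simp add: single_add mult_single single_zero_comm)+
qed

end


section \<open>Acyclic graphs have regular Leavitt path algebras\<close>

lemma poly_mapping_conv_sum_words:
  fixes p :: "'x free_monoid \<Rightarrow>\<^sub>0 'k::comm_ring_1"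
  shows "p = (\<Sum>w\<in>Poly_Mapping.keys p. Poly_Mapping.single 0 (Poly_Mapping.lookup p w) * prod_list (map gen (letters w)))"
proof -
  have word: "prod_list (map gen xs) = (Poly_Mapping.single (Word xs) 1 :: 'x free_monoid \<Rightarrow>\<^sub>0 'k)" for xs
    by (induction xs) (simp_all add: gen_def mult_single plus_free_monoid_def flip: zero_free_monoid_def)
  show ?thesis
    unfolding word
    by (rule poly_mapping_eqI)
      (simp add: lookup_sum mult_single lookup_single when_def in_keys_iff if_distrib sum.delta cong: if_cong)
qed

lemma (in wf_digraph) von_neumann_regular_lpa_if_acyclic:
  assumes ac: "acyclic_digraph G" and K: "von_neumann_regular (UNIV :: 'k::comm_ring_1 set) (*)"
  shows "von_neumann_regular (carrier (leavitt_path_algebra TYPE('k) G))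
    (mult (leavitt_path_algebra TYPE('k) G))"
  unfolding von_neumann_regular_lpa_iff
proof (intro allI impI, elim conjE)
  fix p :: "('a, 'b) lpa_gen free_monoid \<Rightarrow>\<^sub>0 'k"
  assume p: "trunc (lpa_gens G) p = p" and p0: "Poly_Mapping.lookup p 0 = 0"
  interpret cohn_family G lpa_cong "\<lambda>v. gen (Vertex v)" "\<lambda>e. gen (Edge e)" "\<lambda>e. gen (Ghost e)"
    "Poly_Mapping.single 0 :: 'k \<Rightarrow> _"
    by (rule cohn_family_lpa)
  define X where "X = (\<Union>w\<in>Poly_Mapping.keys p. set (letters w))"
  have X: "finite X" "X \<subseteq> lpa_gens G"
    using p by (auto simp: X_def free_algebra_def simp flip: carrier_free_algebra)
  define F where "F = {e. Edge e \<in> X \<or> Ghost e \<in> X}"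
  \<comment> \<open>The endpoints of the edges in \<open>F\<close> are included because the
    expansions of e and e* use matrix units indexed by paths from both ends of e.\<close>
  define V where "V = {v. Vertex v \<in> X} \<union> tail G ` F \<union> head G ` F"
  have "F \<subseteq> (\<lambda>x. case x of Edge e \<Rightarrow> e | Ghost e \<Rightarrow> e) ` X"
    by (force simp: F_def)
  then have F: "finite F" "F \<subseteq> arcs G"
    using finite_surj[OF X(1)] by (blast, auto simp: F_def dest!: subsetD[OF X(2)])
  have "{v. Vertex v \<in> X} \<subseteq> (\<lambda>x. case x of Vertex v \<Rightarrow> v) ` X"
    by force
  then have "finite {v. Vertex v \<in> X}"
    using finite_surj[OF X(1)] by blast
  then have V: "finite V" "V \<subseteq> verts G"
    using F by (auto simp: V_def dest!: subsetD[OF X(2)])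
  have letter: "spanned V F (gen x)" if "x \<in> X" for x
  proof (cases x)
    case (Vertex v)
    then show ?thesis
      using that by (simp, intro spanned_vx[OF F V ac]) (simp add: V_def)
  next
    case (Edge e)
    then show ?thesis
      using that by (simp, intro spanned_ed[OF F V ac]) (auto simp: V_def F_def)
  next
    case (Ghost e)
    then show ?thesis
      using that by (simp, intro spanned_gh[OF F V ac]) (auto simp: V_def F_def)
  qed
  \<comment> \<open>Only nonempty words are treated: the empty word is the unit of the free algebra,
    which need not be spanned. This is where the vanishing constant term of \<open>p\<close>
    enters.\<close>
  have word: "spanned V F (prod_list (map gen (x # xs)))" if "set (x # xs) \<subseteq> X" for x xs
    using that
  proof (induction xs arbitrary: x)
    case (Cons y ys)
    have "spanned V F (gen x * prod_list (map gen (y # ys)))"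
      by (intro spanned_mult[OF F V ac] letter Cons.IH) (use Cons.prems in auto)
    then show ?case
      by simp
  qed (simp add: letter)
  have "spanned V F p"
  proof (subst poly_mapping_conv_sum_words[of p], intro spanned_sum spanned_scale)
    fix w assume w: "w \<in> Poly_Mapping.keys p"
    with p0 have "letters w \<noteq> []"
      by (cases w) (auto simp: zero_free_monoid_def in_keys_iff)
    moreover have "set (letters w) \<subseteq> X"
      using w by (auto simp: X_def)
    ultimately show "spanned V F (prod_list (map gen (letters w)))"
      using word by (cases "letters w") auto
  qed
  then obtain y where y: "lpa_cong (p * y * p) p"
    using regular_if_spanned[OF F V ac K] by blast
  \<comment> \<open>A quasi-inverse of the form \<open>y p y\<close> has no constant term.\<close>
  let ?y = "trunc (lpa_gens G) y"
  have "lpa_cong (p * (y * p * y) * p) p"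
    using cong_trans[OF cong_mult_right[OF y, of "y * p"]] y by (simp add: mult.assoc)
  then have "p * (?y * p * ?y) * p - p \<in> lpa_ideal G"
    by (simp add: lpa_cong_def p)
  then show "\<exists>q. trunc (lpa_gens G) q = q \<and> Poly_Mapping.lookup q 0 = 0 \<and> p * q * p - p \<in> lpa_ideal G"
    by (intro exI[of _ "?y * p * ?y"]) (simp add: p p0 lookup_mult_zero)
qed

section \<open>Infinite paths\<close>

context wf_digraph
begin

lemma infinite_paths_unfold:
  "\<xi> \<in> infinite_paths G \<longleftrightarrow>
    shd \<xi> \<in> arcs G \<and> head G (shd \<xi>) = tail G (shd (stl \<xi>)) \<and> stl \<xi> \<in> infinite_paths G"
proof -
  have "(\<forall>i. P i) \<longleftrightarrow> P 0 \<and> (\<forall>i. P (Suc i))" for P :: "nat \<Rightarrow> bool"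
    by (metis not0_implies_Suc)
  from this[of "\<lambda>i. \<xi> !! i \<in> arcs G \<and> head G (\<xi> !! i) = tail G (\<xi> !! Suc i)"] show ?thesis
    by (simp add: infinite_paths_def)
qed

lemma infinite_paths_Stream:
  "e ## \<xi> \<in> infinite_paths G \<longleftrightarrow> e \<in> arcs G \<and> head G e = tail G (shd \<xi>) \<and> \<xi> \<in> infinite_paths G"
  by (subst infinite_paths_unfold) simp

lemma infinite_paths_stl: "\<xi> \<in> infinite_paths G \<Longrightarrow> stl \<xi> \<in> infinite_paths G"
  by (simp add: infinite_paths_unfold[of \<xi>])

lemma awalk_nth_Suc: "awalk u p v \<Longrightarrow> Suc i < length p \<Longrightarrow> head G (p ! i) = tail G (p ! Suc i)"
proof (induction p arbitrary: u i)
  case (Cons e p)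
  then show ?case
    by (cases i; cases p) (auto simp: awalk_Cons_iff)
qed simp

lemma cycle_in_infinite_paths:
  assumes "awalk u p u" and "p \<noteq> []"
  shows "Stream.cycle p \<in> infinite_paths G"
  unfolding infinite_paths_def
proof (intro CollectI allI)
  fix i
  let ?l = "length p"
  have nth: "Stream.cycle p !! j = p ! (j mod ?l)" for j
  proof -
    have "Stream.cycle p !! j = shd (sdrop j (Stream.cycle p))"
      by (simp add: sdrop_snth flip: snth.simps(1))
    also have "\<dots> = p ! (j mod ?l)"
      using assms by (simp add: sdrop_cycle hd_rotate_conv_nth)
    finally show ?thesis .
  qed
  have l: "?l > 0"
    using assms by simp
  have "head G (p ! (i mod ?l)) = tail G (p ! (Suc i mod ?l))"
  proof (cases "Suc (i mod ?l) < ?l")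
    case True
    then show ?thesis
      using awalk_nth_Suc[OF assms(1) True] by (simp add: mod_Suc)
  next
    \<comment> \<open>The index wraps around: the last edge of the closed walk ends at
      \<open>u\<close>, where its first edge starts.\<close>
    case False
    then have "Suc (i mod ?l) = ?l"
      using mod_less_divisor[OF l, of i] by linarith
    then have i: "i mod ?l = ?l - 1" "Suc i mod ?l = 0"
      by (simp_all add: mod_Suc)
    have "awalk_verts u p = map (tail G) p @ [head G (last p)]"
      using assms by (simp add: awalk_verts_conv)
    then have "head G (last p) = u"
      using awlast_of_awalk[OF assms(1)] assms(1) by (metis awalkE last_snoc)
    moreover have "tail G (hd p) = u"
      using assms by (cases p) (auto simp: awalk_Cons_iff)
    ultimately show ?thesis
      using assms i by (simp add: last_conv_nth hd_conv_nth)
  qed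
  moreover have "p ! (i mod ?l) \<in> arcs G"
    using assms(1) nth_mem[of "i mod ?l" p] l unfolding awalk_def by auto
  ultimately show "Stream.cycle p !! i \<in> arcs G \<and> head G (Stream.cycle p !! i) = tail G (Stream.cycle p !! Suc i)"
    by (simp only: nth)
qed

end

section \<open>The graded representation on infinite paths\<close>

type_synonym ('e, 'k) graded_fun = "'e stream \<Rightarrow> int \<Rightarrow> 'k"

text \<open>On indicator functions, e sends (\<xi>, n) to (e\<xi>, n + 1) when e\<xi> is a path, and
  e* undoes this. Arguments therefore appear in pulled-back form, with n - 1 for e and n + 1 for e*.
  Functions need not have finite support.\<close>

fun gen_act :: "('v, 'e) pre_digraph \<Rightarrow> ('v, 'e) lpa_gen \<Rightarrow> ('e, 'k::comm_ring_1) graded_fun \<Rightarrow> ('e, 'k) graded_fun" where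
  "gen_act E (Vertex v) f \<xi> n = (if \<xi> \<in> infinite_paths E \<and> tail E (shd \<xi>) = v then f \<xi> n else 0)"
| "gen_act E (Edge e) f \<xi> n = (if \<xi> \<in> infinite_paths E \<and> shd \<xi> = e then f (stl \<xi>) (n - 1) else 0)"
| "gen_act E (Ghost e) f \<xi> n = (if e ## \<xi> \<in> infinite_paths E then f (e ## \<xi>) (n + 1) else 0)"

definition word_act :: "('v, 'e) pre_digraph \<Rightarrow> ('v, 'e) lpa_gen list \<Rightarrow> ('e, 'k::comm_ring_1) graded_fun \<Rightarrow> ('e, 'k) graded_fun" where
  "word_act E w f = foldr (gen_act E) w f"

definition act :: "('v, 'e) pre_digraph \<Rightarrow> (('v, 'e) lpa_gen free_monoid \<Rightarrow>\<^sub>0 'k::comm_ring_1) \<Rightarrow>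
    ('e, 'k) graded_fun \<Rightarrow> ('e, 'k) graded_fun" where
  "act E p f \<xi> n = (\<Sum>w\<in>Poly_Mapping.keys p. Poly_Mapping.lookup p w * word_act E (letters w) f \<xi> n)"

lemma word_act_simps [simp]:
  "word_act E [] f = f" "word_act E (x # w) f = gen_act E x (word_act E w f)"
  "word_act E (v @ w) f = word_act E v (word_act E w f)"
  by (simp_all add: word_act_def)

lemma act_add [simp]: "act E (p + q) f = (\<lambda>\<xi> n. act E p f \<xi> n + act E q f \<xi> n)"
proof (intro ext)
  fix \<xi> n
  show "act E (p + q) f \<xi> n = act E p f \<xi> n + act E q f \<xi> n"
    unfolding act_def
    using setsum_keys_plus_distrib[of "\<lambda>w k. k * word_act E (letters w) f \<xi> n" p q]
    by (simp add: distrib_right)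
qed

lemma act_zero [simp]: "act E 0 f = (\<lambda>\<xi> n. 0)"
  by (simp add: act_def fun_eq_iff)

lemma act_diff [simp]: "act E (p - q) f = (\<lambda>\<xi> n. act E p f \<xi> n - act E q f \<xi> n)"
proof -
  have "act E (p - q + q) f = (\<lambda>\<xi> n. act E (p - q) f \<xi> n + act E q f \<xi> n)"
    by (rule act_add)
  then show ?thesis
    by (simp add: fun_eq_iff)
qed

lemma act_sum: "act E (sum p A) f = (\<lambda>\<xi> n. \<Sum>a\<in>A. act E (p a) f \<xi> n)"
  by (induction A rule: infinite_finite_induct) simp_all

lemma act_single [simp]: "act E (Poly_Mapping.single w k) f = (\<lambda>\<xi> n. k * word_act E (letters w) f \<xi> n)"
  by (simp add: act_def fun_eq_iff)

lemma act_gen [simp]: "act E (gen x) f = gen_act E x f"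
  by (simp add: gen_def)

lemma gen_act_linear:
  "gen_act E x (\<lambda>\<xi> n. k * f \<xi> n + g \<xi> n) = (\<lambda>\<xi> n. k * gen_act E x f \<xi> n + gen_act E x g \<xi> n)"
  by (cases x) (auto simp: fun_eq_iff)

lemma word_act_linear:
  "word_act E w (\<lambda>\<xi> n. k * f \<xi> n + g \<xi> n) = (\<lambda>\<xi> n. k * word_act E w f \<xi> n + word_act E w g \<xi> n)"
  by (induction w) (simp_all add: gen_act_linear)

lemma act_linear:
  "act E p (\<lambda>\<xi> n. k * f \<xi> n + g \<xi> n) = (\<lambda>\<xi> n. k * act E p f \<xi> n + act E p g \<xi> n)"
  unfolding act_def word_act_linear
  by (simp add: fun_eq_iff sum_distrib_left sum.distrib distrib_left mult.left_commute)

lemma word_act_zero: "word_act E w (\<lambda>\<xi> n. 0) = (\<lambda>\<xi> n. 0 :: 'k::comm_ring_1)"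
  using word_act_linear[of E w "- 1" "\<lambda>\<xi> n. 0 :: 'k" "\<lambda>\<xi> n. 0 :: 'k"] by simp

lemma act_of_zero: "act E p (\<lambda>\<xi> n. 0) = (\<lambda>\<xi> n. 0)"
  by (simp add: act_def fun_eq_iff word_act_zero)

lemma act_of_diff: "act E p (\<lambda>\<xi> n. f \<xi> n - g \<xi> n) = (\<lambda>\<xi> n. act E p f \<xi> n - act E p g \<xi> n)"
  using act_linear[of E p "- 1" g f] by simp

lemma act_mult [simp]: "act E (p * q) f = act E p (act E q f)"
proof (induction p rule: poly_mapping_additive_induct)
  case (single v k)
  show ?case
  proof (induction q rule: poly_mapping_additive_induct)
    case (single w l)
    show ?case
      using word_act_linear[of E "letters v" l "word_act E (letters w) f" "\<lambda>\<xi> n. 0"]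
      by (simp add: mult_single word_act_zero mult.assoc)
  next
    case (add p q)
    then show ?case
      using word_act_linear[of E "letters v" 1 "act E p f" "act E q f"]
      by (simp add: distrib_left)
  qed
next
  case (add p p')
  then show ?case
    by (simp add: distrib_right)
qed

text \<open>Generators change the degree only by fixed amounts, so the action commutes with
  translation in the degree. The image of one indicator thus determines the images of all its
  translates.\<close>

lemma act_shift:
  fixes f :: "('e, 'k::comm_ring_1) graded_fun"
  shows "act E p (\<lambda>\<xi> n. f \<xi> (n - k)) = (\<lambda>\<xi> n. act E p f \<xi> (n - k))"
proof -
  have gen: "gen_act E x (\<lambda>\<xi> n. f \<xi> (n - k)) = (\<lambda>\<xi> n. gen_act E x f \<xi> (n - k))" for x and f :: "('e, 'k) graded_fun"
    by (cases x) (auto simp: fun_eq_iff algebra_simps)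
  have "word_act E w (\<lambda>\<xi> n. f \<xi> (n - k)) = (\<lambda>\<xi> n. word_act E w f \<xi> (n - k))" for w
    by (induction w) (simp_all add: gen)
  then show ?thesis
    by (simp add: act_def fun_eq_iff)
qed

text \<open>A finiteness condition in the degree alone, uniform in the path. Each generator shifts
  degrees by at most one, so every element of the free algebra preserves it.\<close>

definition degree_bounded :: "('e, 'k::zero) graded_fun \<Rightarrow> bool" where
  "degree_bounded f \<longleftrightarrow> (\<exists>N. \<forall>\<xi> n. \<bar>n\<bar> > N \<longrightarrow> f \<xi> n = 0)"

lemma degree_bounded_act:
  fixes f :: "('e, 'k::comm_ring_1) graded_fun"
  assumes "degree_bounded f"
  shows "degree_bounded (act E p f)"
proof (induction p rule: poly_mapping_additive_induct)
  case (single w k)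
  have gen: "degree_bounded (gen_act E x g)" if g: "degree_bounded g" for x and g :: "('e, 'k) graded_fun"
  proof -
    obtain N where N: "\<And>\<xi> n. \<bar>n\<bar> > N \<Longrightarrow> g \<xi> n = 0"
      using g by (auto simp: degree_bounded_def)
    have "gen_act E x g \<xi> n = 0" if "\<bar>n\<bar> > N + 1" for \<xi> n
      using that by (cases x) (auto intro!: N)
    then show ?thesis
      unfolding degree_bounded_def by blast
  qed
  have "degree_bounded (word_act E v f)" for v
    by (induction v) (simp_all add: assms gen)
  then obtain N where "\<And>\<xi> n. \<bar>n\<bar> > N \<Longrightarrow> word_act E (letters w) f \<xi> n = 0"
    unfolding degree_bounded_def by blast
  then have "\<bar>n\<bar> > N \<Longrightarrow> act E (Poly_Mapping.single w k) f \<xi> n = 0" for \<xi> n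
    by simp
  then show ?case
    unfolding degree_bounded_def by blast
next
  case (add p q)
  then obtain M N where "\<And>\<xi> n. \<bar>n\<bar> > M \<Longrightarrow> act E p f \<xi> n = 0" "\<And>\<xi> n. \<bar>n\<bar> > N \<Longrightarrow> act E q f \<xi> n = 0"
    by (auto simp: degree_bounded_def)
  then have "\<bar>n\<bar> > max M N \<Longrightarrow> act E (p + q) f \<xi> n = 0" for \<xi> n
    by simp
  then show ?case
    unfolding degree_bounded_def by blast
qed

lemma (in wf_digraph) act_relation:
  fixes f :: "('b, 'c::comm_ring_1) graded_fun"
  assumes "r \<in> lpa_relations G"
  shows "act G r f = (\<lambda>\<xi> n. 0)"
proof -
  \<comment> \<open>An infinite path at v begins with exactly one edge out of v, so exactly one of
    the projections ee* acts as the identity on it; this is the relation v = \<Sum> ee*.\<close>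
  have ck2: "(\<Sum>e\<in>out_arcs G v. if \<xi> \<in> infinite_paths G \<and> shd \<xi> = e then s e else 0)
      = (if \<xi> \<in> infinite_paths G \<and> tail G (shd \<xi>) = v then s (shd \<xi>) else 0)"
    if "finite (out_arcs G v)" for v \<xi> and s :: "'b \<Rightarrow> 'c"
    using that infinite_paths_unfold[of \<xi>] by (cases "\<xi> \<in> infinite_paths G") auto
  show ?thesis
    using assms unfolding lpa_relations_def regular_vertex_def
    by (auto simp: fun_eq_iff infinite_paths_Stream act_sum infinite_paths_stl ck2
        dest: infinite_paths_unfold[THEN iffD1] split: if_splits)
qed

text \<open>The annihilator of the representation is an ideal of the free algebra on
  \<open>lpa_gens G\<close> and contains the relations, hence also the ideal generated by
  them.\<close>

lemma (in wf_digraph) act_lpa_ideal: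
  fixes r :: "('a, 'b) lpa_gen free_monoid \<Rightarrow>\<^sub>0 'k::comm_ring_1"
  assumes "r \<in> lpa_ideal G"
  shows "act G r f = (\<lambda>\<xi> n. 0)"
proof -
  let ?F = "free_algebra (lpa_gens G) :: (('a, 'b) lpa_gen free_monoid \<Rightarrow>\<^sub>0 'k) ring"
  let ?J = "{p \<in> carrier ?F. \<forall>f. act G p f = (\<lambda>\<xi> n. 0)}"
  interpret F: ring ?F
    by (rule ring_free_algebra)
  have "ideal ?J ?F"
  proof (rule idealI[OF ring_free_algebra])
    show "subgroup ?J (add_monoid ?F)"
    proof (rule F.add.subgroupI)
      show "\<ominus>\<^bsub>?F\<^esub> a \<in> ?J" if "a \<in> ?J" for a
      proof -
        have "- a \<in> ?J"
          using that act_diff[of G 0 a] by (simp add: carrier_free_algebra)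
        then show ?thesis
          using that free_algebra_uminus[of a] by simp
      qed
    qed (auto simp: carrier_free_algebra intro!: exI[of _ 0])
  qed (auto simp: carrier_free_algebra act_of_zero)
  moreover have "lpa_relations G \<subseteq> ?J"
    using lpa_relations_carrier act_relation by blast
  ultimately have "lpa_ideal G \<subseteq> ?J"
    unfolding lpa_ideal_def by (rule F.genideal_minimal)
  with assms show ?thesis
    by blast
qed

section \<open>Cycles obstruct regularity\<close>

lemma (in wf_digraph) act_path:
  assumes "\<xi> \<in> infinite_paths G"
  shows "act G (prod_list (map (\<lambda>e. gen (Edge e)) p)) f \<xi> n
    = (if stake (length p) \<xi> = p then f (sdrop (length p) \<xi>) (n - int (length p)) else 0)"
  using assms
proof (induction p arbitrary: \<xi> n)
  case Nil
  then show ?case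
    by (simp flip: single_one)
next
  case (Cons e p)
  then show ?case
    by (simp add: infinite_paths_stl algebra_simps)
qed

lemma lookup_gen_zero: "Poly_Mapping.lookup (gen x) 0 = 0"
  by (simp add: gen_def lookup_single zero_free_monoid_def when_def)

lemma act_path_outside:
  assumes "\<xi> \<notin> infinite_paths E" and "p \<noteq> []"
  shows "act E (prod_list (map (\<lambda>e. gen (Edge e)) p)) f \<xi> n = 0"
  using assms by (cases p) simp_all

text \<open>Let T = v - c with quasi-inverse b, let \<delta> be the indicator of c^\<infinity> in
  degree 0, and put h = bT\<delta> - \<delta>. Then T h = 0, and evaluation at c^\<infinity> says
  that h is periodic in the degree with period |c|. Boundedness forces h = 0 at the multiples of
  |c|, which is the difference equation for g = b\<delta>. Its solution vanishes far to the left,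
  jumps to 1 in degree 0 and stays there, contradicting boundedness on the right.\<close>

lemma (in wf_digraph) acyclic_if_von_neumann_regular_lpa:
  assumes vnr: "von_neumann_regular (carrier (leavitt_path_algebra TYPE('k::comm_ring_1) G))
    (mult (leavitt_path_algebra TYPE('k) G))"
  shows "acyclic_digraph G"
proof (rule ccontr)
  assume "\<not> acyclic_digraph G"
  then obtain u p where p: "p \<noteq> []" "awalk u p u"
    by (auto simp: acyclic_digraph_def)
  let ?l = "int (length p)" and ?\<xi> = "Stream.cycle p"
  have \<xi>: "?\<xi> \<in> infinite_paths G"
    by (rule cycle_in_infinite_paths[OF p(2,1)])
  have tail: "tail G (shd ?\<xi>) = u"
    using p by (cases p) (auto simp: awalk_Cons_iff)
  have l: "?l > 0"
    using p by simp
  let ?c = "prod_list (map (\<lambda>e. gen (Edge e)) p) :: ('a, 'b) lpa_gen free_monoid \<Rightarrow>\<^sub>0 'k"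
  let ?T = "gen (Vertex u) - ?c"
  have "trunc (lpa_gens G) (prod_list (map (\<lambda>e. gen (Edge e)) q)) = (prod_list (map (\<lambda>e. gen (Edge e)) q) :: ('a, 'b) lpa_gen free_monoid \<Rightarrow>\<^sub>0 'k)"
    if "set q \<subseteq> arcs G" for q
    using that by (induction q) (simp_all add: trunc_single flip: single_one)
  then have "trunc (lpa_gens G) ?T = ?T"
    using p(2) unfolding awalk_def by simp
  moreover have "Poly_Mapping.lookup ?T 0 = 0"
    using p(1) by (cases p) (simp_all add: lookup_minus lookup_mult_zero lookup_gen_zero)
  ultimately obtain b where b: "?T * b * ?T - ?T \<in> lpa_ideal G"
    using vnr unfolding von_neumann_regular_lpa_iff by blast
  define \<delta> :: "int \<Rightarrow> ('b, 'k) graded_fun" where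
    "\<delta> k = (\<lambda>\<zeta> n. if \<zeta> = ?\<xi> \<and> n = k then 1 else 0)" for k
  \<comment> \<open>Only c^\<infinity> both begins with c and continues as c^\<infinity>; hence c
    carries its indicator to itself with the degree raised by |c|.\<close>
  have stake: "stake (length p) \<zeta> = p \<and> sdrop (length p) \<zeta> = ?\<xi> \<longleftrightarrow> \<zeta> = ?\<xi>" for \<zeta>
    using cycle_decomp[OF p(1)] p(1) by (metis stake_sdrop stake_cycle_eq sdrop_cycle_eq)
  have c\<delta>: "act G ?c (\<delta> 0) = \<delta> ?l"
  proof (intro ext)
    fix \<zeta> n
    show "act G ?c (\<delta> 0) \<zeta> n = \<delta> ?l \<zeta> n"
    proof (cases "\<zeta> \<in> infinite_paths G")
      case True
      then show ?thesis
        using stake[of \<zeta>] by (auto simp: act_path \<delta>_def)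
    next
      case False
      then show ?thesis
        using \<xi> p(1) by (auto simp: act_path_outside \<delta>_def)
    qed
  qed
  have T\<delta>: "act G ?T (\<delta> 0) = (\<lambda>\<zeta> n. \<delta> 0 \<zeta> n - \<delta> ?l \<zeta> n)"
  proof -
    have "gen_act G (Vertex u) (\<delta> 0) = \<delta> 0"
      using \<xi> tail by (auto simp: fun_eq_iff \<delta>_def)
    then show ?thesis
      by (simp add: c\<delta>)
  qed
  define g where "g = act G b (\<delta> 0)"
  have "\<delta> ?l = (\<lambda>\<zeta> n. \<delta> 0 \<zeta> (n - ?l))"
    by (auto simp: \<delta>_def fun_eq_iff)
  then have bT\<delta>: "act G b (act G ?T (\<delta> 0)) = (\<lambda>\<zeta> n. g \<zeta> n - g \<zeta> (n - ?l))"
    unfolding T\<delta> act_of_diff g_def by (simp add: act_shift)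
  \<comment> \<open>This is bT\<delta> - \<delta>. The identity TbT = T on \<delta> says precisely
    that T annihilates it.\<close>
  define h where "h = (\<lambda>\<zeta> n. g \<zeta> n - g \<zeta> (n - ?l) - \<delta> 0 \<zeta> n)"
  have "act G ?T h = (\<lambda>\<zeta> n. act G (?T * b * ?T - ?T) (\<delta> 0) \<zeta> n)"
    unfolding h_def by (subst act_of_diff) (simp only: act_diff[of G "?T * b * ?T" ?T] act_mult bT\<delta>)
  then have "act G ?T h = (\<lambda>\<zeta> n. 0)"
    using act_lpa_ideal[OF b] by simp
  then have "act G ?T h ?\<xi> n = 0" for n
    by simp
  then have per: "h ?\<xi> n = h ?\<xi> (n - ?l)" for n
    using \<xi> tail p(1) by (simp add: act_path)
  have "degree_bounded (\<delta> 0)"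
    unfolding degree_bounded_def \<delta>_def by (intro exI[of _ 0]) auto
  then have "degree_bounded g"
    unfolding g_def by (rule degree_bounded_act)
  then obtain N where N: "\<And>n. \<bar>n\<bar> > N \<Longrightarrow> g ?\<xi> n = 0"
    unfolding degree_bounded_def by blast
  \<comment> \<open>As |c| is at least 1, multiples of |c| with factor at least |N| + 1 in absolute
    value lie beyond the bound \<open>N\<close>.\<close>
  define M where "M = nat \<bar>N\<bar> + 1"
  have M: "\<bar>?l * k\<bar> > N" if "\<bar>k\<bar> \<ge> int M" for k
  proof -
    have "\<bar>k\<bar> \<le> ?l * \<bar>k\<bar>"
      using l by (simp add: mult_le_cancel_right1 Suc_le_eq)
    then show ?thesis
      using that by (simp add: M_def abs_mult)
  qed
  have minus_Suc: "- (?l * int (Suc k)) = - (?l * int k) - ?l" for k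
    by (simp add: algebra_simps)
  have h_mult: "h ?\<xi> (?l * int k) = h ?\<xi> 0" "h ?\<xi> (- (?l * int k)) = h ?\<xi> 0" for k
  proof (induction k)
    case (Suc k)
    {
      case 1
      then show ?case
        using Suc(1) per[of "?l * int (Suc k)"] by (simp add: algebra_simps)
    next
      case 2
      then show ?case
        using Suc(2) per[of "- (?l * int k)"] by (simp only: minus_Suc)
    }
  qed simp_all
  \<comment> \<open>The value is read off at the multiple M + 1, because h there also involves g at
    the preceding multiple, which must still lie beyond the bound.\<close>
  have h0: "h ?\<xi> 0 = 0"
  proof -
    have "h ?\<xi> (?l * int (M + 1)) = g ?\<xi> (?l * int (M + 1)) - g ?\<xi> (?l * int M) - \<delta> 0 ?\<xi> (?l * int (M + 1))"
      by (simp add: h_def algebra_simps)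
    also have "\<dots> = 0"
      using N[OF M[of "int (M + 1)"]] N[OF M[of "int M"]] l by (simp add: \<delta>_def)
    finally show ?thesis
      by (simp only: h_mult)
  qed
  \<comment> \<open>The zero value travels from -M towards the origin and must stop at k = 1, since
    the difference equation has its jump at 0.\<close>
  have neg: "g ?\<xi> (- (?l * int k)) = 0" if "k \<ge> 1" "k \<le> M" for k
    using that(2,1)
  proof (induction k rule: inc_induct)
    case base
    then show ?case
      using N M[of "- int M"] by simp
  next
    case (step k)
    have "h ?\<xi> (- (?l * int k)) = 0"
      using h0 by (simp only: h_mult)
    moreover have "- (?l * int k) \<noteq> 0"
      using l step.prems by simp
    ultimately have "g ?\<xi> (- (?l * int k)) = g ?\<xi> (- (?l * int (Suc k)))"
      unfolding minus_Suc by (simp add: h_def \<delta>_def)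
    with step.IH show ?case
      by simp
  qed
  have pos: "g ?\<xi> (?l * int k) = 1" for k
  proof (induction k)
    case 0
    have "h ?\<xi> 0 = 0" "g ?\<xi> (- ?l) = 0"
      using h0 neg[of 1] by (auto simp: M_def)
    then show ?case
      by (simp add: h_def \<delta>_def)
  next
    case (Suc k)
    have "h ?\<xi> (?l * int (Suc k)) = 0"
      using h0 by (simp only: h_mult)
    moreover have "?l * int (Suc k) \<noteq> 0"
      using l by simp
    ultimately have "g ?\<xi> (?l * int (Suc k)) = g ?\<xi> (?l * int (Suc k) - ?l)"
      by (simp add: h_def \<delta>_def)
    with Suc show ?case
      by (simp add: algebra_simps)
  qed
  have "g ?\<xi> (?l * int M) = 0"
    using N M[of "int M"] by simp
  with pos show False
    by simp
qed

section \<open>Concatenation of boundary paths\<close>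

fun hd_edge :: "('v, 'e) gpath \<Rightarrow> 'e option" where
  "hd_edge (FinPath \<mu>) = (case snd \<mu> of [] \<Rightarrow> None | e # p \<Rightarrow> Some e)"
| "hd_edge (InfPath \<xi>) = Some (shd \<xi>)"

definition composable :: "('v, 'e) pre_digraph \<Rightarrow> ('v, 'e) finite_path \<Rightarrow> ('v, 'e) gpath \<Rightarrow> bool" where
  "composable E \<mu> z \<longleftrightarrow> \<mu> \<in> finite_paths E \<and> z \<in> boundary_paths E \<and> gpath_source E z = path_range E \<mu>"

context wf_digraph
begin

lemma finite_paths_iff: "\<mu> \<in> finite_paths G \<longleftrightarrow> awalk (fst \<mu>) (snd \<mu>) (path_range G \<mu>)"
  by (auto simp: finite_paths_def path_range_def)

lemma path_range_append: "path_range G (u, p @ q) = path_range G (path_range G (u, p), q)"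
  by (simp add: path_range_def awlast_append)

lemma path_range_Nil [simp]: "path_range G (u, []) = u"
  by (simp add: path_range_def)

lemma path_range_awalk: "awalk u p v \<Longrightarrow> path_range G (u, p) = v"
  by (auto simp: path_range_def)

lemma infinite_paths_shift:
  "awalk u p v \<Longrightarrow> \<xi> \<in> infinite_paths G \<Longrightarrow> tail G (shd \<xi>) = v \<Longrightarrow>
    p @- \<xi> \<in> infinite_paths G \<and> tail G (shd (p @- \<xi>)) = u"
  by (induction p arbitrary: u) (auto simp: awalk_simps infinite_paths_Stream)

lemma infinite_paths_sdrop:
  "\<xi> \<in> infinite_paths G \<Longrightarrow> awalk (tail G (shd \<xi>)) (stake n \<xi>) (tail G (shd (sdrop n \<xi>)))
    \<and> sdrop n \<xi> \<in> infinite_paths G"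
proof (induction n arbitrary: \<xi>)
  case 0
  then show ?case
    using infinite_paths_unfold[of \<xi>] by (simp add: awalk_Nil_iff)
next
  case (Suc n)
  then show ?case
    using infinite_paths_unfold[of \<xi>] Suc.IH[of "stl \<xi>"] by (simp add: awalk_Cons_iff)
qed

lemma finite_paths_append_iff:
  "(u, p @ q) \<in> finite_paths G \<longleftrightarrow> (u, p) \<in> finite_paths G \<and> (path_range G (u, p), q) \<in> finite_paths G"
  by (simp add: finite_paths_iff path_range_def awlast_append)

lemma FinPath_boundary_iff:
  "FinPath \<nu> \<in> boundary_paths G \<longleftrightarrow> \<nu> \<in> finite_paths G \<and> path_range G \<nu> \<in> singular_verts G"
  by (auto simp: boundary_paths_def)

lemma InfPath_boundary_iff: "InfPath \<xi> \<in> boundary_paths G \<longleftrightarrow> \<xi> \<in> infinite_paths G"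
  by (auto simp: boundary_paths_def)

lemma path_range_finite_paths: "\<mu> \<in> finite_paths G \<Longrightarrow> path_range G \<mu> \<in> verts G"
  by (auto simp: finite_paths_iff)

lemma gpath_source_boundary: "z \<in> boundary_paths G \<Longrightarrow> gpath_source G z \<in> verts G"
  using infinite_paths_unfold[of "case z of InfPath \<xi> \<Rightarrow> \<xi>"]
  by (cases z) (auto simp: InfPath_boundary_iff FinPath_boundary_iff finite_paths_iff)

lemma composable_append:
  assumes "composable G \<mu> z"
  shows "path_append \<mu> z \<in> boundary_paths G" "gpath_source G (path_append \<mu> z) = fst \<mu>"
    "path_shift G (path_length \<mu>) (path_append \<mu> z) = z"
    "enat (path_length \<mu>) \<le> gpath_length (path_append \<mu> z)"
proof -
  have \<mu>: "awalk (fst \<mu>) (snd \<mu>) (path_range G \<mu>)" and z: "z \<in> boundary_paths G" "gpath_source G z = path_range G \<mu>"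
    using assms by (auto simp: composable_def finite_paths_iff)
  have "path_append \<mu> z \<in> boundary_paths G \<and> gpath_source G (path_append \<mu> z) = fst \<mu> \<and>
    path_shift G (path_length \<mu>) (path_append \<mu> z) = z \<and> enat (path_length \<mu>) \<le> gpath_length (path_append \<mu> z)"
  proof (cases z)
    case (FinPath \<nu>)
    with z have "fst \<nu> = path_range G \<mu>" "\<nu> \<in> finite_paths G" "path_range G \<nu> \<in> singular_verts G"
      by (auto simp: FinPath_boundary_iff)
    moreover from this have "(fst \<mu>, snd \<mu> @ snd \<nu>) \<in> finite_paths G"
      using \<mu> unfolding finite_paths_append_iff by (metis finite_paths_iff prod.collapse)
    moreover from calculation have "path_range G (fst \<mu>, snd \<mu> @ snd \<nu>) = path_range G \<nu>"
      by (metis path_range_append prod.collapse)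
    ultimately show ?thesis
      using FinPath by (simp add: FinPath_boundary_iff path_length_def prod_eq_iff)
  next
    case (InfPath \<xi>)
    with z \<mu> show ?thesis
      using infinite_paths_shift[OF \<mu>, of \<xi>]
      by (simp add: InfPath_boundary_iff path_length_def sdrop_shift)
  qed
  then show "path_append \<mu> z \<in> boundary_paths G" "gpath_source G (path_append \<mu> z) = fst \<mu>"
    "path_shift G (path_length \<mu>) (path_append \<mu> z) = z"
    "enat (path_length \<mu>) \<le> gpath_length (path_append \<mu> z)"
    by blast+
qed

lemma path_append_append:
  "path_append (u, p @ q) z = path_append (u, p) (path_append (v, q) z)"
  by (cases z) simp_all

lemma composable_append_iff:
  "composable G (u, p @ q) z \<longleftrightarrow> (u, p) \<in> finite_paths G \<and> composable G (path_range G (u, p), q) z"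
  by (auto simp: composable_def finite_paths_append_iff path_range_append)

lemma composable_path_append:
  assumes "composable G (u, p @ q) z"
  shows "composable G (u, p) (path_append (path_range G (u, p), q) z)"
proof -
  have "(u, p) \<in> finite_paths G" and c: "composable G (path_range G (u, p), q) z"
    using assms by (simp_all add: composable_append_iff)
  then show ?thesis
    using composable_append(1,2)[OF c] by (simp add: composable_def)
qed

lemma boundary_path_split:
  assumes "x \<in> boundary_paths G" "enat m \<le> gpath_length x"
  obtains \<mu> where "composable G \<mu> (path_shift G m x)" "path_length \<mu> = m" "path_append \<mu> (path_shift G m x) = x"
proof (cases x)
  case (FinPath \<nu>)
  let ?\<mu> = "(fst \<nu>, take m (snd \<nu>))" and ?\<rho> = "(path_range G (fst \<nu>, take m (snd \<nu>)), drop m (snd \<nu>))"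
  have \<nu>: "\<nu> = (fst \<nu>, take m (snd \<nu>) @ drop m (snd \<nu>))"
    by simp
  have "\<nu> \<in> finite_paths G" "path_range G \<nu> \<in> singular_verts G"
    using assms FinPath by (auto simp: FinPath_boundary_iff)
  then have "?\<mu> \<in> finite_paths G" "?\<rho> \<in> finite_paths G" "path_range G ?\<rho> \<in> singular_verts G"
    using \<nu> finite_paths_append_iff path_range_append by metis+
  then show ?thesis
    using assms FinPath that[of ?\<mu>]
    by (simp add: composable_def FinPath_boundary_iff path_length_def)
next
  case (InfPath \<xi>)
  let ?\<mu> = "(tail G (shd \<xi>), stake m \<xi>)"
  have "awalk (tail G (shd \<xi>)) (stake m \<xi>) (tail G (shd (sdrop m \<xi>)))" "sdrop m \<xi> \<in> infinite_paths G"
    using assms InfPath infinite_paths_sdrop by (auto simp: InfPath_boundary_iff)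
  then show ?thesis
    using InfPath that[of ?\<mu>]
    by (auto simp: composable_def InfPath_boundary_iff path_length_def stake_sdrop finite_paths_iff path_range_awalk)
qed

text \<open>Both sources equal the source of the common path; they are compared separately because
  an empty edge list carries no vertex. The rest cuts one edge sequence at two positions.\<close>

lemma path_append_prefix:
  assumes "composable G \<mu> z" "composable G \<nu> w" "path_append \<mu> z = path_append \<nu> w"
    and "path_length \<mu> \<le> path_length \<nu>"
  obtains p where "\<nu> = (fst \<mu>, snd \<mu> @ p)" "z = path_append (path_range G \<mu>, p) w"
proof -
  have src: "fst \<mu> = fst \<nu>"
    using assms composable_append(2) by metis
  show ?thesis
  proof (cases z)
    case z: (FinPath \<alpha>)
    then obtain \<beta> where w: "w = FinPath \<beta>"
      using assms(3) by (cases w) auto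
    have eq: "snd \<mu> @ snd \<alpha> = snd \<nu> @ snd \<beta>"
      using assms(3) z w by simp
    obtain p where "snd \<nu> = snd \<mu> @ p" "snd \<alpha> = p @ snd \<beta>"
    proof
      have "snd \<mu> = take (length (snd \<mu>)) (snd \<nu>)"
        using arg_cong[OF eq, of "take (length (snd \<mu>))"] assms(4) by (simp add: path_length_def)
      then show "snd \<nu> = snd \<mu> @ drop (length (snd \<mu>)) (snd \<nu>)"
        by (metis append_take_drop_id)
      show "snd \<alpha> = drop (length (snd \<mu>)) (snd \<nu>) @ snd \<beta>"
        using arg_cong[OF eq, of "drop (length (snd \<mu>))"] assms(4) by (simp add: path_length_def)
    qed
    then show ?thesis
      using that[of p] src z w assms(1) by (simp add: prod_eq_iff composable_def)
  next
    case z: (InfPath \<xi>)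
    then obtain \<zeta> where w: "w = InfPath \<zeta>"
      using assms(3) by (cases w) auto
    have eq: "snd \<mu> @- \<xi> = snd \<nu> @- \<zeta>"
      using assms(3) z w by simp
    have "snd \<mu> = take (length (snd \<mu>)) (snd \<nu>)"
      using arg_cong[OF eq, of "stake (length (snd \<mu>))"] assms(4) by (simp add: stake_shift path_length_def)
    then have "snd \<nu> = snd \<mu> @ drop (length (snd \<mu>)) (snd \<nu>)"
      by (metis append_take_drop_id)
    moreover have "\<xi> = drop (length (snd \<mu>)) (snd \<nu>) @- \<zeta>"
      using arg_cong[OF eq, of "sdrop (length (snd \<mu>))"] assms(4) by (simp add: sdrop_shift path_length_def)
    ultimately show ?thesis
      using that[of "drop (length (snd \<mu>)) (snd \<nu>)"] src z w by (metis path_append.simps(2) prod.collapse snd_conv)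
  qed
qed

lemma path_append_cancel:
  assumes "composable G \<mu> z" "composable G \<nu> w" "path_append \<mu> z = path_append \<nu> w"
    and "path_length \<mu> = path_length \<nu>"
  shows "\<mu> = \<nu>" "z = w"
proof -
  show "z = w"
    using composable_append(3)[OF assms(1)] composable_append(3)[OF assms(2)] assms(3,4) by simp
  obtain p where "\<nu> = (fst \<mu>, snd \<mu> @ p)"
    using path_append_prefix[OF assms(1-3)] assms(4) by auto
  with assms(4) show "\<mu> = \<nu>"
    by (simp add: path_length_def prod_eq_iff)
qed

lemma path_append_Nil: "gpath_source G z = u \<Longrightarrow> path_append (u, []) z = z"
  by (cases z) (auto simp: prod_eq_iff)

lemma hd_edge_append: "p \<noteq> [] \<Longrightarrow> hd_edge (path_append (u, p) z) = Some (hd p)"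
  by (cases z; cases p) auto

lemma hd_edge_SomeE:
  assumes "z \<in> boundary_paths G" "hd_edge z = Some e"
  obtains w where "composable G (gpath_source G z, [e]) w" "z = path_append (gpath_source G z, [e]) w"
    "e \<in> out_arcs G (gpath_source G z)"
proof -
  have "enat 1 \<le> gpath_length z"
    using assms(2) by (cases z) (auto simp: path_length_def split: list.splits)
  then obtain \<mu> w where \<mu>: "composable G \<mu> w" "path_length \<mu> = 1" "path_append \<mu> w = z"
    using boundary_path_split[OF assms(1)] by metis
  then have "snd \<mu> = [e]"
    using assms(2) hd_edge_append[of "snd \<mu>" "fst \<mu>" w] by (auto simp: path_length_def length_Suc_conv)
  then have "\<mu> = (gpath_source G z, [e])"
    using \<mu> composable_append(2)[OF \<mu>(1)] by (simp add: prod_eq_iff)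
  moreover from this have "e \<in> out_arcs G (gpath_source G z)"
    using \<mu>(1) by (auto simp: composable_def finite_paths_iff awalk_Cons_iff)
  ultimately show ?thesis
    using that \<mu> by auto
qed

section \<open>Arrows and basic sets\<close>

text \<open>The set Z(\<mu>, F, \<nu>) parametrised by the common tail z. This replaces equations
  between shifted paths by factorisations, which is the form used for refining and
  composing.\<close>

definition basic_set :: "('a, 'b) finite_path \<Rightarrow> 'b set \<Rightarrow> ('a, 'b) finite_path \<Rightarrow> ('a, 'b) bpg_arrow set" where
  "basic_set \<mu> F \<nu> = {(path_append \<mu> z, int (path_length \<mu>) - int (path_length \<nu>), path_append \<nu> z) | z.
     composable G \<mu> z \<and> composable G \<nu> z \<and> hd_edge z \<notin> Some ` F}"

lemma bpg_arrows_iff: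
  "(x, k, y) \<in> bpg_arrows G \<longleftrightarrow> (\<exists>\<mu> \<nu> z. composable G \<mu> z \<and> composable G \<nu> z \<and>
     x = path_append \<mu> z \<and> y = path_append \<nu> z \<and> k = int (path_length \<mu>) - int (path_length \<nu>))"
proof
  assume "(x, k, y) \<in> bpg_arrows G"
  then obtain m n where mn: "x \<in> boundary_paths G" "y \<in> boundary_paths G" "enat m \<le> gpath_length x"
      "enat n \<le> gpath_length y" "path_shift G m x = path_shift G n y" "k = int m - int n"
    by (auto simp: bpg_arrows_def)
  obtain \<mu> where "composable G \<mu> (path_shift G m x)" "path_length \<mu> = m" "path_append \<mu> (path_shift G m x) = x"
    using boundary_path_split mn by blast
  moreover obtain \<nu> where "composable G \<nu> (path_shift G n y)" "path_length \<nu> = n" "path_append \<nu> (path_shift G n y) = y"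
    using boundary_path_split mn by blast
  ultimately show "\<exists>\<mu> \<nu> z. composable G \<mu> z \<and> composable G \<nu> z \<and>
     x = path_append \<mu> z \<and> y = path_append \<nu> z \<and> k = int (path_length \<mu>) - int (path_length \<nu>)"
    using mn(5,6) by (intro exI[of _ \<mu>] exI[of _ \<nu>] exI[of _ "path_shift G m x"]) auto
next
  assume "\<exists>\<mu> \<nu> z. composable G \<mu> z \<and> composable G \<nu> z \<and>
     x = path_append \<mu> z \<and> y = path_append \<nu> z \<and> k = int (path_length \<mu>) - int (path_length \<nu>)"
  then obtain \<mu> \<nu> z where z: "composable G \<mu> z" "composable G \<nu> z"
      "x = path_append \<mu> z" "y = path_append \<nu> z" "k = int (path_length \<mu>) - int (path_length \<nu>)"
    by blast
  show "(x, k, y) \<in> bpg_arrows G"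
    unfolding bpg_arrows_def mem_Collect_eq
    by (rule exI[of _ x], rule exI[of _ "path_length \<mu>"], rule exI[of _ "path_length \<nu>"], rule exI[of _ y])
      (simp add: z composable_append[OF z(1)] composable_append[OF z(2)])
qed

lemma cylinder_minus_iff:
  assumes "composable G \<mu> z" "F \<subseteq> out_arcs G (path_range G \<mu>)"
  shows "path_append \<mu> z \<in> cylinder_minus G \<mu> F \<longleftrightarrow> hd_edge z \<notin> Some ` F"
proof -
  have "path_append \<mu> z \<in> cylinder G (fst \<mu>, snd \<mu> @ [e]) \<longleftrightarrow> hd_edge z = Some e" if "e \<in> F" for e
  proof
    assume "path_append \<mu> z \<in> cylinder G (fst \<mu>, snd \<mu> @ [e])"
    then obtain w where w: "w \<in> boundary_paths G" "gpath_source G w = path_range G (fst \<mu>, snd \<mu> @ [e])"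
        "path_append \<mu> z = path_append (fst \<mu>, snd \<mu> @ [e]) w"
      by (auto simp: cylinder_def)
    have \<mu>: "\<mu> \<in> finite_paths G"
      using assms(1) by (simp add: composable_def)
    moreover have "(path_range G \<mu>, [e]) \<in> finite_paths G"
      using that assms(2) by (auto simp: finite_paths_iff awalk_simps path_range_def)
    ultimately have c: "composable G (fst \<mu>, snd \<mu> @ [e]) w"
      using w by (simp add: composable_def finite_paths_append_iff)
    have "z = path_append (path_range G \<mu>, [e]) w"
      using path_append_cancel(2)[OF assms(1) composable_path_append[OF c, unfolded prod.collapse]] w(3)
        path_append_append[of "fst \<mu>" "snd \<mu>" "[e]" w "path_range G \<mu>"] by simp
    then show "hd_edge z = Some e"
      by (simp add: hd_edge_append)
  next
    assume "hd_edge z = Some e"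
    then obtain w where w: "composable G (gpath_source G z, [e]) w" "z = path_append (gpath_source G z, [e]) w"
      using hd_edge_SomeE assms(1) by (metis composable_def)
    have "gpath_source G w = path_range G (fst \<mu>, snd \<mu> @ [e])"
      using w(1) assms(1) path_range_append[of "fst \<mu>" "snd \<mu>" "[e]"] by (simp add: composable_def)
    moreover have "path_append \<mu> z = path_append (fst \<mu>, snd \<mu> @ [e]) w"
      using w(2) path_append_append[of "fst \<mu>" "snd \<mu>" "[e]" w "gpath_source G z"] by simp
    ultimately show "path_append \<mu> z \<in> cylinder G (fst \<mu>, snd \<mu> @ [e])"
      using w(1) unfolding cylinder_def composable_def by blast
  qed
  moreover have "path_append \<mu> z \<in> cylinder G \<mu>"
    using assms(1) by (auto simp: cylinder_def composable_def)
  ultimately show ?thesis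
    by (auto simp: cylinder_minus_def)
qed

lemma bpg_basic_set_conv:
  assumes "\<mu> \<in> finite_paths G" "\<nu> \<in> finite_paths G" "path_range G \<mu> = path_range G \<nu>"
    and "F \<subseteq> out_arcs G (path_range G \<mu>)"
  shows "bpg_basic_set G \<mu> F \<nu> = basic_set \<mu> F \<nu>"
proof (intro Set.set_eqI iffI)
  fix g assume "g \<in> bpg_basic_set G \<mu> F \<nu>"
  then obtain x y where g: "g = (x, int (path_length \<mu>) - int (path_length \<nu>), y)"
      "x \<in> cylinder_minus G \<mu> F" "y \<in> cylinder_minus G \<nu> F"
      "path_shift G (path_length \<mu>) x = path_shift G (path_length \<nu>) y"
    by (auto simp: bpg_basic_set_def)
  obtain z w where zw: "composable G \<mu> z" "x = path_append \<mu> z" "composable G \<nu> w" "y = path_append \<nu> w"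
    using g assms by (auto simp: cylinder_minus_def cylinder_def composable_def)
  moreover from zw g(4) have "z = w"
    using composable_append(3) by metis
  moreover have "hd_edge z \<notin> Some ` F"
    using cylinder_minus_iff[OF zw(1) assms(4)] g(2) zw(2) by blast
  ultimately show "g \<in> basic_set \<mu> F \<nu>"
    using g(1) by (auto simp: basic_set_def)
next
  fix g assume "g \<in> basic_set \<mu> F \<nu>"
  then obtain z where z: "g = (path_append \<mu> z, int (path_length \<mu>) - int (path_length \<nu>), path_append \<nu> z)"
      "composable G \<mu> z" "composable G \<nu> z" "hd_edge z \<notin> Some ` F"
    by (auto simp: basic_set_def)
  moreover from z have "g \<in> bpg_arrows G"
    using bpg_arrows_iff by blast
  moreover have "path_append \<mu> z \<in> cylinder_minus G \<mu> F" "path_append \<nu> z \<in> cylinder_minus G \<nu> F"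
    using cylinder_minus_iff z assms by auto
  ultimately show "g \<in> bpg_basic_set G \<mu> F \<nu>"
    unfolding bpg_basic_set_def using composable_append(3) by auto
qed

definition basic_index :: "('a, 'b) finite_path \<Rightarrow> 'b set \<Rightarrow> ('a, 'b) finite_path \<Rightarrow> bool" where
  "basic_index \<mu> F \<nu> \<longleftrightarrow> \<mu> \<in> finite_paths G \<and> \<nu> \<in> finite_paths G \<and> path_range G \<mu> = path_range G \<nu> \<and>
     finite F \<and> F \<subseteq> out_arcs G (path_range G \<mu>)"

lemma bpg_topology_conv:
  "bpg_topology G = topology_generated_by {basic_set \<mu> F \<nu> | \<mu> F \<nu>. basic_index \<mu> F \<nu>}"
proof -
  have "{bpg_basic_set G \<mu> F \<nu> | \<mu> F \<nu>. \<mu> \<in> finite_paths G \<and> \<nu> \<in> finite_paths G \<and>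
      path_range G \<mu> = path_range G \<nu> \<and> finite F \<and> F \<subseteq> out_arcs G (path_range G \<mu>)}
    = {basic_set \<mu> F \<nu> | \<mu> F \<nu>. basic_index \<mu> F \<nu>}"
    unfolding basic_index_def using bpg_basic_set_conv by blast
  then show ?thesis
    unfolding bpg_topology_def by simp
qed

lemma openin_basic_set: "basic_index \<mu> F \<nu> \<Longrightarrow> openin (bpg_topology G) (basic_set \<mu> F \<nu>)"
  unfolding bpg_topology_conv by (rule topology_generated_by_Basis) blast

lemma basic_set_arrows: "basic_set \<mu> F \<nu> \<subseteq> bpg_arrows G"
  unfolding basic_set_def using bpg_arrows_iff by blast

lemma arrow_in_basic_set:
  assumes "composable G \<mu> z" "composable G \<nu> z"
  shows "basic_index \<mu> {} \<nu>"
    and "(path_append \<mu> z, int (path_length \<mu>) - int (path_length \<nu>), path_append \<nu> z) \<in> basic_set \<mu> {} \<nu>"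
  using assms by (auto simp: basic_index_def basic_set_def composable_def)

lemma bpg_arrowE:
  assumes "g \<in> bpg_arrows G"
  obtains \<mu> \<nu> z where "composable G \<mu> z" "composable G \<nu> z"
    "g = (path_append \<mu> z, int (path_length \<mu>) - int (path_length \<nu>), path_append \<nu> z)"
  using assms bpg_arrows_iff by (metis prod.collapse)

lemma topspace_bpg: "topspace (bpg_topology G) = bpg_arrows G"
proof
  show "topspace (bpg_topology G) \<subseteq> bpg_arrows G"
    unfolding bpg_topology_conv topology_generated_by_topspace using basic_set_arrows by blast
  show "bpg_arrows G \<subseteq> topspace (bpg_topology G)"
  proof
    fix g assume "g \<in> bpg_arrows G"
    then obtain \<mu> \<nu> z where "composable G \<mu> z" "composable G \<nu> z"
        "g = (path_append \<mu> z, int (path_length \<mu>) - int (path_length \<nu>), path_append \<nu> z)"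
      by (rule bpg_arrowE)
    then show "g \<in> topspace (bpg_topology G)"
      using arrow_in_basic_set openin_basic_set openin_subset by blast
  qed
qed

lemma openin_lag: "openin (bpg_topology G) {g \<in> bpg_arrows G. fst (snd g) = k}"
proof (subst openin_subopen, intro ballI)
  fix g assume g: "g \<in> {g \<in> bpg_arrows G. fst (snd g) = k}"
  then obtain \<mu> \<nu> z where z: "composable G \<mu> z" "composable G \<nu> z"
      "g = (path_append \<mu> z, int (path_length \<mu>) - int (path_length \<nu>), path_append \<nu> z)"
    using bpg_arrowE by blast
  with g have lag: "int (path_length \<mu>) - int (path_length \<nu>) = k"
    by simp
  show "\<exists>T. openin (bpg_topology G) T \<and> g \<in> T \<and> T \<subseteq> {g \<in> bpg_arrows G. fst (snd g) = k}"
  proof (intro exI conjI)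
    show "openin (bpg_topology G) (basic_set \<mu> {} \<nu>)"
      using arrow_in_basic_set(1) z openin_basic_set by blast
    show "g \<in> basic_set \<mu> {} \<nu>"
      using arrow_in_basic_set(2) z by blast
    show "basic_set \<mu> {} \<nu> \<subseteq> {g \<in> bpg_arrows G. fst (snd g) = k}"
      using basic_set_arrows[of \<mu> "{}" \<nu>] lag by (auto simp: basic_set_def)
  qed
qed

section \<open>Acyclicity and principality\<close>

text \<open>If \<nu> were longer than \<mu>, then \<nu> = \<mu>p with p nonempty. Both ranges equal
  the source of the common tail z, so p would be a closed path.\<close>

lemma isotropy_cycle:
  assumes ac: "acyclic_digraph G" and z: "composable G \<mu> z" "composable G \<nu> z" "path_append \<mu> z = path_append \<nu> z"
  shows "path_length \<mu> = path_length \<nu>"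
proof -
  have "path_length \<nu> \<le> path_length \<mu>" if z: "composable G \<mu> z" "composable G \<nu> z" "path_append \<mu> z = path_append \<nu> z"
    for \<mu> \<nu>
  proof (rule ccontr)
    assume less: "\<not> path_length \<nu> \<le> path_length \<mu>"
    then obtain p where p: "\<nu> = (fst \<mu>, snd \<mu> @ p)"
      using path_append_prefix[OF z] by (metis nle_le)
    then have "p \<noteq> []"
      using less by (auto simp: path_length_def)
    moreover have "awalk (path_range G \<mu>) p (path_range G \<mu>)"
    proof -
      have "(path_range G \<mu>, p) \<in> finite_paths G" "path_range G (path_range G \<mu>, p) = path_range G \<nu>"
        using z p path_range_append[of "fst \<mu>" "snd \<mu>" p] finite_paths_append_iff[of "fst \<mu>" "snd \<mu>" p]
        by (auto simp: composable_def)
      moreover have "path_range G \<nu> = path_range G \<mu>"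
        using z by (simp add: composable_def)
      ultimately show ?thesis
        by (simp add: finite_paths_iff)
    qed
    ultimately show False
      using ac unfolding acyclic_digraph_def by blast
  qed
  then show ?thesis
    using z by (metis antisym)
qed

lemma boundary_path_groupoid_simps [simp]:
  "garrows (boundary_path_groupoid G) = bpg_arrows G"
  "gtopology (boundary_path_groupoid G) = bpg_topology G"
  "gsource (boundary_path_groupoid G) (x, k, y) = (y, 0, y)"
  "grange (boundary_path_groupoid G) (x, k, y) = (x, 0, x)"
  "gmult (boundary_path_groupoid G) (x, k, y) (y', l, z) = (x, k + l, z)"
  "ginverse (boundary_path_groupoid G) (x, k, y) = (y, - k, x)"
  by (simp_all add: boundary_path_groupoid_def)

lemma unit_arrow: "x \<in> boundary_paths G \<Longrightarrow> (x, 0, x) \<in> bpg_arrows G"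
  unfolding bpg_arrows_iff
  by (intro exI[of _ "(gpath_source G x, [])"] exI[of _ x])
    (simp add: composable_def path_append_Nil finite_paths_iff awalk_Nil_iff gpath_source_boundary)

lemma arrow_boundary: "(x, k, y) \<in> bpg_arrows G \<Longrightarrow> x \<in> boundary_paths G \<and> y \<in> boundary_paths G"
  by (auto simp: bpg_arrows_def)

lemma principal_iff:
  "principal_groupoid (boundary_path_groupoid G) \<longleftrightarrow> (\<forall>x k. (x, k, x) \<in> bpg_arrows G \<longrightarrow> k = 0)"
proof -
  have units: "gunits (boundary_path_groupoid G) = {(x, 0, x) | x. x \<in> boundary_paths G}"
    using unit_arrow arrow_boundary by (auto simp: gunits_def)
  have "isotropy (boundary_path_groupoid G) (x, 0, x) = {(x, k, x) | k. (x, k, x) \<in> bpg_arrows G}" for x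
    by (auto simp: isotropy_def)
  then show ?thesis
    unfolding principal_groupoid_def units using unit_arrow arrow_boundary by fastforce
qed

text \<open>The path c^\<infinity> factors through itself in two ways, with prefix c and with the
  empty prefix, and the lengths differ by |c|.\<close>

lemma cycle_arrow:
  assumes "awalk u p u" "p \<noteq> []"
  shows "(InfPath (Stream.cycle p), int (length p), InfPath (Stream.cycle p)) \<in> bpg_arrows G"
  unfolding bpg_arrows_iff
proof (intro exI conjI)
  have tail: "tail G (shd (Stream.cycle p)) = u"
    using assms by (cases p) (auto simp: awalk_Cons_iff)
  then show "composable G (u, p) (InfPath (Stream.cycle p))" "composable G (u, []) (InfPath (Stream.cycle p))"
    using assms cycle_in_infinite_paths[OF assms] path_range_awalk[OF assms(1)]
    by (auto simp: composable_def InfPath_boundary_iff finite_paths_iff awalk_Nil_iff)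
  show "InfPath (Stream.cycle p) = path_append (u, p) (InfPath (Stream.cycle p))"
    using cycle_decomp[OF assms(2)] by simp
qed (simp_all add: path_length_def)

lemma principal_iff_acyclic: "principal_groupoid (boundary_path_groupoid G) \<longleftrightarrow> acyclic_digraph G"
proof
  assume pr: "principal_groupoid (boundary_path_groupoid G)"
  show "acyclic_digraph G"
    unfolding acyclic_digraph_def
  proof (intro notI, elim exE conjE)
    fix u p assume "p \<noteq> []" "awalk u p u"
    then show False
      using pr cycle_arrow[of u p] unfolding principal_iff by fastforce
  qed
next
  assume "acyclic_digraph G"
  then show "principal_groupoid (boundary_path_groupoid G)"
    unfolding principal_iff bpg_arrows_iff using isotropy_cycle by (metis diff_self)
qed

section \<open>Cycles obstruct approximate quasi-compactness\<close>

lemma acyclic_if_approximately_quasi_compact: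
  assumes "approximately_quasi_compact (boundary_path_groupoid G)"
  shows "acyclic_digraph G"
  unfolding acyclic_digraph_def
proof (intro notI, elim exE conjE)
  fix u p assume p: "p \<noteq> []" "awalk u p u"
  let ?x = "InfPath (Stream.cycle p)" and ?C = "\<lambda>k. {g \<in> bpg_arrows G. fst (snd g) = k}"
  have "(?x, int (length p), ?x) \<in> bpg_arrows G"
    by (rule cycle_arrow[OF p(2,1)])
  then obtain H where H: "subgroupoid H (boundary_path_groupoid G)" "compactin (bpg_topology G) H"
      "(?x, int (length p), ?x) \<in> H"
    using assms unfolding approximately_quasi_compact_def boundary_path_groupoid_simps by blast
  \<comment> \<open>Powers are counted from 1, so the induction starts at the given arrow. They have
    infinitely many degrees, whereas a finite subcover by the degree sets admits only finitely
    many.\<close>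
  have pow: "(?x, int (Suc n) * int (length p), ?x) \<in> H" for n
  proof (induction n)
    case (Suc n)
    with H(1,3) have "gmult (boundary_path_groupoid G) (?x, int (length p), ?x) (?x, int (Suc n) * int (length p), ?x) \<in> H"
      unfolding subgroupoid_def by (metis boundary_path_groupoid_simps(3,4))
    then show ?case
      by (simp add: algebra_simps)
  qed (use H in simp)
  have "H \<subseteq> \<Union> (range ?C)"
    using H(1) by (auto simp: subgroupoid_def)
  then obtain \<F> where "finite \<F>" "\<F> \<subseteq> range ?C" "H \<subseteq> \<Union>\<F>"
    using compactinD[OF H(2), of "range ?C"] openin_lag by blast
  then obtain K where K: "finite K" "H \<subseteq> \<Union> (?C ` K)"
    using finite_subset_image[of \<F> ?C UNIV] by blast
  have "(\<lambda>n. int (Suc n) * int (length p)) ` UNIV \<subseteq> K"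
    using pow K(2) by fastforce
  moreover have "inj (\<lambda>n. int (Suc n) * int (length p))"
    using p(1) by (auto simp: inj_def)
  ultimately show False
    using K(1) by (meson finite_imageD finite_subset infinite_UNIV_nat)
qed

section \<open>Compactness of the basic sets\<close>

text \<open>Comparing prefixes gives \<mu> = \<alpha>p and \<nu> = \<beta>q; equal degrees make p
  and q equally long, and cancelling the common tail makes them equal. If p is nonempty, its first
  edge is already known to avoid \<open>F\<close>, so every arrow through (\<mu>, \<nu>) lies in the
  larger set, whatever \<open>F'\<close> is. If p is empty, the set \<open>F\<close> still matters
  and the caller must keep it.\<close>

lemma basic_set_refine:
  assumes g: "(path_append \<mu> z, k, path_append \<nu> z) \<in> basic_set \<alpha> F \<beta>"
    and z: "composable G \<mu> z" "composable G \<nu> z" and k: "k = int (path_length \<mu>) - int (path_length \<nu>)"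
    and len: "path_length \<alpha> \<le> path_length \<mu>"
  obtains p where "\<mu> = (fst \<alpha>, snd \<alpha> @ p)" "\<nu> = (fst \<beta>, snd \<beta> @ p)"
    "p \<noteq> [] \<Longrightarrow> basic_set \<mu> F' \<nu> \<subseteq> basic_set \<alpha> F \<beta>" "path_range G \<alpha> = path_range G \<beta>"
proof -
  obtain w where w: "composable G \<alpha> w" "composable G \<beta> w" "hd_edge w \<notin> Some ` F"
      "path_append \<mu> z = path_append \<alpha> w" "path_append \<nu> z = path_append \<beta> w"
      "k = int (path_length \<alpha>) - int (path_length \<beta>)"
    using g by (auto simp: basic_set_def)
  have rng: "path_range G \<alpha> = path_range G \<beta>"
    using w by (simp add: composable_def)
  obtain p where p: "\<mu> = (fst \<alpha>, snd \<alpha> @ p)" "w = path_append (path_range G \<alpha>, p) z"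
    using path_append_prefix[OF w(1) z(1) w(4)[symmetric] len] .
  have "path_length \<beta> \<le> path_length \<nu>"
    using k w(6) len by linarith
  then obtain q where q: "\<nu> = (fst \<beta>, snd \<beta> @ q)" "w = path_append (path_range G \<beta>, q) z"
    using path_append_prefix[OF w(2) z(2) w(5)[symmetric]] by blast
  have "length p = length q"
    using k w(6) p(1) q(1) by (simp add: path_length_def)
  moreover have "composable G (path_range G \<alpha>, p) z" "composable G (path_range G \<beta>, q) z"
    using z p(1) q(1) composable_append_iff by (metis prod.collapse)+
  ultimately have "q = p"
    using path_append_cancel(1)[of "(path_range G \<alpha>, p)" z "(path_range G \<beta>, q)" z] p(2) q(2)
    by (simp add: path_length_def)
  have "basic_set \<mu> F' \<nu> \<subseteq> basic_set \<alpha> F \<beta>" if "p \<noteq> []"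
  proof
    fix h assume "h \<in> basic_set \<mu> F' \<nu>"
    then obtain z' where z': "composable G \<mu> z'" "composable G \<nu> z'"
        "h = (path_append \<mu> z', int (path_length \<mu>) - int (path_length \<nu>), path_append \<nu> z')"
      by (auto simp: basic_set_def)
    let ?w = "path_append (path_range G \<alpha>, p) z'"
    have "composable G \<alpha> ?w" "composable G \<beta> ?w"
      using z'(1,2) composable_path_append[of "fst \<alpha>" "snd \<alpha>" p z'] composable_path_append[of "fst \<beta>" "snd \<beta>" p z']
        p(1) q(1) \<open>q = p\<close> rng by simp_all
    moreover have "hd_edge ?w \<notin> Some ` F"
      using w(3) that p(2) by (simp add: hd_edge_append)
    moreover have "h = (path_append \<alpha> ?w, int (path_length \<alpha>) - int (path_length \<beta>), path_append \<beta> ?w)"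
      using z'(3) p(1) q(1) \<open>q = p\<close> path_append_append[of "fst \<alpha>" "snd \<alpha>" p z' "path_range G \<alpha>"]
        path_append_append[of "fst \<beta>" "snd \<beta>" p z' "path_range G \<alpha>"]
      by (simp add: path_length_def)
    ultimately show "h \<in> basic_set \<alpha> F \<beta>"
      unfolding basic_set_def by blast
  qed
  with p q \<open>q = p\<close> rng show ?thesis
    using that by blast
qed

text \<open>Induction over the generation of the topology. A generator whose paths are proper
  prefixes of \<mu> and \<nu> contains the whole of Z(\<mu>, {}, \<nu>); a generator at \<mu> and
  \<nu> themselves contributes its own excluded edges. Intersections unite the finite sets of
  excluded edges.\<close>

lemma open_nbhd_finite_path:
  assumes "openin (bpg_topology G) U" and r: "path_range G \<mu> = path_range G \<nu>"
    and \<mu>: "FinPath \<mu> \<in> boundary_paths G" and \<nu>: "FinPath \<nu> \<in> boundary_paths G"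
    and "(FinPath \<mu>, int (path_length \<mu>) - int (path_length \<nu>), FinPath \<nu>) \<in> U"
  shows "\<exists>F. finite F \<and> F \<subseteq> out_arcs G (path_range G \<mu>) \<and> basic_set \<mu> F \<nu> \<subseteq> U"
  using openin_topology_generated_by[OF assms(1)[unfolded bpg_topology_conv]] assms(5)
proof (induction U)
  case (Int U V)
  then obtain F F' where "finite F" "F \<subseteq> out_arcs G (path_range G \<mu>)" "basic_set \<mu> F \<nu> \<subseteq> U"
      "finite F'" "F' \<subseteq> out_arcs G (path_range G \<mu>)" "basic_set \<mu> F' \<nu> \<subseteq> V"
    by blast
  moreover have "basic_set \<mu> (F \<union> F') \<nu> \<subseteq> basic_set \<mu> F \<nu> \<inter> basic_set \<mu> F' \<nu>"
    by (auto simp: basic_set_def)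
  ultimately show ?case
    by (intro exI[of _ "F \<union> F'"]) auto
next
  case (UN K)
  then obtain k where k: "k \<in> K" and mem: "(FinPath \<mu>, int (path_length \<mu>) - int (path_length \<nu>), FinPath \<nu>) \<in> k"
    by (elim UnionE)
  show ?case
    using UN.IH[OF k mem] Union_upper[OF k] by (meson subset_trans)
next
  case (Basis S)
  then obtain \<alpha> F \<beta> where S: "S = basic_set \<alpha> F \<beta>" "basic_index \<alpha> F \<beta>"
    by blast
  let ?z = "FinPath (path_range G \<mu>, [])"
  have \<mu>z: "path_append \<mu> ?z = FinPath \<mu>" and \<nu>z: "path_append \<nu> ?z = FinPath \<nu>"
    by simp_all
  have comp: "composable G \<mu> ?z" "composable G \<nu> ?z"
    using \<mu> \<nu> r by (auto simp: composable_def FinPath_boundary_iff finite_paths_iff awalk_Nil_iff)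
  have mem: "(path_append \<mu> ?z, int (path_length \<mu>) - int (path_length \<nu>), path_append \<nu> ?z) \<in> basic_set \<alpha> F \<beta>"
    using Basis S by simp
  then obtain w where "path_append \<alpha> w = FinPath \<mu>"
    by (auto simp: basic_set_def)
  then have len: "path_length \<alpha> \<le> path_length \<mu>"
    by (cases w) (auto simp: path_length_def)
  from basic_set_refine[OF mem comp refl len, of "{}"] obtain p where
    p: "\<mu> = (fst \<alpha>, snd \<alpha> @ p)" "\<nu> = (fst \<beta>, snd \<beta> @ p)" "p \<noteq> [] \<Longrightarrow> basic_set \<mu> {} \<nu> \<subseteq> basic_set \<alpha> F \<beta>"
    by metis
  show ?case
  proof (cases "p = []")
    case True
    then show ?thesis
      using p S by (auto simp: basic_index_def)
  next
    case False
    then show ?thesis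
      using p(3) S by blast
  qed
qed simp

lemma open_nbhd_infinite_path:
  assumes "openin (bpg_topology G) U" and \<mu>: "composable G \<mu> (InfPath \<xi>)" and \<nu>: "composable G \<nu> (InfPath \<xi>)"
    and "(path_append \<mu> (InfPath \<xi>), int (path_length \<mu>) - int (path_length \<nu>), path_append \<nu> (InfPath \<xi>)) \<in> U"
  shows "\<exists>N. \<forall>n\<ge>N. basic_set (fst \<mu>, snd \<mu> @ stake n \<xi>) {} (fst \<nu>, snd \<nu> @ stake n \<xi>) \<subseteq> U"
  using openin_topology_generated_by[OF assms(1)[unfolded bpg_topology_conv]] assms(4)
proof (induction U)
  case (Int U V)
  then obtain M N where
    "\<forall>n\<ge>M. basic_set (fst \<mu>, snd \<mu> @ stake n \<xi>) {} (fst \<nu>, snd \<nu> @ stake n \<xi>) \<subseteq> U"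
    "\<forall>n\<ge>N. basic_set (fst \<mu>, snd \<mu> @ stake n \<xi>) {} (fst \<nu>, snd \<nu> @ stake n \<xi>) \<subseteq> V"
    by blast
  then show ?case
    by (intro exI[of _ "max M N"]) simp
next
  case (UN K)
  then obtain k where k: "k \<in> K" and mem: "(path_append \<mu> (InfPath \<xi>), int (path_length \<mu>) - int (path_length \<nu>),
      path_append \<nu> (InfPath \<xi>)) \<in> k"
    by (elim UnionE)
  show ?case
    using UN.IH[OF k mem] Union_upper[OF k] by (meson subset_trans)
next
  case (Basis S)
  then obtain \<alpha> F \<beta> where S: "S = basic_set \<alpha> F \<beta>"
    by blast
  \<comment> \<open>Going at least one edge beyond the length of \<alpha> makes the extension of
    \<alpha> nonempty, so that \<open>basic_set_refine\<close> absorbs the set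
    \<open>F\<close>.\<close>
  have "basic_set (fst \<mu>, snd \<mu> @ stake n \<xi>) {} (fst \<nu>, snd \<nu> @ stake n \<xi>) \<subseteq> S"
    if n: "n \<ge> Suc (path_length \<alpha>)" for n
  proof -
    let ?\<mu> = "(fst \<mu>, snd \<mu> @ stake n \<xi>)" and ?\<nu> = "(fst \<nu>, snd \<nu> @ stake n \<xi>)" and ?z = "InfPath (sdrop n \<xi>)"
    have \<xi>: "\<xi> \<in> infinite_paths G" "tail G (shd \<xi>) = path_range G \<mu>" "path_range G \<mu> = path_range G \<nu>"
      using \<mu> \<nu> by (auto simp: composable_def InfPath_boundary_iff)
    have "composable G (path_range G \<mu>, stake n \<xi>) ?z"
      using infinite_paths_sdrop[OF \<xi>(1), of n] \<xi>(2)
      by (auto simp: composable_def InfPath_boundary_iff finite_paths_iff path_range_awalk)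
    then have comp: "composable G ?\<mu> ?z" "composable G ?\<nu> ?z"
      using \<mu> \<nu> \<xi>(3) by (simp_all add: composable_append_iff) (simp_all add: composable_def)
    have app: "path_append ?\<mu> ?z = path_append \<mu> (InfPath \<xi>)" "path_append ?\<nu> ?z = path_append \<nu> (InfPath \<xi>)"
      by (simp_all add: stake_sdrop)
    have mem: "(path_append ?\<mu> ?z, int (path_length \<mu>) - int (path_length \<nu>), path_append ?\<nu> ?z) \<in> basic_set \<alpha> F \<beta>"
      using Basis S app by simp
    have "int (path_length \<mu>) - int (path_length \<nu>) = int (path_length ?\<mu>) - int (path_length ?\<nu>)"
        "path_length \<alpha> \<le> path_length ?\<mu>"
      using n by (simp_all add: path_length_def)
    from basic_set_refine[OF mem comp this, of "{}"] obtain p where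
      p: "?\<mu> = (fst \<alpha>, snd \<alpha> @ p)" "p \<noteq> [] \<Longrightarrow> basic_set ?\<mu> {} ?\<nu> \<subseteq> basic_set \<alpha> F \<beta>"
      by metis
    have "length (snd \<mu>) + n = length (snd \<alpha>) + length p"
      using arg_cong[OF p(1), of "\<lambda>\<mu>. length (snd \<mu>)"] by simp
    with n have "p \<noteq> []"
      by (auto simp: path_length_def)
    with p S show ?thesis
      by blast
  qed
  then show ?case
    by blast
qed simp

lemma basic_index_snoc:
  assumes "basic_index \<mu> F \<nu>" "e \<in> out_arcs G (path_range G \<mu>)"
  shows "basic_index (fst \<mu>, snd \<mu> @ [e]) {} (fst \<nu>, snd \<nu> @ [e])"
proof -
  have "(path_range G \<mu>, [e]) \<in> finite_paths G"
    using assms(2) by (auto simp: finite_paths_iff path_range_def awalk_simps)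
  then show ?thesis
    using assms path_range_append[of "fst \<mu>" "snd \<mu>" "[e]"] path_range_append[of "fst \<nu>" "snd \<nu>" "[e]"]
    by (simp add: basic_index_def finite_paths_append_iff)
qed

lemma basic_set_snoc:
  assumes "basic_index \<mu> F \<nu>" "composable G \<mu> z" "composable G \<nu> z" "hd_edge z = Some e"
  shows "e \<in> out_arcs G (path_range G \<mu>)"
    and "(path_append \<mu> z, int (path_length \<mu>) - int (path_length \<nu>), path_append \<nu> z)
      \<in> basic_set (fst \<mu>, snd \<mu> @ [e]) {} (fst \<nu>, snd \<nu> @ [e])"
proof -
  have z: "z \<in> boundary_paths G" "gpath_source G z = path_range G \<mu>" "path_range G \<nu> = path_range G \<mu>"
    using assms by (auto simp: composable_def)
  obtain w where w: "composable G (path_range G \<mu>, [e]) w" "z = path_append (path_range G \<mu>, [e]) w"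
      "e \<in> out_arcs G (path_range G \<mu>)"
    using hd_edge_SomeE[OF z(1) assms(4)] unfolding z(2) by blast
  have "composable G (fst \<mu>, snd \<mu> @ [e]) w" "composable G (fst \<nu>, snd \<nu> @ [e]) w"
    using w(1) assms(1) z(3) by (simp_all add: composable_append_iff basic_index_def)
  then show "(path_append \<mu> z, int (path_length \<mu>) - int (path_length \<nu>), path_append \<nu> z)
      \<in> basic_set (fst \<mu>, snd \<mu> @ [e]) {} (fst \<nu>, snd \<nu> @ [e])"
    using w(2) path_append_append[of "fst \<mu>" "snd \<mu>" "[e]" w "path_range G \<mu>"]
      path_append_append[of "fst \<nu>" "snd \<nu>" "[e]" w "path_range G \<mu>"]
    unfolding basic_set_def by (intro CollectI exI[of _ w]) (simp add: path_length_def)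
  show "e \<in> out_arcs G (path_range G \<mu>)"
    by (rule w(3))
qed

text \<open>At a regular vertex no boundary path stops, so the finitely many one-edge extensions
  exhaust the set. At a singular vertex the arrow with empty tail belongs to the set; a member of
  the cover containing it also contains all tails except those starting with one of finitely many
  edges.\<close>

lemma basic_set_cover_step:
  assumes idx: "basic_index \<mu> F \<nu>" and \<U>: "\<And>U. U \<in> \<U> \<Longrightarrow> openin (bpg_topology G) U"
    and sub: "basic_set \<mu> F \<nu> \<subseteq> \<Union>\<U>"
  obtains A \<V> where "finite A" "A \<subseteq> out_arcs G (path_range G \<mu>) - F" "finite \<V>" "\<V> \<subseteq> \<U>"
    "basic_set \<mu> F \<nu> \<subseteq> \<Union>\<V> \<union> (\<Union>e\<in>A. basic_set (fst \<mu>, snd \<mu> @ [e]) {} (fst \<nu>, snd \<nu> @ [e]))"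
proof -
  let ?x = "path_range G \<mu>"
  have elem: "h \<in> basic_set \<mu> F \<nu> \<Longrightarrow> \<exists>z. composable G \<mu> z \<and> composable G \<nu> z \<and> hd_edge z \<notin> Some ` F \<and>
      h = (path_append \<mu> z, int (path_length \<mu>) - int (path_length \<nu>), path_append \<nu> z)" for h
    by (auto simp: basic_set_def)
  show ?thesis
  proof (cases "regular_vertex G ?x")
    case True
    have "basic_set \<mu> F \<nu> \<subseteq> (\<Union>e\<in>out_arcs G ?x - F. basic_set (fst \<mu>, snd \<mu> @ [e]) {} (fst \<nu>, snd \<nu> @ [e]))"
    proof
      fix h assume "h \<in> basic_set \<mu> F \<nu>"
      then obtain z where z: "composable G \<mu> z" "composable G \<nu> z" "hd_edge z \<notin> Some ` F"
          "h = (path_append \<mu> z, int (path_length \<mu>) - int (path_length \<nu>), path_append \<nu> z)"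
        using elem by blast
      have "hd_edge z \<noteq> None"
      proof
        assume "hd_edge z = None"
        then have "z = FinPath (?x, [])"
          using z(1) by (cases z) (auto simp: composable_def prod_eq_iff split: list.splits)
        then show False
          using z(1) True by (simp add: composable_def FinPath_boundary_iff singular_verts_def)
      qed
      then obtain e where "hd_edge z = Some e"
        by blast
      with basic_set_snoc[OF idx z(1,2) this] z(3,4)
      show "h \<in> (\<Union>e\<in>out_arcs G ?x - F. basic_set (fst \<mu>, snd \<mu> @ [e]) {} (fst \<nu>, snd \<nu> @ [e]))"
        by blast
    qed
    then show ?thesis
      using True that[of "out_arcs G ?x - F" "{}"] by (auto simp: regular_vertex_def)
  next
    case False
    then have x: "?x \<in> singular_verts G" "path_range G \<nu> = ?x" "?x \<in> verts G"
      using idx path_range_finite_paths by (auto simp: basic_index_def singular_verts_def)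
    let ?z = "FinPath (?x, [])"
    have comp: "composable G \<mu> ?z" "composable G \<nu> ?z"
      using idx x by (auto simp: basic_index_def composable_def FinPath_boundary_iff finite_paths_iff awalk_Nil_iff)
    then have "(path_append \<mu> ?z, int (path_length \<mu>) - int (path_length \<nu>), path_append \<nu> ?z) \<in> basic_set \<mu> F \<nu>"
      unfolding basic_set_def by fastforce
    then obtain U where U: "U \<in> \<U>" "(FinPath \<mu>, int (path_length \<mu>) - int (path_length \<nu>), FinPath \<nu>) \<in> U"
      using sub by auto
    have "FinPath \<mu> \<in> boundary_paths G" "FinPath \<nu> \<in> boundary_paths G"
      using composable_append(1)[OF comp(1)] composable_append(1)[OF comp(2)] by simp_all
    then obtain F' where F': "finite F'" "F' \<subseteq> out_arcs G ?x" "basic_set \<mu> F' \<nu> \<subseteq> U"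
      using open_nbhd_finite_path[OF \<U>[OF U(1)] x(2)[symmetric] _ _ U(2)] by blast
    have "basic_set \<mu> F \<nu> \<subseteq> \<Union>{U} \<union> (\<Union>e\<in>F' - F. basic_set (fst \<mu>, snd \<mu> @ [e]) {} (fst \<nu>, snd \<nu> @ [e]))"
    proof
      fix h assume "h \<in> basic_set \<mu> F \<nu>"
      then obtain z where z: "composable G \<mu> z" "composable G \<nu> z" "hd_edge z \<notin> Some ` F"
          "h = (path_append \<mu> z, int (path_length \<mu>) - int (path_length \<nu>), path_append \<nu> z)"
        using elem by blast
      show "h \<in> \<Union>{U} \<union> (\<Union>e\<in>F' - F. basic_set (fst \<mu>, snd \<mu> @ [e]) {} (fst \<nu>, snd \<nu> @ [e]))"
      proof (cases "hd_edge z \<in> Some ` F'")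
        case True
        then obtain e where e: "hd_edge z = Some e" "e \<in> F'"
          by blast
        with basic_set_snoc(2)[OF idx z(1,2) e(1)] z(3,4) show ?thesis
          by auto
      next
        case False
        then have "h \<in> basic_set \<mu> F' \<nu>"
          using z by (auto simp: basic_set_def)
        with F'(3) show ?thesis
          by blast
      qed
    qed
    then show ?thesis
      using F' U(1) by (intro that[of "F' - F" "{U}"]) auto
  qed
qed

text \<open>
  Koenig's argument: a basic set without finite subcover contains one that extends both paths by
  a common edge; iterating yields an infinite path, one neighbourhood of which is a member of the cover.
\<close>

lemma compactin_basic_set:
  assumes idx: "basic_index \<mu> F \<nu>"
  shows "compactin (bpg_topology G) (basic_set \<mu> F \<nu>)"
  unfolding compactin_def
proof (intro conjI allI impI; (elim conjE)?)
  show "basic_set \<mu> F \<nu> \<subseteq> topspace (bpg_topology G)"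
    using basic_set_arrows topspace_bpg by simp
next
  fix \<U> assume \<U>: "Ball \<U> (openin (bpg_topology G))" and sub: "basic_set \<mu> F \<nu> \<subseteq> \<Union>\<U>"
  define covered where "covered S \<longleftrightarrow> (\<exists>\<V>. finite \<V> \<and> \<V> \<subseteq> \<U> \<and> S \<subseteq> \<Union>\<V>)" for S
  define B where "B p = basic_set (fst \<mu>, snd \<mu> @ p) {} (fst \<nu>, snd \<nu> @ p)" for p
  have covered_UN: "covered (\<Union>\<V> \<union> (\<Union>e\<in>A. S e))"
    if fin: "finite A" "finite \<V>" "\<V> \<subseteq> \<U>" "\<And>e. e \<in> A \<Longrightarrow> covered (S e)" for A :: "'b set" and S \<V>
  proof -
    obtain W where W: "\<And>e. e \<in> A \<Longrightarrow> finite (W e) \<and> W e \<subseteq> \<U> \<and> S e \<subseteq> \<Union>(W e)"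
      using fin(4) unfolding covered_def by metis
    show ?thesis
      unfolding covered_def
    proof (intro exI conjI)
      show "finite (\<V> \<union> (\<Union>e\<in>A. W e))"
        using W fin by blast
      show "\<V> \<union> (\<Union>e\<in>A. W e) \<subseteq> \<U>"
        using W fin by blast
      show "\<Union>\<V> \<union> (\<Union>e\<in>A. S e) \<subseteq> \<Union>(\<V> \<union> (\<Union>e\<in>A. W e))"
      proof (intro Un_least UN_least)
        show "S e \<subseteq> \<Union>(\<V> \<union> (\<Union>e\<in>A. W e))" if "e \<in> A" for e
        proof -
          have "S e \<subseteq> \<Union>(W e)"
            using W[OF that] by blast
          also have "\<dots> \<subseteq> \<Union>(\<V> \<union> (\<Union>e\<in>A. W e))"
            using that by (intro Union_mono) blast
          finally show ?thesis .
        qed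
      qed blast
    qed
  qed
  have covered_mono: "covered S" if "S \<subseteq> T" "covered T" for S T
    using that unfolding covered_def by (meson subset_trans)
  have step: "\<exists>e. e \<in> out_arcs G (path_range G \<alpha>) - F' \<and> \<not> covered (basic_set (fst \<alpha>, snd \<alpha> @ [e]) {} (fst \<beta>, snd \<beta> @ [e]))"
    if \<alpha>: "basic_index \<alpha> F' \<beta>" "basic_set \<alpha> F' \<beta> \<subseteq> \<Union>\<U>" "\<not> covered (basic_set \<alpha> F' \<beta>)" for \<alpha> F' \<beta>
  proof (rule ccontr)
    assume neg: "\<not> ?thesis"
    obtain A \<V> where A: "finite A" "A \<subseteq> out_arcs G (path_range G \<alpha>) - F'" "finite \<V>" "\<V> \<subseteq> \<U>"
        "basic_set \<alpha> F' \<beta> \<subseteq> \<Union>\<V> \<union> (\<Union>e\<in>A. basic_set (fst \<alpha>, snd \<alpha> @ [e]) {} (fst \<beta>, snd \<beta> @ [e]))"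
      using basic_set_cover_step[OF \<alpha>(1) _ \<alpha>(2)] \<U> by blast
    have "covered (\<Union>\<V> \<union> (\<Union>e\<in>A. basic_set (fst \<alpha>, snd \<alpha> @ [e]) {} (fst \<beta>, snd \<beta> @ [e])))"
      using neg A(2) by (intro covered_UN A) blast
    with covered_mono[OF A(5)] \<alpha>(3) show False
      by blast
  qed
  have "covered (basic_set \<mu> F \<nu>)"
  proof (rule ccontr)
    assume bad: "\<not> covered (basic_set \<mu> F \<nu>)"
    have B_sub: "B p \<subseteq> basic_set \<mu> F \<nu>" if p: "p \<noteq> []" "hd p \<notin> F" for p
    proof
      fix h assume "h \<in> B p"
      then obtain z where z: "composable G (fst \<mu>, snd \<mu> @ p) z" "composable G (fst \<nu>, snd \<nu> @ p) z"
          "h = (path_append (fst \<mu>, snd \<mu> @ p) z, int (path_length \<mu>) - int (path_length \<nu>), path_append (fst \<nu>, snd \<nu> @ p) z)"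
        by (auto simp: B_def basic_set_def path_length_def)
      let ?w = "path_append (path_range G \<mu>, p) z"
      have "composable G \<mu> ?w" "composable G \<nu> ?w"
        using composable_path_append[OF z(1)] composable_path_append[OF z(2)] idx by (simp_all add: basic_index_def)
      moreover have "hd_edge ?w \<notin> Some ` F"
        using p by (auto simp: hd_edge_append)
      moreover have "h = (path_append \<mu> ?w, int (path_length \<mu>) - int (path_length \<nu>), path_append \<nu> ?w)"
        using z(3) path_append_append[of "fst \<mu>" "snd \<mu>" p z "path_range G \<mu>"]
          path_append_append[of "fst \<nu>" "snd \<nu>" p z "path_range G \<mu>"] by simp
      ultimately show "h \<in> basic_set \<mu> F \<nu>"
        unfolding basic_set_def by blast
    qed
    \<comment> \<open>Requiring the first edge to avoid \<open>F\<close> keeps \<open>B p\<close>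
      inside the original basic set, hence inside the union of the cover, so \<open>step\<close> can
      be applied again. After the first edge no further exclusions are carried along.\<close>
    define good where "good p \<longleftrightarrow> p \<noteq> [] \<and> hd p \<notin> F \<and>
      basic_index (fst \<mu>, snd \<mu> @ p) {} (fst \<nu>, snd \<nu> @ p) \<and> \<not> covered (B p)" for p
    obtain e where e: "e \<in> out_arcs G (path_range G \<mu>) - F" "\<not> covered (B [e])"
      using step[OF idx sub bad] unfolding B_def by blast
    have good_e: "good [e]"
      using e basic_index_snoc[OF idx, of e] by (simp add: good_def)
    have "\<exists>f. good (p @ [f])" if "good p" for p
    proof -
      have "basic_index (fst \<mu>, snd \<mu> @ p) {} (fst \<nu>, snd \<nu> @ p)" "B p \<subseteq> \<Union>\<U>" "\<not> covered (B p)"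
        using that B_sub[of p] sub by (auto simp: good_def)
      from step[OF this[unfolded B_def]] obtain f where f: "f \<in> out_arcs G (path_range G (fst \<mu>, snd \<mu> @ p))" "\<not> covered (B (p @ [f]))"
        by (auto simp: B_def)
      then have "good (p @ [f])"
        using that basic_index_snoc[of "(fst \<mu>, snd \<mu> @ p)" "{}" "(fst \<nu>, snd \<nu> @ p)" f] by (simp add: good_def)
      then show ?thesis
        by blast
    qed
    then obtain nxt where nxt: "\<And>p. good p \<Longrightarrow> good (p @ [nxt p])"
      by metis
    define L where "L = rec_nat [e] (\<lambda>_ p. p @ [nxt p])"
    have L: "L 0 = [e]" "\<And>n. L (Suc n) = L n @ [nxt (L n)]"
      by (simp_all add: L_def)
    have good_L: "good (L n)" for n
      by (induction n) (simp_all add: L good_e nxt)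
    define \<xi> where "\<xi> = smap (\<lambda>n. last (L n)) nats"
    \<comment> \<open>The sequence \<open>L\<close> starts with a list of one edge, whence the shift
      by one.\<close>
    have stake: "stake (Suc n) \<xi> = L n" for n
    proof (induction n)
      case (Suc n)
      have "stake (Suc (Suc n)) \<xi> = stake (Suc n) \<xi> @ [\<xi> !! Suc n]"
        by (rule stake_Suc)
      with Suc show ?case
        by (simp add: \<xi>_def L)
    qed (simp add: \<xi>_def L)
    have walk: "(path_range G \<mu>, stake (Suc n) \<xi>) \<in> finite_paths G" for n
    proof -
      have "(fst \<mu>, snd \<mu> @ L n) \<in> finite_paths G"
        using good_L[of n] by (simp add: good_def basic_index_def)
      then show ?thesis
        unfolding stake by (simp add: finite_paths_append_iff)
    qed
    have \<xi>: "\<xi> \<in> infinite_paths G"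
      unfolding infinite_paths_def
    proof (intro CollectI allI)
      fix i
      let ?p = "stake (Suc (Suc i)) \<xi>"
      have aw: "awalk (path_range G \<mu>) ?p (path_range G (path_range G \<mu>, ?p))"
        using walk[of "Suc i"] by (simp only: finite_paths_iff fst_conv snd_conv)
      have "\<xi> !! i = ?p ! i" "\<xi> !! Suc i = ?p ! Suc i"
        by (rule stake_nth[symmetric], simp)+
      moreover have "head G (?p ! i) = tail G (?p ! Suc i)"
        by (rule awalk_nth_Suc[OF aw]) simp
      moreover have "?p ! i \<in> arcs G"
        using aw nth_mem[of i ?p] by (auto simp: awalk_def simp del: stake.simps)
      ultimately show "\<xi> !! i \<in> arcs G \<and> head G (\<xi> !! i) = tail G (\<xi> !! Suc i)"
        by simp
    qed
    have hd: "shd \<xi> = e"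
      using stake[of 0] by (simp add: L)
    have comp: "composable G \<mu> (InfPath \<xi>)" "composable G \<nu> (InfPath \<xi>)"
      using idx \<xi> e hd by (auto simp: basic_index_def composable_def InfPath_boundary_iff)
    then have "(path_append \<mu> (InfPath \<xi>), int (path_length \<mu>) - int (path_length \<nu>), path_append \<nu> (InfPath \<xi>)) \<in> basic_set \<mu> F \<nu>"
      unfolding basic_set_def using hd e(1) by fastforce
    then obtain U where U: "U \<in> \<U>"
        "(path_append \<mu> (InfPath \<xi>), int (path_length \<mu>) - int (path_length \<nu>), path_append \<nu> (InfPath \<xi>)) \<in> U"
      using sub by blast
    then obtain N where "\<And>n. n \<ge> N \<Longrightarrow> B (stake n \<xi>) \<subseteq> U"
      using open_nbhd_infinite_path[OF _ comp U(2)] \<U> unfolding B_def by blast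
    then have "B (L N) \<subseteq> \<Union>{U}"
      using stake[of N] by (metis cSup_singleton le_SucI order_refl)
    then have "covered (B (L N))"
      unfolding covered_def using U(1) by blast
    with good_L[of N] show False
      by (simp add: good_def)
  qed
  then show "\<exists>\<F>. finite \<F> \<and> \<F> \<subseteq> \<U> \<and> basic_set \<mu> F \<nu> \<subseteq> \<Union>\<F>"
    by (simp add: covered_def)
qed

section \<open>Acyclic graphs have approximately quasi-compact groupoids\<close>

text \<open>Excluding the edges of \<open>F\<close> after \<mu> and \<nu> makes these the maximal
  initial segments inside the subgraph. The intersection with \<open>out_arcs\<close> only meets the
  format of \<open>basic_index\<close>: a tail at r(\<mu>) can begin with no other edges.\<close>

definition subgraph_groupoid :: "'a set \<Rightarrow> 'b set \<Rightarrow> ('a, 'b) bpg_arrow set" where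
  "subgraph_groupoid V F = (\<Union>\<mu>\<in>paths_from G V F.
     \<Union>\<nu>\<in>{\<nu> \<in> paths_from G V F. path_range G \<nu> = path_range G \<mu>}.
       basic_set \<mu> (F \<inter> out_arcs G (path_range G \<mu>)) \<nu>)"

lemma subgraph_groupoid_iff:
  "g \<in> subgraph_groupoid V F \<longleftrightarrow> (\<exists>\<mu> \<nu> z. \<mu> \<in> paths_from G V F \<and> \<nu> \<in> paths_from G V F \<and>
     composable G \<mu> z \<and> composable G \<nu> z \<and> hd_edge z \<notin> Some ` F \<and>
     g = (path_append \<mu> z, int (path_length \<mu>) - int (path_length \<nu>), path_append \<nu> z))"
    (is "_ \<longleftrightarrow> ?R")
proof -
  have hd: "hd_edge z \<in> Some ` (F \<inter> out_arcs G (path_range G \<mu>)) \<longleftrightarrow> hd_edge z \<in> Some ` F"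
    if "composable G \<mu> z" for \<mu> z
    using that hd_edge_SomeE[of z] unfolding composable_def by (metis (no_types, lifting) IntI Int_iff image_iff)
  have rng: "path_range G \<nu> = path_range G \<mu>" if "composable G \<mu> z" "composable G \<nu> z" for \<mu> \<nu> z
    using that by (simp add: composable_def)
  show ?thesis
  proof
    assume "g \<in> subgraph_groupoid V F"
    then show ?R
      unfolding subgraph_groupoid_def basic_set_def using hd by blast
  next
    assume ?R
    then obtain \<mu> \<nu> z where g: "\<mu> \<in> paths_from G V F" "\<nu> \<in> paths_from G V F"
        "composable G \<mu> z" "composable G \<nu> z" "hd_edge z \<notin> Some ` F"
        "g = (path_append \<mu> z, int (path_length \<mu>) - int (path_length \<nu>), path_append \<nu> z)"
      by blast
    then have "g \<in> basic_set \<mu> (F \<inter> out_arcs G (path_range G \<mu>)) \<nu>"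
      unfolding basic_set_def using hd[OF g(3)] by blast
    then show "g \<in> subgraph_groupoid V F"
      unfolding subgraph_groupoid_def using g(1,2) rng[OF g(3,4)] by (intro UN_I[of \<mu>] UN_I[of \<nu>]) auto
  qed
qed

lemma
  assumes ac: "acyclic_digraph G" and "finite V" "finite F"
  shows openin_subgraph_groupoid: "openin (bpg_topology G) (subgraph_groupoid V F)"
    and compactin_subgraph_groupoid: "compactin (bpg_topology G) (subgraph_groupoid V F)"
proof -
  have fin: "finite (paths_from G V F)"
    by (rule finite_paths_from[OF assms])
  have idx: "basic_index \<mu> (F \<inter> out_arcs G (path_range G \<mu>)) \<nu>"
    if "\<mu> \<in> paths_from G V F" "\<nu> \<in> {\<nu> \<in> paths_from G V F. path_range G \<nu> = path_range G \<mu>}" for \<mu> \<nu>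
    unfolding basic_index_def finite_paths_iff
    using that assms(3) paths_fromD[of \<mu> V F] paths_fromD[of \<nu> V F] by simp
  have "openin (bpg_topology G) (\<Union>\<nu>\<in>{\<nu> \<in> paths_from G V F. path_range G \<nu> = path_range G \<mu>}.
      basic_set \<mu> (F \<inter> out_arcs G (path_range G \<mu>)) \<nu>)" if "\<mu> \<in> paths_from G V F" for \<mu>
    using openin_basic_set[OF idx[OF that]] by (intro openin_Union) blast
  then show "openin (bpg_topology G) (subgraph_groupoid V F)"
    unfolding subgraph_groupoid_def by (intro openin_Union) blast
  have "compactin (bpg_topology G) (\<Union>\<nu>\<in>{\<nu> \<in> paths_from G V F. path_range G \<nu> = path_range G \<mu>}.
      basic_set \<mu> (F \<inter> out_arcs G (path_range G \<mu>)) \<nu>)" if "\<mu> \<in> paths_from G V F" for \<mu>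
    using compactin_basic_set[OF idx[OF that]] fin by (intro compactin_Union finite_imageI) auto
  then show "compactin (bpg_topology G) (subgraph_groupoid V F)"
    unfolding subgraph_groupoid_def using fin by (intro compactin_Union finite_imageI) auto
qed

text \<open>A longer prefix would extend the shorter one by a nonempty path in \<open>F\<close>,
  whose first edge would be the forbidden first edge of the tail. For composable arrows this makes
  the two factorisations of the middle path coincide, so that the product again has the required
  form.\<close>

lemma max_prefix_unique:
  assumes "\<mu> \<in> paths_from G V F" "composable G \<mu> z" "hd_edge z \<notin> Some ` F"
    and "\<nu> \<in> paths_from G V F" "composable G \<nu> w" "hd_edge w \<notin> Some ` F"
    and "path_append \<mu> z = path_append \<nu> w"
  shows "\<mu> = \<nu>" "z = w"
proof -
  have le: "path_length \<nu> \<le> path_length \<mu>"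
    if h: "composable G \<mu> z" "hd_edge z \<notin> Some ` F" "\<nu> \<in> paths_from G V F" "composable G \<nu> w"
      "path_append \<mu> z = path_append \<nu> w" for \<mu> \<nu> z w
  proof (rule ccontr)
    assume less: "\<not> path_length \<nu> \<le> path_length \<mu>"
    then obtain p where p: "\<nu> = (fst \<mu>, snd \<mu> @ p)" "z = path_append (path_range G \<mu>, p) w"
      using path_append_prefix[OF h(1,4,5)] by (metis nle_le)
    then have "p \<noteq> []"
      using less by (auto simp: path_length_def)
    then have "hd_edge z = Some (hd p)"
      using p(2) by (simp add: hd_edge_append)
    moreover have "set p \<subseteq> F"
      using paths_fromD[OF h(3)] p(1) by simp
    then have "hd p \<in> F"
      using \<open>p \<noteq> []\<close> by auto
    ultimately have "hd_edge z \<in> Some ` F"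
      by simp
    with h(2) show False
      by blast
  qed
  have "path_length \<mu> = path_length \<nu>"
    using le[OF assms(2,3,4,5,7)] le[OF assms(5,6,1,2) assms(7)[symmetric]] by simp
  then show "\<mu> = \<nu>" "z = w"
    using path_append_cancel[OF assms(2,5,7)] by blast+
qed

lemma subgroupoid_subgraph_groupoid:
  "subgroupoid (subgraph_groupoid V F) (boundary_path_groupoid G)"
  unfolding subgroupoid_def
proof (intro conjI ballI impI)
  show "subgraph_groupoid V F \<subseteq> garrows (boundary_path_groupoid G)"
    unfolding subgraph_groupoid_def boundary_path_groupoid_simps using basic_set_arrows by blast
next
  fix g assume "g \<in> subgraph_groupoid V F"
  then obtain \<mu> \<nu> z where "\<mu> \<in> paths_from G V F" "\<nu> \<in> paths_from G V F" "composable G \<mu> z" "composable G \<nu> z"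
      "hd_edge z \<notin> Some ` F" "g = (path_append \<mu> z, int (path_length \<mu>) - int (path_length \<nu>), path_append \<nu> z)"
    unfolding subgraph_groupoid_iff by blast
  then show "ginverse (boundary_path_groupoid G) g \<in> subgraph_groupoid V F"
    unfolding subgraph_groupoid_iff by (intro exI[of _ \<nu>] exI[of _ \<mu>] exI[of _ z]) simp
next
  fix g h assume "g \<in> subgraph_groupoid V F" "h \<in> subgraph_groupoid V F"
    and src: "gsource (boundary_path_groupoid G) g = grange (boundary_path_groupoid G) h"
  then obtain \<mu> \<nu> z \<alpha> \<beta> w where
    g: "\<mu> \<in> paths_from G V F" "\<nu> \<in> paths_from G V F" "composable G \<mu> z" "composable G \<nu> z" "hd_edge z \<notin> Some ` F"
      "g = (path_append \<mu> z, int (path_length \<mu>) - int (path_length \<nu>), path_append \<nu> z)" and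
    h: "\<alpha> \<in> paths_from G V F" "\<beta> \<in> paths_from G V F" "composable G \<alpha> w" "composable G \<beta> w" "hd_edge w \<notin> Some ` F"
      "h = (path_append \<alpha> w, int (path_length \<alpha>) - int (path_length \<beta>), path_append \<beta> w)"
    unfolding subgraph_groupoid_iff by blast
  have "path_append \<nu> z = path_append \<alpha> w"
    using src g(6) h(6) by simp
  then have "\<nu> = \<alpha>" "z = w"
    using max_prefix_unique[OF g(2,4,5) h(1,3,5)] by blast+
  then show "gmult (boundary_path_groupoid G) g h \<in> subgraph_groupoid V F"
    unfolding subgraph_groupoid_iff using g h
    by (intro exI[of _ \<mu>] exI[of _ \<beta>] exI[of _ z]) simp
qed

text \<open>Only finitely many paths at the source of z run inside \<open>F\<close>, by acyclicity,
  so among the prefixes of z there is a longest one. If the remaining tail began with an edge of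
  \<open>F\<close>, that edge could be appended to it.\<close>

lemma max_prefix_exists:
  assumes ac: "acyclic_digraph G" and F: "finite F" and z: "z \<in> boundary_paths G"
  obtains p w where "set p \<subseteq> F" "composable G (gpath_source G z, p) w"
    "z = path_append (gpath_source G z, p) w" "hd_edge w \<notin> Some ` F"
proof -
  let ?u = "gpath_source G z"
  define P where "P = {p. set p \<subseteq> F \<and> (\<exists>w. composable G (?u, p) w \<and> z = path_append (?u, p) w)}"
  have "P \<subseteq> paths_within G F ?u"
    by (auto simp: P_def paths_within_def composable_def finite_paths_def)
  then have fin: "finite P"
    using finite_paths_within[OF ac F] finite_subset by blast
  have "[] \<in> P"
    using z gpath_source_boundary[OF z]
    by (auto simp: P_def composable_def path_append_Nil finite_paths_iff awalk_Nil_iff intro!: exI[of _ z])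
  moreover have "\<forall>q. q \<in> P \<longrightarrow> length q < Suc (Max (length ` P))"
    using fin by (simp add: less_Suc_eq_le)
  ultimately have "\<exists>p. p \<in> P \<and> (\<forall>q. q \<in> P \<longrightarrow> length q \<le> length p)"
    by (rule Lattices_Big.ex_has_greatest_nat)
  then obtain p where p: "p \<in> P" "\<And>q. q \<in> P \<Longrightarrow> length q \<le> length p"
    by blast
  then obtain w where w: "set p \<subseteq> F" "composable G (?u, p) w" "z = path_append (?u, p) w"
    by (auto simp: P_def)
  have "hd_edge w \<notin> Some ` F"
  proof
    assume "hd_edge w \<in> Some ` F"
    then obtain f where f: "hd_edge w = Some f" "f \<in> F"
      by blast
    have src: "w \<in> boundary_paths G" "gpath_source G w = path_range G (?u, p)" "(?u, p) \<in> finite_paths G"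
      using w(2) by (auto simp: composable_def)
    obtain w' where w': "composable G (path_range G (?u, p), [f]) w'" "w = path_append (path_range G (?u, p), [f]) w'"
      using hd_edge_SomeE[OF src(1) f(1)] unfolding src(2) by blast
    have "composable G (?u, p @ [f]) w'"
      using w'(1) src(3) by (simp add: composable_append_iff)
    moreover have "z = path_append (?u, p @ [f]) w'"
      using w(3) w'(2) path_append_append[of ?u p "[f]" w'] by metis
    ultimately have "p @ [f] \<in> P"
      using w(1) f(2) by (auto simp: P_def)
    from p(2)[OF this] show False
      by simp
  qed
  with w show ?thesis
    using that by blast
qed

text \<open>The given prefixes need not be maximal. Moving the longest initial part of the tail
  inside \<open>F\<close> over to both of them makes them maximal without changing the
  arrow.\<close>

lemma arrow_in_subgraph_groupoid:
  assumes ac: "acyclic_digraph G" and F: "finite F"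
    and \<mu>: "\<mu> \<in> paths_from G V F" "composable G \<mu> z" and \<nu>: "\<nu> \<in> paths_from G V F" "composable G \<nu> z"
  shows "(path_append \<mu> z, int (path_length \<mu>) - int (path_length \<nu>), path_append \<nu> z) \<in> subgraph_groupoid V F"
proof -
  have z: "z \<in> boundary_paths G" "gpath_source G z = path_range G \<mu>" "path_range G \<nu> = path_range G \<mu>"
    using \<mu> \<nu> by (auto simp: composable_def)
  obtain p w where p: "set p \<subseteq> F" "composable G (path_range G \<mu>, p) w" "z = path_append (path_range G \<mu>, p) w"
      "hd_edge w \<notin> Some ` F"
    using max_prefix_exists[OF ac F z(1)] unfolding z(2) .
  let ?\<mu> = "(fst \<mu>, snd \<mu> @ p)" and ?\<nu> = "(fst \<nu>, snd \<nu> @ p)"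
  have comp: "composable G ?\<mu> w" "composable G ?\<nu> w"
    using p(2) \<mu>(2) \<nu>(2) z(3) unfolding composable_append_iff by (simp_all add: composable_def)
  moreover have "?\<mu> \<in> paths_from G V F" "?\<nu> \<in> paths_from G V F"
    using comp paths_fromD[OF \<mu>(1)] paths_fromD[OF \<nu>(1)] p(1)
    unfolding composable_def finite_paths_def paths_from_def paths_within_def by auto
  moreover have "(path_append \<mu> z, int (path_length \<mu>) - int (path_length \<nu>), path_append \<nu> z)
      = (path_append ?\<mu> w, int (path_length ?\<mu>) - int (path_length ?\<nu>), path_append ?\<nu> w)"
    using p(3) path_append_append[of "fst \<mu>" "snd \<mu>" p w "path_range G \<mu>"]
      path_append_append[of "fst \<nu>" "snd \<nu>" p w "path_range G \<mu>"]
    by (simp add: path_length_def)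
  ultimately show ?thesis
    unfolding subgraph_groupoid_iff using p(4) by blast
qed

lemma approximately_quasi_compact_if_acyclic:
  assumes ac: "acyclic_digraph G"
  shows "approximately_quasi_compact (boundary_path_groupoid G)"
  unfolding approximately_quasi_compact_def
proof (intro exI conjI)
  let ?\<H> = "{subgraph_groupoid V F | V F. finite V \<and> finite F}"
  show "\<forall>H\<in>?\<H>. subgroupoid H (boundary_path_groupoid G) \<and> openin (gtopology (boundary_path_groupoid G)) H \<and>
      compactin (gtopology (boundary_path_groupoid G)) H"
    using subgroupoid_subgraph_groupoid openin_subgraph_groupoid[OF ac] compactin_subgraph_groupoid[OF ac] by auto
  show "?\<H> \<noteq> {}"
    by blast
  \<comment> \<open>Not immediate from the definition: a larger edge set admits more prefixes but
    also forbids more tails. Each arrow has to be factored anew with longer prefixes.\<close>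
  have mono: "subgraph_groupoid V F \<subseteq> subgraph_groupoid V' F'"
    if "V \<subseteq> V'" "F \<subseteq> F'" "finite F'" for V F V' F'
  proof
    fix g assume "g \<in> subgraph_groupoid V F"
    then obtain \<mu> \<nu> z where g: "\<mu> \<in> paths_from G V F" "\<nu> \<in> paths_from G V F" "composable G \<mu> z" "composable G \<nu> z"
        "g = (path_append \<mu> z, int (path_length \<mu>) - int (path_length \<nu>), path_append \<nu> z)"
      unfolding subgraph_groupoid_iff by blast
    have "paths_from G V F \<subseteq> paths_from G V' F'"
      using that unfolding paths_from_def paths_within_def by blast
    with g show "g \<in> subgraph_groupoid V' F'"
      using arrow_in_subgraph_groupoid[OF ac that(3)] by blast
  qed
  show "\<forall>A\<in>?\<H>. \<forall>B\<in>?\<H>. \<exists>C\<in>?\<H>. A \<subseteq> C \<and> B \<subseteq> C"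
  proof (intro ballI)
    fix A B assume "A \<in> ?\<H>" "B \<in> ?\<H>"
    then obtain V F V' F' where "A = subgraph_groupoid V F" "finite V" "finite F"
        "B = subgraph_groupoid V' F'" "finite V'" "finite F'"
      by blast
    moreover from this have "A \<subseteq> subgraph_groupoid (V \<union> V') (F \<union> F')" "B \<subseteq> subgraph_groupoid (V \<union> V') (F \<union> F')"
      using mono[of V "V \<union> V'" F "F \<union> F'"] mono[of V' "V \<union> V'" F' "F \<union> F'"] by simp_all
    moreover from calculation have "subgraph_groupoid (V \<union> V') (F \<union> F') \<in> ?\<H>"
      by blast
    ultimately show "\<exists>C\<in>?\<H>. A \<subseteq> C \<and> B \<subseteq> C"
      by blast
  qed
  show "\<Union>?\<H> = garrows (boundary_path_groupoid G)"
  proof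
    show "\<Union>?\<H> \<subseteq> garrows (boundary_path_groupoid G)"
      using subgroupoid_subgraph_groupoid unfolding subgroupoid_def by blast
    show "garrows (boundary_path_groupoid G) \<subseteq> \<Union>?\<H>"
    proof
      fix g assume "g \<in> garrows (boundary_path_groupoid G)"
      then obtain \<mu> \<nu> z where g: "composable G \<mu> z" "composable G \<nu> z"
          "g = (path_append \<mu> z, int (path_length \<mu>) - int (path_length \<nu>), path_append \<nu> z)"
        unfolding boundary_path_groupoid_simps by (rule bpg_arrowE)
      let ?V = "{fst \<mu>, fst \<nu>}" and ?F = "set (snd \<mu>) \<union> set (snd \<nu>)"
      have "\<mu> \<in> paths_from G ?V ?F" "\<nu> \<in> paths_from G ?V ?F"
        using g(1,2) by (auto simp: composable_def finite_paths_def paths_from_def paths_within_def)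
      then have "g \<in> subgraph_groupoid ?V ?F"
        using arrow_in_subgraph_groupoid[OF ac, of ?F] g by simp
      moreover have "subgraph_groupoid ?V ?F \<in> ?\<H>"
        by (rule CollectI, rule exI[of _ ?V], rule exI[of _ ?F]) simp
      ultimately show "g \<in> \<Union>?\<H>"
        by (rule UnionI[rotated])
    qed
  qed
qed

end

theorem theorem5p2:
  fixes E :: "('v, 'e) pre_digraph"
  assumes "wf_digraph E" and "verts E \<noteq> {}"
    and "von_neumann_regular (UNIV :: 'k::comm_ring_1 set) (*)"
  shows "(von_neumann_regular (carrier (leavitt_path_algebra TYPE('k) E))
             (mult (leavitt_path_algebra TYPE('k) E))
           \<longleftrightarrow> acyclic_digraph E) \<and>
         (acyclic_digraph E \<longleftrightarrow> principal_groupoid (boundary_path_groupoid E)) \<and>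
         (principal_groupoid (boundary_path_groupoid E)
           \<longleftrightarrow> approximately_quasi_compact (boundary_path_groupoid E))"
proof -
  interpret wf_digraph E
    by (rule assms(1))
  show ?thesis
    using von_neumann_regular_lpa_if_acyclic[OF _ assms(3)] acyclic_if_von_neumann_regular_lpa
      principal_iff_acyclic acyclic_if_approximately_quasi_compact approximately_quasi_compact_if_acyclic
    by blast
qed

end
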